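(* Let $\widetilde A$ be a proper extension of the minimal operator $L_0$ with nonempty resolvent set $\rho(\widetilde A)$. Then there exists a family of fundamental solutions $Z(\cdot,\lambda):\Delta\to[\mathcal K',H]$, $\lambda\in\rho(\widetilde A)$ (with $\mathcal K'$ a Hilbert space), of the equation $l[y]-\lambda y=0$ such that for every fixed $t\in\Delta$ all quasi-derivatives $Z^{[k]}(t,\cdot)$, $k=0,1,\dots,2n-1$, are holomorphic on $\rho(\widetilde A)$.
   Context: **Setting.** $[X,Y]$ is the set of bounded linear operators from a Hilbert space $X$ to a Hilbert space $Y$, $[X]=[X,X]$. $\Delta=[0,b\rangle$ with $0<b\le\infty$ (if $b<\infty$, $b$ may or may not belong to $\Delta$), $H$ is a separable complex Hilbert space ($\dim H\le\infty$), $D=d/dt$, and $$l[y]=\sum_{k=1}^n(-1)^k\Big(D^k(p_{n-k}D^ky)-\tfrac i2\big[D^{k-1}(q_{n-k}^*D^ky)+D^k(q_{n-k}D^{k-1}y)\big]\Big)+p_ny$$ with sufficiently smooth coefficients $p_k,q_k:\Delta\to[H]$, $p_k(t)=p_k^*(t)$, $p_0(t)^{-1}\in[H]$. Quasi-derivatives: $y^{[k]}=D^ky$ ($0\le k\le n-1$), $y^{[n]}=p_0D^ny-\frac i2q_0D^{n-1}y$, $y^{[n+k]}=-Dy^{[n+k-1]}+p_kD^{n-k}y+\frac i2(q_{k-1}^*D^{n-k+1}y-q_kD^{n-k-1}y)$ ($1\le k\le n-1$), $y^{[2n]}=-Dy^{[2n-1]}+p_ny+\frac i2q_{n-1}^*Dy=l[y]$;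 the same formulas apply to operator functions $Y:\Delta\to[\mathcal K,H]$. Put $y^{(1)}(t)=(y^{[0]}(t),\dots,y^{[n-1]}(t))$, $y^{(2)}(t)=(y^{[2n-1]}(t),\dots,y^{[n]}(t))$, $\widetilde y(t)=\{y^{(1)}(t),y^{(2)}(t)\}$. An operator solution of $l[y]-\lambda y=0$ is a function $Y:\Delta\to[\mathcal K,H]$ whose quasi-derivatives up to order $2n-1$ are continuously differentiable and which satisfies the equation. $\mathfrak H=L_2(\Delta;H)$. The maximal operator $L$ has domain $\mathcal D=\{y\in\mathfrak H:\ y^{[k]}\ (0\le k\le2n-2)$ continuously differentiable, $y^{[2n-1]}$ (locally) absolutely continuous, $l[y]\in\mathfrak H\}$ and $Ly=l[y]$. Put $[y,z](t)=(y^{(1)}(t),z^{(2)}(t))-(y^{(2)}(t),z^{(1)}(t))$, $[y,z](b)=\lim_{t\uparrow b}[y,z](t)$. The minimal operator $L_0$ is the restriction of $L$ to $\{y\in\mathcal D:\widetilde y(0)=0,\ [y,z](b)=0\ \forall z\in\mathcal D\}$; it is closed, densely defined, symmetric and $L_0^*=L$. $\mathfrak N_\lambda(L_0)=\mathrm{Ker}(L-\lambda)$. A proper extension of $L_0$ is a closed operator $\widetilde A$ in $\mathfrak H$ with $L_0\subset\widetilde A\subset L$. **Fundamental solution.** An operator function $Z(\cdot,\lambda):\Delta\to[\mathcal K',H]$ is a fundamental solution of $l[y]-\lambda y=0$ if (i) it is an operator solution of this equation; (ii) $Z(\cdot,\lambda)h'\in\mathfrak H$ for all $h'\in\mathcal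 K'$; (iii) for every $y\in\mathfrak N_\lambda(L_0)$ there is a unique $h'\in\mathcal K'$ with $y(t)=Z(t,\lambda)h'$. *)

theory Defs
  imports "HOL-Analysis.Analysis"
begin

section \<open>Complex Hilbert spaces\<close>

class scaleC =
  fixes scaleC :: "complex \<Rightarrow> 'a \<Rightarrow> 'a"  (infixr \<open>*\<^sub>C\<close> 75)

class complex_normed_vector = real_normed_vector + scaleC +
  assumes scaleC_add_right: "c *\<^sub>C (x + y) = c *\<^sub>C x + c *\<^sub>C y"
    and scaleC_add_left: "(c + d) *\<^sub>C x = c *\<^sub>C x + d *\<^sub>C x"
    and scaleC_scaleC: "c *\<^sub>C (d *\<^sub>C x) = (c * d) *\<^sub>C x"
    and scaleR_scaleC: "r *\<^sub>R x = complex_of_real r *\<^sub>C x"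
    and norm_scaleC: "norm (c *\<^sub>C x) = cmod c * norm x"

text \<open>The inner product is linear in the first argument. Its real part is the real inner product
  of the class \<^class>\<open>real_inner\<close>, which supplies positivity and the norm.\<close>

class complex_inner = complex_normed_vector + real_inner +
  fixes cinner :: "'a \<Rightarrow> 'a \<Rightarrow> complex"
  assumes cinner_commute: "cinner x y = cnj (cinner y x)"
    and cinner_add_left: "cinner (x + y) z = cinner x z + cinner y z"
    and cinner_scaleC_left: "cinner (c *\<^sub>C x) y = c * cinner x y"
    and inner_eq_Re_cinner: "inner x y = Re (cinner x y)"

class complex_hilbert = complex_inner + complete_space

subclass (in complex_hilbert) banach ..

definition csubspace :: "'a::complex_normed_vector set \<Rightarrow> bool" where
  "csubspace V \<longleftrightarrow> 0 \<in> V \<and> (\<forall>x\<in>V. \<forall>y\<in>V. x + y \<in> V) \<and> (\<forall>c. \<forall>x\<in>V. c *\<^sub>C x \<in> V)"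

lemma bounded_linear_scaleC: "bounded_linear (\<lambda>x::'a::complex_normed_vector. c *\<^sub>C x)"
proof (rule bounded_linear_intro[where K = "cmod c"])
  fix x y :: 'a and r :: real
  show "c *\<^sub>C (x + y) = c *\<^sub>C x + c *\<^sub>C y" by (rule scaleC_add_right)
  show "c *\<^sub>C (r *\<^sub>R x) = r *\<^sub>R (c *\<^sub>C x)"
    by (simp add: scaleR_scaleC scaleC_scaleC mult.commute)
  show "norm (c *\<^sub>C x) \<le> norm x * cmod c" by (simp add: norm_scaleC mult.commute)
qed

lemma cinner_eq:
  fixes x y :: "'a::complex_inner"
  shows "cinner x y = Complex (inner x y) (inner x (\<i> *\<^sub>C y))"
proof -
  have "cinner x (\<i> *\<^sub>C y) = cnj (cinner (\<i> *\<^sub>C y) x)" by (rule cinner_commute)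
  also have "\<dots> = - \<i> * cnj (cinner y x)" by (simp add: cinner_scaleC_left)
  also have "\<dots> = - \<i> * cinner x y" by (simp add: cinner_commute[of x y])
  finally show ?thesis by (simp add: inner_eq_Re_cinner complex_eq_iff)
qed


section \<open>Bounded operators\<close>

text \<open>The type \<^typ>\<open>'a \<Rightarrow>\<^sub>L 'b\<close> consists of the bounded real-linear maps; it carries the
  complex structure of \<^typ>\<open>'b\<close>, and \<open>[X,Y]\<close> is the subspace of its complex-linear members.\<close>

instantiation blinfun :: (real_normed_vector, complex_normed_vector) complex_normed_vector
begin

lift_definition scaleC_blinfun :: "complex \<Rightarrow> 'a \<Rightarrow>\<^sub>L 'b \<Rightarrow> 'a \<Rightarrow>\<^sub>L 'b"
  is "\<lambda>c f x. c *\<^sub>C f x"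
  by (rule bounded_linear_compose[OF bounded_linear_scaleC])

instance
proof
  fix c d :: complex and r :: real and x y :: "'a \<Rightarrow>\<^sub>L 'b"
  show "c *\<^sub>C (x + y) = c *\<^sub>C x + c *\<^sub>C y"
    by transfer (simp add: scaleC_add_right)
  show "(c + d) *\<^sub>C x = c *\<^sub>C x + d *\<^sub>C x"
    by transfer (simp add: scaleC_add_left)
  show "c *\<^sub>C (d *\<^sub>C x) = (c * d) *\<^sub>C x"
    by transfer (simp add: scaleC_scaleC)
  show "r *\<^sub>R x = complex_of_real r *\<^sub>C x"
    by transfer (simp add: scaleR_scaleC)
  show "norm (c *\<^sub>C x) = cmod c * norm x"
  proof transfer
    fix c :: complex and f :: "'a \<Rightarrow> 'b"
    assume f: "bounded_linear f"
    have "onorm (\<lambda>x. c *\<^sub>C f x) = onorm (\<lambda>x. cmod c *\<^sub>R f x)"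
      by (simp add: onorm_def norm_scaleC)
    also have "\<dots> = cmod c * onorm f"
      using onorm_scaleR[OF f, of "cmod c"] by simp
    finally show "onorm (\<lambda>x. c *\<^sub>C f x) = cmod c * onorm f" .
  qed
qed

end

definition complex_linear ::
    "('a::complex_normed_vector \<Rightarrow>\<^sub>L 'b::complex_normed_vector) \<Rightarrow> bool" where
  "complex_linear T \<longleftrightarrow> (\<forall>c x. T (c *\<^sub>C x) = c *\<^sub>C T x)"

text \<open>\<open>[K,Y]\<close> for a complete subspace \<open>K\<close> of \<^typ>\<open>'a\<close>: an operator on \<open>K\<close> is identified with
  its extension by \<open>0\<close> to the orthogonal complement of \<open>K\<close>. As \<open>K\<close> is complete it is complemented
  by its orthogonal complement, so restriction to \<open>K\<close> is an isometric isomorphism onto the bounded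
  operators from \<open>K\<close> to \<open>Y\<close>.\<close>

definition ops_on ::
    "'a::complex_inner set \<Rightarrow> ('a \<Rightarrow>\<^sub>L 'b::complex_normed_vector) set" where
  "ops_on K = {T. complex_linear T \<and> (\<forall>x. (\<forall>k\<in>K. cinner x k = 0) \<longrightarrow> T x = 0)}"

definition cadjoint ::
    "('a::complex_hilbert \<Rightarrow>\<^sub>L 'a) \<Rightarrow> ('a \<Rightarrow>\<^sub>L 'a)" where
  "cadjoint T = (THE S. \<forall>x y. cinner (blinfun_apply T x) y = cinner x (blinfun_apply S y))"

text \<open>Bounded invertibility: the inverse is complex-linear when \<open>T\<close> is.\<close>

definition has_bounded_inverse :: "('a::real_normed_vector \<Rightarrow>\<^sub>L 'a) \<Rightarrow> bool" where
  "has_bounded_inverse T \<longleftrightarrow> (\<exists>S. T o\<^sub>L S = id_blinfun \<and> S o\<^sub>L T = id_blinfun)"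

text \<open>Holomorphy in norm; for values in \<^typ>\<open>complex\<close> this is \<open>holomorphic_on\<close>.\<close>

definition vholomorphic_on :: "(complex \<Rightarrow> 'a::complex_normed_vector) \<Rightarrow> complex set \<Rightarrow> bool" where
  "vholomorphic_on f S \<longleftrightarrow>
    (\<forall>z\<in>S. \<exists>D. ((\<lambda>w. inverse (w - z) *\<^sub>C (f w - f z)) \<longlongrightarrow> D) (at z within S))"


section \<open>The space of square integrable functions\<close>

definition square_integrable :: "(real \<Rightarrow> 'a::real_normed_vector) \<Rightarrow> bool" where
  "square_integrable f \<longleftrightarrow>
    f \<in> borel_measurable lebesgue \<and> integrable lebesgue (\<lambda>t. (norm (f t))\<^sup>2)"

lemma square_integrable_add:
  fixes f g :: "real \<Rightarrow> 'a::{real_normed_vector, second_countable_topology}"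
  assumes "square_integrable f" "square_integrable g"
  shows "square_integrable (\<lambda>t. f t + g t)"
proof -
  have [measurable]: "f \<in> borel_measurable lebesgue" "g \<in> borel_measurable lebesgue"
    using assms by (auto simp: square_integrable_def)
  have "integrable lebesgue (\<lambda>t. 2 * (norm (f t))\<^sup>2 + 2 * (norm (g t))\<^sup>2)"
    using assms by (auto simp: square_integrable_def)
  then have "integrable lebesgue (\<lambda>t. (norm (f t + g t))\<^sup>2)"
  proof (rule Bochner_Integration.integrable_bound)
    have "(norm (f t + g t))\<^sup>2 \<le> 2 * (norm (f t))\<^sup>2 + 2 * (norm (g t))\<^sup>2" for t
    proof -
      have "(norm (f t + g t))\<^sup>2 \<le> (norm (f t) + norm (g t))\<^sup>2"
        by (intro power_mono norm_triangle_ineq) auto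
      also have "\<dots> \<le> 2 * (norm (f t))\<^sup>2 + 2 * (norm (g t))\<^sup>2"
        using sum_squares_ge_zero[of "norm (f t) - norm (g t)" 0]
        by (simp add: power2_eq_square algebra_simps)
      finally show ?thesis .
    qed
    then show "AE t in lebesgue. norm ((norm (f t + g t))\<^sup>2)
        \<le> norm (2 * (norm (f t))\<^sup>2 + 2 * (norm (g t))\<^sup>2)"
      by (intro AE_I2) simp
  qed measurable
  then show ?thesis unfolding square_integrable_def by simp
qed

lemma square_integrable_bounded_linear:
  fixes f :: "real \<Rightarrow> 'a::real_normed_vector"
    and T :: "'a \<Rightarrow> 'b::{real_normed_vector, second_countable_topology}"
  assumes "bounded_linear T" "square_integrable f"
  shows "square_integrable (\<lambda>t. T (f t))"
proof -
  have f[measurable]: "f \<in> borel_measurable lebesgue"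
    using assms by (auto simp: square_integrable_def)
  have T[measurable]: "T \<in> borel_measurable borel"
    by (intro borel_measurable_continuous_onI linear_continuous_on assms(1))
  have m[measurable]: "(\<lambda>t. T (f t)) \<in> borel_measurable lebesgue"
    by measurable
  obtain K where K: "\<And>x. norm (T x) \<le> norm x * K"
    using bounded_linear.bounded[OF assms(1)] by blast
  have "integrable lebesgue (\<lambda>t. K\<^sup>2 * (norm (f t))\<^sup>2)"
    using assms by (auto simp: square_integrable_def)
  then have "integrable lebesgue (\<lambda>t. (norm (T (f t)))\<^sup>2)"
  proof (rule Bochner_Integration.integrable_bound)
    have "(norm (T (f t)))\<^sup>2 \<le> K\<^sup>2 * (norm (f t))\<^sup>2" for t
      using power_mono[OF K[of "f t"], of 2] by (simp add: power_mult_distrib mult.commute)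
    then show "AE t in lebesgue. norm ((norm (T (f t)))\<^sup>2) \<le> norm (K\<^sup>2 * (norm (f t))\<^sup>2)"
      by (intro AE_I2) simp
  qed measurable
  then show ?thesis using m unfolding square_integrable_def by simp
qed

lemmas square_integrable_scaleC = square_integrable_bounded_linear[OF bounded_linear_scaleC]
lemmas square_integrable_scaleR = square_integrable_bounded_linear[OF bounded_linear_scaleR_right]

lemma square_integrable_zero: "square_integrable (\<lambda>t. 0)"
  by (simp add: square_integrable_def)

lemma square_integrable_inner:
  fixes f g :: "real \<Rightarrow> 'a::{real_inner, second_countable_topology}"
  assumes "square_integrable f" "square_integrable g"
  shows "integrable lebesgue (\<lambda>t. inner (f t) (g t))"
proof -
  have [measurable]: "f \<in> borel_measurable lebesgue" "g \<in> borel_measurable lebesgue"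
    using assms by (auto simp: square_integrable_def)
  have "integrable lebesgue (\<lambda>t. (norm (f t))\<^sup>2 + (norm (g t))\<^sup>2)"
    using assms by (auto simp: square_integrable_def)
  then show ?thesis
  proof (rule Bochner_Integration.integrable_bound)
    have "\<bar>inner (f t) (g t)\<bar> \<le> (norm (f t))\<^sup>2 + (norm (g t))\<^sup>2" for t
    proof -
      have "\<bar>inner (f t) (g t)\<bar> \<le> norm (f t) * norm (g t)" by (rule Cauchy_Schwarz_ineq2)
      also have "\<dots> \<le> (norm (f t))\<^sup>2 + (norm (g t))\<^sup>2"
        using sum_squares_bound[of "norm (f t)" "norm (g t)"]
          mult_nonneg_nonneg[OF norm_ge_zero[of "f t"] norm_ge_zero[of "g t"]] by linarith
      finally show ?thesis .
    qed
    then show "AE t in lebesgue. norm (inner (f t) (g t)) \<le> norm ((norm (f t))\<^sup>2 + (norm (g t))\<^sup>2)"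
      by (intro AE_I2) simp
  qed measurable
qed

lemma square_integrable_cinner:
  fixes f g :: "real \<Rightarrow> 'a::{complex_inner, second_countable_topology}"
  assumes "square_integrable f" "square_integrable g"
  shows "integrable lebesgue (\<lambda>t. cinner (f t) (g t))"
proof -
  have "integrable lebesgue (\<lambda>t. inner (f t) (g t))"
    "integrable lebesgue (\<lambda>t. inner (f t) (\<i> *\<^sub>C g t))"
    by (intro square_integrable_inner assms square_integrable_scaleC)+
  then have "integrable lebesgue (\<lambda>t. complex_of_real (inner (f t) (g t))
      + \<i> * complex_of_real (inner (f t) (\<i> *\<^sub>C g t)))"
    by (intro Bochner_Integration.integrable_add integrable_mult_right integrable_of_real)
  then show ?thesis by (simp add: cinner_eq Complex_eq)
qed

text \<open>\<open>L\<^sub>2(\<real>;H)\<close>, with \<open>L\<^sub>2(\<Delta>;H)\<close> below as its subspace of functions vanishing outside \<open>\<Delta>\<close>.\<close>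

quotient_type (overloaded) 'a L2 =
    "real \<Rightarrow> 'a::{complex_inner, second_countable_topology}" / partial:
  "\<lambda>f g. square_integrable f \<and> square_integrable g \<and> (AE t in lebesgue. f t = g t)"
proof (rule part_equivpI)
  show "\<exists>f::real \<Rightarrow> 'a. square_integrable f \<and> square_integrable f \<and> (AE t in lebesgue. f t = f t)"
    using square_integrable_zero by auto
  show "symp (\<lambda>f g. square_integrable f \<and> square_integrable g
      \<and> (AE t in lebesgue. f t = (g t::'a)))"
    by (auto simp: symp_def eq_commute)
  show "transp (\<lambda>f g. square_integrable f \<and> square_integrable g
      \<and> (AE t in lebesgue. f t = (g t::'a)))"
    unfolding transp_def
  proof (intro allI impI conjI)
    fix f g h :: "real \<Rightarrow> 'a"
    assume 1: "square_integrable f \<and> square_integrable g \<and> (AE t in lebesgue. f t = g t)"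
      and 2: "square_integrable g \<and> square_integrable h \<and> (AE t in lebesgue. g t = h t)"
    from 1 2 have "AE t in lebesgue. f t = g t" "AE t in lebesgue. g t = h t" by auto
    then show "AE t in lebesgue. f t = h t" by eventually_elim simp
  qed auto
qed

instantiation L2 :: ("{complex_inner, second_countable_topology}") real_inner
begin

lift_definition zero_L2 :: "'a L2" is "\<lambda>t. 0"
  by (simp add: square_integrable_zero)

lift_definition plus_L2 :: "'a L2 \<Rightarrow> 'a L2 \<Rightarrow> 'a L2" is "\<lambda>f g t. f t + g t"
proof (intro conjI)
  fix f f' g g' :: "real \<Rightarrow> 'a"
  assume 1: "square_integrable f \<and> square_integrable f' \<and> (AE t in lebesgue. f t = f' t)"
    and 2: "square_integrable g \<and> square_integrable g' \<and> (AE t in lebesgue. g t = g' t)"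
  then have "AE t in lebesgue. f t = f' t" "AE t in lebesgue. g t = g' t" by auto
  then show "AE t in lebesgue. f t + g t = f' t + g' t" by eventually_elim simp
qed (auto intro: square_integrable_add)

lift_definition scaleR_L2 :: "real \<Rightarrow> 'a L2 \<Rightarrow> 'a L2" is "\<lambda>r f t. r *\<^sub>R f t"
  by (auto intro: square_integrable_scaleR)

definition uminus_L2 :: "'a L2 \<Rightarrow> 'a L2" where "uminus_L2 u = (- 1) *\<^sub>R u"

definition minus_L2 :: "'a L2 \<Rightarrow> 'a L2 \<Rightarrow> 'a L2" where "minus_L2 u v = u + - v"

lift_definition inner_L2 :: "'a L2 \<Rightarrow> 'a L2 \<Rightarrow> real"
  is "\<lambda>f g. \<integral>t. inner (f t) (g t) \<partial>lebesgue"
proof -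
  fix f f' g g' :: "real \<Rightarrow> 'a"
  assume 1: "square_integrable f \<and> square_integrable f' \<and> (AE t in lebesgue. f t = f' t)"
    and 2: "square_integrable g \<and> square_integrable g' \<and> (AE t in lebesgue. g t = g' t)"
  then have "AE t in lebesgue. f t = f' t" "AE t in lebesgue. g t = g' t" by auto
  then have "AE t in lebesgue. inner (f t) (g t) = inner (f' t) (g' t)" by eventually_elim simp
  then show "(\<integral>t. inner (f t) (g t) \<partial>lebesgue) = (\<integral>t. inner (f' t) (g' t) \<partial>lebesgue)"
    using 1 2 by (intro integral_cong_AE borel_measurable_integrable square_integrable_inner) auto
qed

definition norm_L2 :: "'a L2 \<Rightarrow> real" where "norm_L2 u = sqrt (inner u u)"

definition sgn_L2 :: "'a L2 \<Rightarrow> 'a L2" where "sgn_L2 u = inverse (norm u) *\<^sub>R u"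

definition dist_L2 :: "'a L2 \<Rightarrow> 'a L2 \<Rightarrow> real" where "dist_L2 u v = norm (u - v)"

definition uniformity_L2 :: "('a L2 \<times> 'a L2) filter" where
  "uniformity_L2 = (INF e\<in>{0 <..}. principal {(x, y). dist x y < e})"

definition open_L2 :: "'a L2 set \<Rightarrow> bool" where
  "open_L2 S \<longleftrightarrow> (\<forall>x\<in>S. \<forall>\<^sub>F (x', y) in uniformity. x' = x \<longrightarrow> y \<in> S)"

instance
proof
  fix u v w :: "'a L2" and r s :: real
  show "u + v + w = u + (v + w)"
    by transfer (auto intro!: square_integrable_add simp: add.assoc)
  show "u + v = v + u"
    by transfer (auto intro!: square_integrable_add simp: add.commute)
  show "0 + u = u"
    by transfer auto
  show "- u + u = 0"
    unfolding uminus_L2_def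
    by transfer (auto intro!: square_integrable_add square_integrable_scaleR square_integrable_zero)
  show "u - v = u + - v" by (rule minus_L2_def)
  show "r *\<^sub>R (u + v) = r *\<^sub>R u + r *\<^sub>R v"
    by transfer (auto intro!: square_integrable_add square_integrable_scaleR simp: scaleR_add_right)
  show "(r + s) *\<^sub>R u = r *\<^sub>R u + s *\<^sub>R u"
    by transfer (auto intro!: square_integrable_add square_integrable_scaleR simp: scaleR_add_left)
  show "r *\<^sub>R s *\<^sub>R u = (r * s) *\<^sub>R u"
    by transfer (auto intro!: square_integrable_scaleR)
  show "1 *\<^sub>R u = u"
    by transfer auto
  show "inner u v = inner v u"
    by transfer (simp add: inner_commute)
  show "inner (u + v) w = inner u w + inner v w"
    by transfer (simp add: inner_add_left square_integrable_inner)
  show "inner (r *\<^sub>R u) v = r * inner u v"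
    by transfer simp
  show "0 \<le> inner u u"
    by transfer simp
  show "inner u u = 0 \<longleftrightarrow> u = 0"
  proof transfer
    fix f :: "real \<Rightarrow> 'a"
    assume f: "square_integrable f \<and> square_integrable f \<and> (AE t in lebesgue. f t = f t)"
    have "(\<integral>t. inner (f t) (f t) \<partial>lebesgue) = 0 \<longleftrightarrow> (AE t in lebesgue. inner (f t) (f t) = 0)"
      using f by (intro integral_nonneg_eq_0_iff_AE square_integrable_inner) auto
    then show "((\<integral>t. inner (f t) (f t) \<partial>lebesgue) = 0) =
        (square_integrable f \<and> square_integrable (\<lambda>t. 0) \<and> (AE t in lebesgue. f t = 0))"
      using f by (simp add: square_integrable_zero)
  qed
  show "norm u = sqrt (inner u u)" by (rule norm_L2_def)
  show "sgn u = inverse (norm u) *\<^sub>R u" by (rule sgn_L2_def)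
  show "dist u v = norm (u - v)" by (rule dist_L2_def)
  show "uniformity = (INF e\<in>{0 <..}. principal {(x, y::'a L2). dist x y < e})"
    by (rule uniformity_L2_def)
  show "open S \<longleftrightarrow> (\<forall>x\<in>S. \<forall>\<^sub>F (x', y) in uniformity. x' = x \<longrightarrow> y \<in> S)" for S :: "'a L2 set"
    by (rule open_L2_def)
qed

end

instantiation L2 :: ("{complex_inner, second_countable_topology}") complex_inner
begin

lift_definition scaleC_L2 :: "complex \<Rightarrow> 'a L2 \<Rightarrow> 'a L2" is "\<lambda>c f t. c *\<^sub>C f t"
  by (auto intro: square_integrable_scaleC)

lift_definition cinner_L2 :: "'a L2 \<Rightarrow> 'a L2 \<Rightarrow> complex"
  is "\<lambda>f g. \<integral>t. cinner (f t) (g t) \<partial>lebesgue"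
proof -
  fix f f' g g' :: "real \<Rightarrow> 'a"
  assume 1: "square_integrable f \<and> square_integrable f' \<and> (AE t in lebesgue. f t = f' t)"
    and 2: "square_integrable g \<and> square_integrable g' \<and> (AE t in lebesgue. g t = g' t)"
  then have "AE t in lebesgue. f t = f' t" "AE t in lebesgue. g t = g' t" by auto
  then have "AE t in lebesgue. cinner (f t) (g t) = cinner (f' t) (g' t)" by eventually_elim simp
  then show "(\<integral>t. cinner (f t) (g t) \<partial>lebesgue) = (\<integral>t. cinner (f' t) (g' t) \<partial>lebesgue)"
    using 1 2 by (intro integral_cong_AE borel_measurable_integrable square_integrable_cinner) auto
qed

instance
proof
  fix u v w :: "'a L2" and r :: real and c d :: complex
  show "c *\<^sub>C (u + v) = c *\<^sub>C u + c *\<^sub>C v"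
    by transfer (auto intro!: square_integrable_add square_integrable_scaleC simp: scaleC_add_right)
  show "(c + d) *\<^sub>C u = c *\<^sub>C u + d *\<^sub>C u"
    by transfer (auto intro!: square_integrable_add square_integrable_scaleC simp: scaleC_add_left)
  show "c *\<^sub>C (d *\<^sub>C u) = (c * d) *\<^sub>C u"
    by transfer (auto intro!: square_integrable_scaleC simp: scaleC_scaleC)
  show "r *\<^sub>R u = complex_of_real r *\<^sub>C u"
    by transfer (auto intro!: square_integrable_scaleC square_integrable_scaleR
        simp: scaleR_scaleC[symmetric])
  show "cinner u v = cnj (cinner v u)"
  proof transfer
    fix f g :: "real \<Rightarrow> 'a"
    have "(\<integral>t. cinner (f t) (g t) \<partial>lebesgue) = (\<integral>t. cnj (cinner (g t) (f t)) \<partial>lebesgue)"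
      by (rule Bochner_Integration.integral_cong[OF refl]) (rule cinner_commute)
    then show "(\<integral>t. cinner (f t) (g t) \<partial>lebesgue) = cnj (\<integral>t. cinner (g t) (f t) \<partial>lebesgue)"
      by simp
  qed
  show "cinner (u + v) w = cinner u w + cinner v w"
    by transfer (simp add: cinner_add_left square_integrable_cinner)
  show "cinner (c *\<^sub>C u) v = c * cinner u v"
    by transfer (simp add: cinner_scaleC_left)
  show "inner u v = Re (cinner u v)"
    by transfer (simp add: inner_eq_Re_cinner integral_Re square_integrable_cinner)
  have "inner (c *\<^sub>C u) (c *\<^sub>C u) = (cmod c)\<^sup>2 * inner u u"
    by transfer (simp add: power2_norm_eq_inner[symmetric] norm_scaleC power_mult_distrib)
  then show "norm (c *\<^sub>C u) = cmod c * norm u"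
    by (simp add: norm_eq_sqrt_inner real_sqrt_mult)
qed

end

text \<open>Values of functions on \<open>\<Delta>\<close> outside \<open>\<Delta>\<close> are irrelevant throughout.\<close>

definition ext0 :: "real set \<Rightarrow> (real \<Rightarrow> 'a::real_vector) \<Rightarrow> real \<Rightarrow> 'a" where
  "ext0 \<Delta> y = (\<lambda>t. if t \<in> \<Delta> then y t else 0)"

definition in_L2 :: "real set \<Rightarrow> (real \<Rightarrow> 'a::real_normed_vector) \<Rightarrow> bool" where
  "in_L2 \<Delta> y \<longleftrightarrow> square_integrable (ext0 \<Delta> y)"

definition L2_class ::
    "real set \<Rightarrow> (real \<Rightarrow> 'a::{complex_inner, second_countable_topology}) \<Rightarrow> 'a L2" where
  "L2_class \<Delta> y = abs_L2 (ext0 \<Delta> y)"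

definition L2_on :: "real set \<Rightarrow> 'a::{complex_inner, second_countable_topology} L2 set" where
  "L2_on \<Delta> = {L2_class \<Delta> y |y. in_L2 \<Delta> y}"


section \<open>Unbounded operators\<close>

text \<open>An operator is identified with its graph, so that extension of operators is inclusion.\<close>

definition closed_operator_in ::
    "'a::complex_normed_vector set \<Rightarrow> ('a \<times> 'a) set \<Rightarrow> bool" where
  "closed_operator_in X A \<longleftrightarrow>
    A \<subseteq> X \<times> X \<and> single_valued A \<and>
    (0, 0) \<in> A \<and>
    (\<forall>u f v g. (u, f) \<in> A \<longrightarrow> (v, g) \<in> A \<longrightarrow> (u + v, f + g) \<in> A) \<and>
    (\<forall>c u f. (u, f) \<in> A \<longrightarrow> (c *\<^sub>C u, c *\<^sub>C f) \<in> A) \<and>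
    closed A"

text \<open>\<open>\<mu>\<close> is in the resolvent set of \<open>A\<close> iff \<open>A - \<mu>\<close> maps its domain bijectively onto \<open>X\<close> with
  bounded inverse.\<close>

definition resolvent_set ::
    "'a::complex_normed_vector set \<Rightarrow> ('a \<times> 'a) set \<Rightarrow> complex set" where
  "resolvent_set X A = {\<mu>.
    (\<forall>g\<in>X. \<exists>!u. \<exists>f. (u, f) \<in> A \<and> f - \<mu> *\<^sub>C u = g) \<and>
    (\<exists>C. \<forall>u f. (u, f) \<in> A \<longrightarrow> norm u \<le> C * norm (f - \<mu> *\<^sub>C u))}"


section \<open>Differentiability on an interval\<close>

text \<open>Derivatives are taken within \<open>\<Delta>\<close>, i.e. one-sided at end points belonging to \<open>\<Delta>\<close>.\<close>

definition D :: "real set \<Rightarrow> (real \<Rightarrow> 'v::real_normed_vector) \<Rightarrow> real \<Rightarrow> 'v" where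
  "D \<Delta> y = (\<lambda>t. vector_derivative y (at t within \<Delta>))"

definition differentiable_in :: "real set \<Rightarrow> (real \<Rightarrow> 'v::real_normed_vector) \<Rightarrow> bool" where
  "differentiable_in \<Delta> y \<longleftrightarrow> (\<forall>t\<in>\<Delta>. y differentiable (at t within \<Delta>))"

definition Ck_on :: "nat \<Rightarrow> real set \<Rightarrow> (real \<Rightarrow> 'v::real_normed_vector) \<Rightarrow> bool" where
  "Ck_on m \<Delta> y \<longleftrightarrow>
    (\<forall>j<m. differentiable_in \<Delta> ((D \<Delta> ^^ j) y)) \<and> continuous_on \<Delta> ((D \<Delta> ^^ m) y)"

definition locally_absolutely_continuous_on ::
    "real set \<Rightarrow> (real \<Rightarrow> 'v::real_normed_vector) \<Rightarrow> bool" where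
  "locally_absolutely_continuous_on \<Delta> y \<longleftrightarrow>
    (\<forall>c d. {c..d} \<subseteq> \<Delta> \<longrightarrow>
      (\<forall>\<epsilon>>0. \<exists>\<delta>>0. \<forall>(m::nat) \<alpha> \<beta>.
        (\<forall>i<m. c \<le> \<alpha> i \<and> \<alpha> i \<le> \<beta> i \<and> \<beta> i \<le> d) \<longrightarrow>
        (\<forall>i<m. \<forall>j<m. i \<noteq> j \<longrightarrow> {\<alpha> i<..<\<beta> i} \<inter> {\<alpha> j<..<\<beta> j} = {}) \<longrightarrow>
        (\<Sum>i<m. \<beta> i - \<alpha> i) < \<delta> \<longrightarrow>
        (\<Sum>i<m. norm (y (\<beta> i) - y (\<alpha> i))) < \<epsilon>))"


section \<open>The differential expression\<close>

text \<open>The quasi-derivatives are needed for vector functions \<open>\<Delta> \<Rightarrow> H\<close> and operator functions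
  \<open>\<Delta> \<Rightarrow> [K,H]\<close>. The parameter \<open>act\<close> is the action of a coefficient on the values: application
  of operators in the first case, composition in the second. The function
  \<open>upper_quasi_deriv\<close> is \<open>y\<^bsup>[n+k]\<^esup>\<close>, where at \<open>k = n\<close> the term with the (absent) coefficient
  \<open>q\<^bsub>n\<^esub>\<close> is dropped.\<close>

primrec upper_quasi_deriv ::
    "('h::complex_hilbert \<Rightarrow>\<^sub>L 'h \<Rightarrow> 'v::complex_normed_vector \<Rightarrow> 'v) \<Rightarrow> real set \<Rightarrow> nat \<Rightarrow>
     (nat \<Rightarrow> real \<Rightarrow> 'h \<Rightarrow>\<^sub>L 'h) \<Rightarrow> (nat \<Rightarrow> real \<Rightarrow> 'h \<Rightarrow>\<^sub>L 'h) \<Rightarrow>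
     (real \<Rightarrow> 'v) \<Rightarrow> nat \<Rightarrow> real \<Rightarrow> 'v" where
  "upper_quasi_deriv act \<Delta> n p q y 0 = (\<lambda>t.
     act (p 0 t) ((D \<Delta> ^^ n) y t) - (\<i> / 2) *\<^sub>C act (q 0 t) ((D \<Delta> ^^ (n - 1)) y t))"
| "upper_quasi_deriv act \<Delta> n p q y (Suc j) = (\<lambda>t.
     - D \<Delta> (upper_quasi_deriv act \<Delta> n p q y j) t
     + (let k = Suc j in
         act (p k t) ((D \<Delta> ^^ (n - k)) y t)
         + (\<i> / 2) *\<^sub>C (act (cadjoint (q (k - 1) t)) ((D \<Delta> ^^ (n - k + 1)) y t)
             - (if k < n then act (q k t) ((D \<Delta> ^^ (n - k - 1)) y t) else 0))))"

definition quasi_deriv ::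
    "('h::complex_hilbert \<Rightarrow>\<^sub>L 'h \<Rightarrow> 'v::complex_normed_vector \<Rightarrow> 'v) \<Rightarrow> real set \<Rightarrow> nat \<Rightarrow>
     (nat \<Rightarrow> real \<Rightarrow> 'h \<Rightarrow>\<^sub>L 'h) \<Rightarrow> (nat \<Rightarrow> real \<Rightarrow> 'h \<Rightarrow>\<^sub>L 'h) \<Rightarrow>
     nat \<Rightarrow> (real \<Rightarrow> 'v) \<Rightarrow> real \<Rightarrow> 'v" where
  "quasi_deriv act \<Delta> n p q k y =
     (if k < n then (D \<Delta> ^^ k) y else upper_quasi_deriv act \<Delta> n p q y (k - n))"

abbreviation "quasi_deriv_vec \<equiv> quasi_deriv blinfun_apply"
abbreviation "quasi_deriv_op \<equiv> quasi_deriv blinfun_compose"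

text \<open>The expression
  \<open>l[y] = \<Sum>k=1..n. (-1)^k (D^k (p\<^bsub>n-k\<^esub> D^k y) - i/2 (D^(k-1) (q\<^bsub>n-k\<^esub>* D^k y) + D^k (q\<^bsub>n-k\<^esub> D^(k-1) y))) + p\<^bsub>n\<^esub> y\<close>
  in its quasi-derivative form \<open>y\<^bsup>[2n]\<^esup>\<close>, which is the form that makes sense on the whole domain
  of the maximal operator.\<close>

abbreviation "l_vec \<Delta> n p q \<equiv> quasi_deriv_vec \<Delta> n p q (2 * n)"
abbreviation "l_op \<Delta> n p q \<equiv> quasi_deriv_op \<Delta> n p q (2 * n)"


section \<open>Maximal and minimal operators\<close>

text \<open>The domain of the maximal operator, as a set of functions. The almost everywhere
  differentiability of \<open>y\<^bsup>[2n-1]\<^esup>\<close> is what gives \<open>l[y]\<close> its meaning; it is automatic for a locally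
  absolutely continuous function with values in a Hilbert space.\<close>

definition max_dom ::
    "real set \<Rightarrow> nat \<Rightarrow> (nat \<Rightarrow> real \<Rightarrow> 'h \<Rightarrow>\<^sub>L 'h) \<Rightarrow> (nat \<Rightarrow> real \<Rightarrow> 'h \<Rightarrow>\<^sub>L 'h) \<Rightarrow>
     (real \<Rightarrow> 'h::{complex_hilbert, second_countable_topology}) set" where
  "max_dom \<Delta> n p q = {y. in_L2 \<Delta> y \<and>
     (\<forall>k\<le>2 * n - 2. Ck_on 1 \<Delta> (quasi_deriv_vec \<Delta> n p q k y)) \<and>
     locally_absolutely_continuous_on \<Delta> (quasi_deriv_vec \<Delta> n p q (2 * n - 1) y) \<and>
     (AE t in lebesgue. t \<in> \<Delta> \<longrightarrow>
        quasi_deriv_vec \<Delta> n p q (2 * n - 1) y differentiable (at t within \<Delta>)) \<and>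
     in_L2 \<Delta> (l_vec \<Delta> n p q y)}"

definition max_op ::
    "real set \<Rightarrow> nat \<Rightarrow> (nat \<Rightarrow> real \<Rightarrow> 'h \<Rightarrow>\<^sub>L 'h) \<Rightarrow> (nat \<Rightarrow> real \<Rightarrow> 'h \<Rightarrow>\<^sub>L 'h) \<Rightarrow>
     ('h::{complex_hilbert, second_countable_topology} L2 \<times> 'h L2) set" where
  "max_op \<Delta> n p q =
     {(L2_class \<Delta> y, L2_class \<Delta> (l_vec \<Delta> n p q y)) |y. y \<in> max_dom \<Delta> n p q}"

definition lagrange_form ::
    "real set \<Rightarrow> nat \<Rightarrow> (nat \<Rightarrow> real \<Rightarrow> 'h \<Rightarrow>\<^sub>L 'h) \<Rightarrow> (nat \<Rightarrow> real \<Rightarrow> 'h \<Rightarrow>\<^sub>L 'h) \<Rightarrow>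
     (real \<Rightarrow> 'h::complex_hilbert) \<Rightarrow> (real \<Rightarrow> 'h) \<Rightarrow> real \<Rightarrow> complex" where
  "lagrange_form \<Delta> n p q y z t =
     (let y' = (\<lambda>k. quasi_deriv_vec \<Delta> n p q k y t); z' = (\<lambda>k. quasi_deriv_vec \<Delta> n p q k z t) in
       (\<Sum>j<n. cinner (y' j) (z' (2 * n - 1 - j))) - (\<Sum>j<n. cinner (y' (2 * n - 1 - j)) (z' j)))"

text \<open>The limit \<open>t \<up> b\<close> is taken along \<open>at_left b\<close> in the extended reals, to cover \<open>b = \<infinity>\<close>.\<close>

definition min_op ::
    "ereal \<Rightarrow> real set \<Rightarrow> nat \<Rightarrow> (nat \<Rightarrow> real \<Rightarrow> 'h \<Rightarrow>\<^sub>L 'h) \<Rightarrow> (nat \<Rightarrow> real \<Rightarrow> 'h \<Rightarrow>\<^sub>L 'h) \<Rightarrow>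
     ('h::{complex_hilbert, second_countable_topology} L2 \<times> 'h L2) set" where
  "min_op b \<Delta> n p q =
     {(L2_class \<Delta> y, L2_class \<Delta> (l_vec \<Delta> n p q y)) |y. y \<in> max_dom \<Delta> n p q \<and>
        (\<forall>k<2 * n. quasi_deriv_vec \<Delta> n p q k y 0 = 0) \<and>
        (\<forall>z\<in>max_dom \<Delta> n p q.
           ((lagrange_form \<Delta> n p q y z \<circ> real_of_ereal) \<longlongrightarrow> 0) (at_left b))}"

definition proper_extension ::
    "ereal \<Rightarrow> real set \<Rightarrow> nat \<Rightarrow> (nat \<Rightarrow> real \<Rightarrow> 'h \<Rightarrow>\<^sub>L 'h) \<Rightarrow> (nat \<Rightarrow> real \<Rightarrow> 'h \<Rightarrow>\<^sub>L 'h) \<Rightarrow>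
     ('h::{complex_hilbert, second_countable_topology} L2 \<times> 'h L2) set \<Rightarrow> bool" where
  "proper_extension b \<Delta> n p q A \<longleftrightarrow>
     closed_operator_in (L2_on \<Delta>) A \<and> min_op b \<Delta> n p q \<subseteq> A \<and> A \<subseteq> max_op \<Delta> n p q"

text \<open>\<open>Ker (L - \<mu>)\<close>, as a set of functions in the domain of \<open>L\<close>.\<close>

definition defect_space ::
    "real set \<Rightarrow> nat \<Rightarrow> (nat \<Rightarrow> real \<Rightarrow> 'h \<Rightarrow>\<^sub>L 'h) \<Rightarrow> (nat \<Rightarrow> real \<Rightarrow> 'h \<Rightarrow>\<^sub>L 'h) \<Rightarrow>
     complex \<Rightarrow> (real \<Rightarrow> 'h::{complex_hilbert, second_countable_topology}) set" where
  "defect_space \<Delta> n p q \<mu> =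
     {y \<in> max_dom \<Delta> n p q. L2_class \<Delta> (l_vec \<Delta> n p q y) = \<mu> *\<^sub>C L2_class \<Delta> y}"


section \<open>Fundamental solutions\<close>

definition operator_solution ::
    "real set \<Rightarrow> nat \<Rightarrow> (nat \<Rightarrow> real \<Rightarrow> 'h \<Rightarrow>\<^sub>L 'h) \<Rightarrow> (nat \<Rightarrow> real \<Rightarrow> 'h \<Rightarrow>\<^sub>L 'h) \<Rightarrow>
     complex \<Rightarrow> 'k::complex_inner set \<Rightarrow> (real \<Rightarrow> 'k \<Rightarrow>\<^sub>L 'h::complex_hilbert) \<Rightarrow> bool" where
  "operator_solution \<Delta> n p q \<mu> K Y \<longleftrightarrow>
     (\<forall>t\<in>\<Delta>. Y t \<in> ops_on K) \<and>
     (\<forall>k\<le>2 * n - 1. Ck_on 1 \<Delta> (quasi_deriv_op \<Delta> n p q k Y)) \<and>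
     (\<forall>t\<in>\<Delta>. l_op \<Delta> n p q Y t - \<mu> *\<^sub>C Y t = 0)"

definition fundamental_solution ::
    "real set \<Rightarrow> nat \<Rightarrow> (nat \<Rightarrow> real \<Rightarrow> 'h \<Rightarrow>\<^sub>L 'h) \<Rightarrow> (nat \<Rightarrow> real \<Rightarrow> 'h \<Rightarrow>\<^sub>L 'h) \<Rightarrow>
     complex \<Rightarrow> 'k::complex_inner set \<Rightarrow>
     (real \<Rightarrow> 'k \<Rightarrow>\<^sub>L 'h::{complex_hilbert, second_countable_topology}) \<Rightarrow> bool" where
  "fundamental_solution \<Delta> n p q \<mu> K Z \<longleftrightarrow>
     operator_solution \<Delta> n p q \<mu> K Z \<and>
     (\<forall>h\<in>K. in_L2 \<Delta> (\<lambda>t. Z t h)) \<and>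
     (\<forall>y\<in>defect_space \<Delta> n p q \<mu>. \<exists>!h. h \<in> K \<and> (\<forall>t\<in>\<Delta>. y t = Z t h))"

end

theory Submission
  imports Defs
begin

text \<open>Write \<open>l[y] = f\<close> as a first-order system for the quasi-derivatives \<open>u\<^sub>k = y\<^bsup>[k]\<^esup>\<close>. Its matrix is lower
  Hessenberg with invertible superdiagonal, so averaging over short intervals recovers every \<open>u\<^sub>k\<close>
  from \<open>y\<close>, and on compact intervals the quasi-derivatives are bounded by the \<open>L\<^sub>2\<close> norms of \<open>y\<close> and
  \<open>f\<close>. Point evaluations are therefore continuous for the graph norm of the maximal operator.

  Fix \<open>\<nu>\<close> in the resolvent set, let \<open>K' = Ker (L - \<nu>)\<close> and \<open>R(\<mu>)\<close> be the resolvent. Then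
  \<open>U(\<mu>) = I + (\<mu> - \<nu>) R(\<mu>)\<close> maps \<open>K'\<close> bijectively onto \<open>Ker (L - \<mu>)\<close>, and \<open>Z(t,\<mu>)\<close> is \<open>U(\<mu>)\<close> followed
  by evaluation at \<open>t\<close>. Holomorphy in \<open>\<mu>\<close> comes from the resolvent identity; differentiability in
  norm with respect to \<open>t\<close> comes from the uniform bounds on the quasi-derivatives.\<close>

section \<open>Complex Hilbert spaces and bounded operators\<close>

text \<open>The obstacle is that elements of \<open>K'\<close> are classes in \<open>L2\<close>,
  while \<open>Z(t, \<mu>)\<close> and its quasi-derivatives are pointwise objects; everything rests
  on the a priori bound by the graph norm. Only \<open>y\<close> and \<open>f\<close> are controlled
  in the mean. Averaging the derivative of a component over a window of length \<open>d\<close>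
  gives a difference quotient of that component and so costs a factor \<open>1/d\<close>. Each
  component is therefore bounded by an arbitrarily small multiple of the supremum \<open>S\<close>
  of all components plus a multiple of the data, and only at the end is \<open>S\<close> absorbed.
  As \<open>f\<close> is merely square integrable, its contribution to an increment is of order
  \<open>sqrt d\<close>.

  Formally \<open>U(\<mu>)\<close> is \<open>(A - \<nu>) (A - \<mu>)^-1\<close>. For
  \<open>v\<close> in \<open>Ker (L - \<nu>)\<close> one gets \<open>(L - \<mu>) U(\<mu>) v = (\<nu>
  - \<mu>) v + (\<mu> - \<nu>) v = 0\<close>, because \<open>A\<close> is a part of
  \<open>L\<close>; exchanging \<open>\<mu>\<close> and \<open>\<nu>\<close> gives the inverse. All
  \<open>U(\<mu>)\<close> start from the same space \<open>K'\<close>, so operators for different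
  \<open>\<mu>\<close> can be subtracted and holomorphy in norm makes sense.\<close>

lemma scaleC_zero_right [simp]: "c *\<^sub>C (0::'a::complex_normed_vector) = 0"
  using norm_scaleC[of c "0::'a"] by simp

lemma scaleC_zero_left [simp]: "0 *\<^sub>C x = (0::'a::complex_normed_vector)"
  using norm_scaleC[of 0 x] by simp

lemma scaleC_one [simp]: "1 *\<^sub>C x = (x::'a::complex_normed_vector)"
  using scaleR_scaleC[of 1 x] by simp

lemma scaleC_diff: "c *\<^sub>C (x - y) = c *\<^sub>C x - c *\<^sub>C (y::'a::complex_normed_vector)"
  by (rule linear_diff[OF bounded_linear.linear[OF bounded_linear_scaleC]])

lemma scaleC_minus_right: "c *\<^sub>C (- x) = - (c *\<^sub>C (x::'a::complex_normed_vector))"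
  using scaleC_diff[of c 0 x] by simp

lemma scaleC_sum: "c *\<^sub>C (\<Sum>i\<in>I. f i) = (\<Sum>i\<in>I. c *\<^sub>C (f i :: 'b::complex_normed_vector))"
  by (induction I rule: infinite_finite_induct) (auto simp: scaleC_add_right)

lemma complex_linear_intros:
  "complex_linear 0" "complex_linear id_blinfun"
  "complex_linear S \<Longrightarrow> complex_linear T \<Longrightarrow> complex_linear (S + T)"
  "complex_linear S \<Longrightarrow> complex_linear (- S)"
  "complex_linear S \<Longrightarrow> complex_linear (c *\<^sub>C S)"
  "complex_linear S \<Longrightarrow> complex_linear T' \<Longrightarrow> complex_linear (S o\<^sub>L T')"
  by (simp_all add: complex_linear_def blinfun.add_left blinfun.minus_left scaleC_add_right scaleC_minus_right
      scaleC_blinfun.rep_eq scaleC_scaleC mult.commute)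

text \<open>A minimising sequence for the distance to \<open>V\<close> is Cauchy by the
  parallelogram law, applied to midpoints, which stay in \<open>V\<close>. Minimality of the limit
  in every direction \<open>w\<close> then forces orthogonality.\<close>

lemma projection_exists:
  fixes V :: "'a::real_inner set"
  assumes V: "complete V" "0 \<in> V" "\<And>u v. u \<in> V \<Longrightarrow> v \<in> V \<Longrightarrow> u + v \<in> V" "\<And>r u. u \<in> V \<Longrightarrow> r *\<^sub>R u \<in> V"
  obtains p where "p \<in> V" "\<And>v. v \<in> V \<Longrightarrow> inner (x - p) v = 0"
proof -
  define d where "d = (INF v\<in>V. (norm (x - v))\<^sup>2)"
  have bdd: "bdd_below ((\<lambda>v. (norm (x - v))\<^sup>2) ` V)" by (rule bdd_belowI[of _ 0]) auto
  have d_le: "d \<le> (norm (x - v))\<^sup>2" if "v \<in> V" for v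
    unfolding d_def by (rule cINF_lower[OF bdd that])
  have near: "\<exists>v\<in>V. (norm (x - v))\<^sup>2 < d + e" if "e > 0" for e
    using cINF_less_iff[OF _ bdd, of "d + e"] \<open>0 \<in> V\<close> that unfolding d_def[symmetric] by auto
  define r where "r m = inverse (real (Suc m))" for m
  have r: "r m > 0" for m by (simp add: r_def)
  have "\<forall>m. \<exists>v\<in>V. (norm (x - v))\<^sup>2 < d + r m" using near r by blast
  then obtain v where v: "\<And>m. v m \<in> V" "\<And>m. (norm (x - v m))\<^sup>2 < d + r m" by metis
  have dist_le: "(norm (v m - v k))\<^sup>2 \<le> 2 * (r m + r k)" for m k
  proof -
    have "(1/2::real) *\<^sub>R (v m + v k) \<in> V" using V v by blast
    then have "4 * d \<le> 4 * (norm (x - (1/2::real) *\<^sub>R (v m + v k)))\<^sup>2" using d_le by auto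
    also have "\<dots> = 2 * (norm (x - v m))\<^sup>2 + 2 * (norm (x - v k))\<^sup>2 - (norm (v m - v k))\<^sup>2"
      by (simp add: power2_norm_eq_inner inner_diff_left inner_diff_right inner_add_left inner_add_right
          inner_commute algebra_simps)
    finally show ?thesis using v(2)[of m] v(2)[of k] by simp
  qed
  have "Cauchy v"
  proof (rule metric_CauchyI)
    fix e :: real assume e: "e > 0"
    then have "e\<^sup>2 / 4 > 0" by simp
    then obtain M where M: "r M < e\<^sup>2 / 4" using reals_Archimedean unfolding r_def by blast
    show "\<exists>M. \<forall>m\<ge>M. \<forall>k\<ge>M. dist (v m) (v k) < e"
    proof (intro exI allI impI)
      fix m k assume mk: "m \<ge> M" "k \<ge> M"
      have "r m \<le> r M" "r k \<le> r M"
        using mk by (auto simp: r_def)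
      then have "2 * (r m + r k) < e\<^sup>2" using M by simp
      with dist_le[of m k] have "(norm (v m - v k))\<^sup>2 < e\<^sup>2" by (rule order_le_less_trans)
      then show "dist (v m) (v k) < e" using e by (simp add: dist_norm power2_less_imp_less)
    qed
  qed
  then obtain p where p: "p \<in> V" "v \<longlonglongrightarrow> p" using V(1) v(1) unfolding complete_def by blast
  have "(\<lambda>m. (norm (x - v m))\<^sup>2) \<longlonglongrightarrow> (norm (x - p))\<^sup>2" by (intro tendsto_intros p)
  moreover have "(\<lambda>m. d + r m) \<longlonglongrightarrow> d + 0"
    unfolding r_def by (intro tendsto_intros LIMSEQ_inverse_real_of_nat)
  ultimately have p_le: "(norm (x - p))\<^sup>2 \<le> d + 0"
    by (rule LIMSEQ_le) (use v(2) less_imp_le in blast)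
  have "inner (x - p) w = 0" if w: "w \<in> V" for w
  proof (cases "w = 0")
    case False
    \<comment> \<open>This \<open>r\<close> minimises the quadratic polynomial
      \<open>norm ((x - p) - r w)^2\<close>.\<close>
    define r where "r = inner (x - p) w / inner w w"
    have "p + r *\<^sub>R w \<in> V" using V p w by blast
    then have "(norm (x - p))\<^sup>2 \<le> (norm (x - (p + r *\<^sub>R w)))\<^sup>2" using d_le p_le by (metis add_0_right order_trans)
    also have "x - (p + r *\<^sub>R w) = (x - p) - r *\<^sub>R w" by simp
    also have "(norm ((x - p) - r *\<^sub>R w))\<^sup>2 = (norm (x - p))\<^sup>2 - (inner (x - p) w)\<^sup>2 / inner w w"
    proof -
      have "(norm ((x - p) - r *\<^sub>R w))\<^sup>2 = (norm (x - p))\<^sup>2 - 2 * r * inner (x - p) w + r * r * inner w w"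
        unfolding power2_norm_eq_inner by (simp add: inner_diff_left inner_diff_right inner_commute algebra_simps)
      then show ?thesis using False by (simp add: r_def power2_eq_square)
    qed
    finally have "(inner (x - p) w)\<^sup>2 / inner w w \<le> 0" by simp
    moreover have "inner w w > 0" using False by simp
    ultimately have "(inner (x - p) w)\<^sup>2 \<le> 0" by (simp add: divide_le_0_iff)
    then show ?thesis by simp
  qed simp
  with p(1) that show ?thesis by blast
qed

text \<open>The kernel of a nonzero functional has codimension one, so a suitable multiple of any
  nonzero vector \<open>w\<close> orthogonal to it represents the functional.\<close>

lemma riesz_representation:
  fixes \<phi> :: "'a::{real_inner, complete_space} \<Rightarrow> real"
  assumes \<phi>: "bounded_linear \<phi>"
  shows "\<exists>z. \<forall>x. \<phi> x = inner x z"
proof (cases "\<forall>x. \<phi> x = 0")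
  case True
  then show ?thesis by (intro exI[of _ 0]) simp
next
  case False
  then obtain x0 where x0: "\<phi> x0 \<noteq> 0" by blast
  interpret \<phi>: bounded_linear \<phi> by fact
  let ?V = "{x. \<phi> x = 0}"
  have "closed ?V"
    by (intro closed_Collect_eq continuous_intros linear_continuous_on \<phi>)
  then have "complete ?V" by (simp add: complete_eq_closed)
  then obtain p where p: "p \<in> ?V" "\<And>v. v \<in> ?V \<Longrightarrow> inner (x0 - p) v = 0"
    by (rule projection_exists[where x = x0]) (auto simp: \<phi>.add \<phi>.scaleR)
  define w where "w = x0 - p"
  have w: "\<phi> w \<noteq> 0" using x0 p by (simp add: w_def \<phi>.diff)
  then have "w \<noteq> 0" by (auto simp: \<phi>.zero)
  have "\<phi> x = inner x ((\<phi> w / inner w w) *\<^sub>R w)" for x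
  proof -
    have "x - (\<phi> x / \<phi> w) *\<^sub>R w \<in> ?V" using w by (simp add: \<phi>.diff \<phi>.scaleR)
    then have "inner w (x - (\<phi> x / \<phi> w) *\<^sub>R w) = 0" using p(2) by (simp add: w_def)
    then show ?thesis using w \<open>w \<noteq> 0\<close> by (simp add: inner_diff_right inner_commute field_simps)
  qed
  then show ?thesis by blast
qed

text \<open>The imaginary part of \<open>cinner x y\<close> is minus the real inner product of
  \<open>\<i> *\<^sub>C x\<close> with \<open>y\<close>, so one complex identity amounts to two real
  ones.\<close>

lemma cinner_eqI_inner:
  fixes x x' y y' :: "'a::complex_inner"
  assumes "inner x y = inner x' y'" "inner (\<i> *\<^sub>C x) y = inner (\<i> *\<^sub>C x') y'"
  shows "cinner x y = cinner x' y'"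
proof -
  have "Im (cinner u v) = - inner (\<i> *\<^sub>C u) v" for u v :: 'a
    by (simp add: inner_eq_Re_cinner cinner_scaleC_left)
  then show ?thesis using assms by (simp add: complex_eq_iff inner_eq_Re_cinner)
qed

lemma cinner_right_unique:
  fixes y z :: "'a::complex_inner"
  assumes "\<And>x. cinner x y = cinner x z"
  shows "y = z"
proof -
  have "inner (y - z) (y - z) = inner (y - z) y - inner (y - z) z" by (simp add: inner_diff_right)
  also have "\<dots> = 0" by (simp add: inner_eq_Re_cinner assms)
  finally show ?thesis by simp
qed

lemma cinner_scaleC_right: "cinner x (c *\<^sub>C y) = cnj c * cinner x (y::'a::complex_inner)"
  by (metis cinner_commute cinner_scaleC_left complex_cnj_mult)

text \<open>The real Riesz theorem yields a real adjoint. Complex linearity of \<open>T\<close>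
  gives its defining identity at \<open>\<i> *\<^sub>C x\<close> as well, which upgrades it to the
  complex identity.\<close>

lemma cadjoint_exists:
  fixes T :: "'a::complex_hilbert \<Rightarrow>\<^sub>L 'a"
  assumes T: "complex_linear T"
  shows "\<exists>S. \<forall>x y. cinner (T x) y = cinner x (blinfun_apply S y)"
proof -
  have "\<exists>z. \<forall>x. inner (T x) y = inner x z" for y
    by (intro riesz_representation bounded_linear_compose[OF bounded_linear_inner_left]
        blinfun.bounded_linear_right)
  then obtain S where S: "\<And>x y. inner (T x) y = inner x (S y)" by metis
  have unique: "u = v" if "\<And>x. inner x u = inner x v" for u v :: 'a
    using that vector_eq_ldot by blast
  have "bounded_linear S"
  proof (rule bounded_linear_intro)
    show "S (x + y) = S x + S y" for x y
      by (rule unique) (simp add: S[symmetric] inner_add_right)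
    show "S (r *\<^sub>R x) = r *\<^sub>R S x" for r x
      by (rule unique) (simp add: S[symmetric])
    show "norm (S x) \<le> norm x * norm T" for x
    proof (cases "S x = 0")
      case False
      have "norm (S x) * norm (S x) = inner (T (S x)) x" by (simp add: S power2_norm_eq_inner flip: power2_eq_square)
      also have "\<dots> \<le> norm (T (S x)) * norm x" by (rule norm_cauchy_schwarz)
      also have "\<dots> \<le> (norm T * norm (S x)) * norm x" by (intro mult_right_mono norm_blinfun) auto
      finally have "norm (S x) * norm (S x) \<le> (norm x * norm T) * norm (S x)" by (simp add: mult_ac)
      then show ?thesis using False by simp
    qed simp
  qed
  then obtain S' where S': "S = blinfun_apply S'" using bounded_linear_Blinfun_apply by metis
  have "cinner (T x) y = cinner x (S' y)" for x y
    using T by (intro cinner_eqI_inner) (simp_all add: S S'[symmetric] complex_linear_def flip: S)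
  then show ?thesis by blast
qed

text \<open>Since \<open>cadjoint\<close> is a definite description, its defining property becomes
  usable only with both existence and uniqueness at hand.\<close>

lemma cinner_cadjoint:
  fixes T :: "'a::complex_hilbert \<Rightarrow>\<^sub>L 'a"
  assumes "complex_linear T"
  shows "cinner (T x) y = cinner x (cadjoint T y)"
proof -
  have "\<exists>!S. \<forall>x y. cinner (T x) y = cinner x (blinfun_apply S y)"
    using cadjoint_exists[OF assms]
    by (rule ex_ex1I) (metis cinner_right_unique blinfun_eqI)
  from theI'[OF this] show ?thesis unfolding cadjoint_def by blast
qed

lemma complex_linear_cadjoint:
  assumes "complex_linear T"
  shows "complex_linear (cadjoint T)"
  unfolding complex_linear_def[of "cadjoint T"]
proof (intro allI cinner_right_unique)
  fix c x y
  show "cinner x (cadjoint T (c *\<^sub>C y)) = cinner x (c *\<^sub>C cadjoint T y)"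
    unfolding cinner_scaleC_right cinner_cadjoint[OF assms, symmetric] ..
qed

lemma norm_cadjoint_diff_le:
  fixes T S :: "'a::complex_hilbert \<Rightarrow>\<^sub>L 'a"
  assumes "complex_linear T" "complex_linear S"
  shows "norm (cadjoint T - cadjoint S) \<le> norm (T - S)"
proof (rule norm_blinfun_bound)
  fix y
  let ?z = "(cadjoint T - cadjoint S) y"
  have inner: "inner (R x) y = inner x (cadjoint R y)" if "complex_linear R" for R :: "'a \<Rightarrow>\<^sub>L 'a" and x
    using cinner_cadjoint[OF that] by (simp add: inner_eq_Re_cinner)
  show "norm ?z \<le> norm (T - S) * norm y"
  proof (cases "?z = 0")
    case False
    have "norm ?z * norm ?z = inner ?z ?z" by (simp add: power2_norm_eq_inner flip: power2_eq_square)
    also have "\<dots> = inner ((T - S) ?z) y"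
      using assms by (simp add: blinfun.diff_left inner_diff_right inner_diff_left inner)
    also have "\<dots> \<le> norm ((T - S) ?z) * norm y" by (rule norm_cauchy_schwarz)
    also have "\<dots> \<le> (norm (T - S) * norm ?z) * norm y" by (intro mult_right_mono norm_blinfun) auto
    finally have "norm ?z * norm ?z \<le> (norm (T - S) * norm y) * norm ?z" by (simp add: mult_ac)
    then show ?thesis using False by simp
  qed simp
qed simp

lemma continuous_on_cadjoint:
  fixes T :: "real \<Rightarrow> 'a::complex_hilbert \<Rightarrow>\<^sub>L 'a"
  assumes "continuous_on S T" "\<And>t. t \<in> S \<Longrightarrow> complex_linear (T t)"
  shows "continuous_on S (\<lambda>t. cadjoint (T t))"
  using assms(1) unfolding continuous_on_iff dist_norm
  by (meson assms(2) norm_cadjoint_diff_le order_le_less_trans)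

lemma norm_inverse_diff_le:
  fixes A B A' B' :: "'a::real_normed_vector \<Rightarrow>\<^sub>L 'a"
  assumes "A' o\<^sub>L A = id_blinfun" "B o\<^sub>L B' = id_blinfun"
  shows "norm (A' - B') \<le> norm A' * norm (A - B) * norm B'"
proof -
  have "A' (A x) = x" "B (B' x) = x" for x
    using assms by (metis blinfun_apply_blinfun_compose id_blinfun.rep_eq)+
  then have "A' - B' = A' o\<^sub>L ((B - A) o\<^sub>L B')"
    by (intro blinfun_eqI) (simp add: blinfun.diff_left blinfun.diff_right)
  also have "norm \<dots> \<le> norm A' * (norm (B - A) * norm B')"
    by (intro order_trans[OF norm_blinfun_compose] mult_left_mono norm_blinfun_compose) auto
  finally show ?thesis by (simp add: norm_minus_commute mult.assoc)
qed

text \<open>The difference of two inverses is bounded by a product containing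
  \<open>norm (A' s)\<close>, so a bound on \<open>A'\<close> near \<open>t\<close> has to be
  derived before the limit can be taken.\<close>

lemma continuous_on_inverse_blinfun:
  fixes A A' :: "real \<Rightarrow> 'a::real_normed_vector \<Rightarrow>\<^sub>L 'a"
  assumes A: "continuous_on S A"
    and inv: "\<And>t. t \<in> S \<Longrightarrow> A' t o\<^sub>L A t = id_blinfun" "\<And>t. t \<in> S \<Longrightarrow> A t o\<^sub>L A' t = id_blinfun"
  shows "continuous_on S A'"
  unfolding continuous_on_def
proof
  fix t assume t: "t \<in> S"
  let ?a = "\<lambda>s. norm (A s - A t)" and ?c = "norm (A' t)"
  have lim: "(?a \<longlongrightarrow> 0) (at t within S)"
    using A t unfolding continuous_on_def by (simp add: LIM_zero_iff tendsto_norm_zero)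
  have "((\<lambda>s. ?a s * ?c) \<longlongrightarrow> 0 * ?c) (at t within S)" by (intro tendsto_intros lim)
  then have small: "\<forall>\<^sub>F s in at t within S. ?a s * ?c < 1/2" by (auto dest: order_tendstoD(2)[of _ _ _ "1/2"])
  have "((\<lambda>s. 2 * ?c * ?c * ?a s) \<longlongrightarrow> 2 * ?c * ?c * 0) (at t within S)" by (intro tendsto_intros lim)
  then have lim2: "((\<lambda>s. 2 * ?c * ?c * ?a s) \<longlongrightarrow> 0) (at t within S)" by simp
  have in_S: "\<forall>\<^sub>F s in at t within S. s \<in> S" by (simp add: eventually_at_filter)
  have "\<forall>\<^sub>F s in at t within S. norm (A' s - A' t) \<le> 2 * ?c * ?c * ?a s"
    using small in_S
  proof eventually_elim
    case (elim s)
    note s = \<open>s \<in> S\<close>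
    have d: "norm (A' s - A' t) \<le> norm (A' s) * ?a s * ?c"
      by (rule norm_inverse_diff_le) (use inv s t in auto)
    \<comment> \<open>Half of \<open>norm (A' s)\<close> is absorbed on the left, leaving the bound
      \<open>2 * norm (A' t)\<close>.\<close>
    have "norm (A' s) * (?a s * ?c) \<le> norm (A' s) * (1/2)" using elim by (intro mult_left_mono) auto
    moreover have "norm (A' s) \<le> norm (A' s - A' t) + ?c" by (metis norm_triangle_sub add.commute)
    ultimately have "norm (A' s) \<le> 2 * ?c" using d by (simp add: mult.assoc)
    then have "norm (A' s) * (?a s * ?c) \<le> (2 * ?c) * (?a s * ?c)" by (intro mult_right_mono) auto
    with d show ?case by (simp add: mult_ac)
  qed
  then have "((\<lambda>s. A' s - A' t) \<longlongrightarrow> 0) (at t within S)" by (rule Lim_null_comparison[OF _ lim2])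
  then show "(A' \<longlongrightarrow> A' t) (at t within S)" by (simp add: LIM_zero_iff)
qed

text \<open>Used to turn maps defined on a closed subspace into operators on the whole space that
  vanish on its orthogonal complement, the form required by \<open>ops_on\<close>.\<close>

lemma orthogonal_projection:
  fixes K :: "'a::complex_inner set"
  assumes K: "csubspace K" "complete K"
  obtains P :: "'a \<Rightarrow>\<^sub>L 'a" where "complex_linear P" "\<And>x. P x \<in> K" "\<And>k. k \<in> K \<Longrightarrow> P k = k"
    "\<And>x. (\<forall>k\<in>K. cinner x k = 0) \<Longrightarrow> P x = 0"
proof -
  have K0: "0 \<in> K" and Kadd: "\<And>u v. u \<in> K \<Longrightarrow> v \<in> K \<Longrightarrow> u + v \<in> K"
    and Kscale: "\<And>c u. u \<in> K \<Longrightarrow> c *\<^sub>C u \<in> K" using K(1) by (auto simp: csubspace_def)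
  have KscaleR: "\<And>r u. u \<in> K \<Longrightarrow> r *\<^sub>R u \<in> K" by (simp add: scaleR_scaleC Kscale)
  have Kdiff: "u - v \<in> K" if "u \<in> K" "v \<in> K" for u v
    using Kadd[OF that(1) KscaleR[OF that(2), of "-1"]] by simp
  have "\<exists>p\<in>K. \<forall>v\<in>K. inner (x - p) v = 0" for x
    by (rule projection_exists[OF K(2) K0 Kadd KscaleR, of x]) auto
  then obtain p where p: "\<And>x. p x \<in> K" "\<And>x v. v \<in> K \<Longrightarrow> inner (x - p x) v = 0" by metis
  have p_eqI: "p x = q" if "q \<in> K" "\<And>v. v \<in> K \<Longrightarrow> inner (x - q) v = 0" for x q
  proof -
    have "p x - q \<in> K" using p that Kdiff by blast
    then have "inner (p x - q) (p x - q) = 0"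
      using p(2)[of "p x - q" x] that(2)[of "p x - q"]
      by (simp add: inner_diff_left inner_diff_right algebra_simps)
    then show ?thesis by simp
  qed
  \<comment> \<open>Testing the real orthogonality also with \<open>\<i> *\<^sub>C v\<close> gives
    complex orthogonality.\<close>
  have orth: "cinner (x - p x) v = 0" if "v \<in> K" for x v
    using p(2)[OF that] p(2)[OF Kscale[OF that], of _ \<i>] by (simp add: cinner_eq complex_eq_iff)
  have padd: "p (x + y) = p x + p y" for x y
  proof (rule p_eqI)
    fix v assume "v \<in> K"
    then show "inner (x + y - (p x + p y)) v = 0"
      using p(2)[of v x] p(2)[of v y] by (simp add: inner_diff_left inner_add_left)
  qed (use p Kadd in auto)
  have pscale: "p (c *\<^sub>C x) = c *\<^sub>C p x" for c x
  proof (rule p_eqI)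
    fix v assume "v \<in> K"
    have "c *\<^sub>C x - c *\<^sub>C p x = c *\<^sub>C (x - p x)"
      using scaleC_add_right[of c "x - p x" "p x"] by (simp add: algebra_simps)
    then show "inner (c *\<^sub>C x - c *\<^sub>C p x) v = 0"
      using orth[OF \<open>v \<in> K\<close>] by (simp add: inner_eq_Re_cinner cinner_scaleC_left)
  qed (use p Kscale in auto)
  have "norm (p x) \<le> norm x" for x
  proof (cases "p x = 0")
    case False
    have "norm (p x) * norm (p x) = inner (p x) (p x)"
      by (simp add: power2_norm_eq_inner flip: power2_eq_square)
    also have "\<dots> = inner x (p x)" using p(2)[OF p(1), of x x] by (simp add: inner_diff_left)
    also have "\<dots> \<le> norm x * norm (p x)" by (rule norm_cauchy_schwarz)
    finally show ?thesis using False by simp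
  qed simp
  then have "bounded_linear p"
    by (intro bounded_linear_intro[where K = 1]) (auto simp: padd pscale scaleR_scaleC)
  then obtain P where P: "p = blinfun_apply P" using bounded_linear_Blinfun_apply by metis
  show thesis
  proof (rule that[of P])
    show "complex_linear P" using pscale by (simp add: complex_linear_def P)
    show "P x \<in> K" for x using p by (simp add: P)
    show "P k = k" if "k \<in> K" for k using p_eqI[of k k] that by (simp add: P)
    show "P x = 0" if "\<forall>k\<in>K. cinner x k = 0" for x
      using p_eqI[of 0 x] that K0 by (simp add: P inner_eq_Re_cinner)
  qed
qed

definition bounded_inverse :: "('a::real_normed_vector \<Rightarrow>\<^sub>L 'a) \<Rightarrow> 'a \<Rightarrow>\<^sub>L 'a" where
  "bounded_inverse T = (SOME S. T o\<^sub>L S = id_blinfun \<and> S o\<^sub>L T = id_blinfun)"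

lemma bounded_inverse:
  assumes "has_bounded_inverse T"
  shows "T o\<^sub>L bounded_inverse T = id_blinfun" "bounded_inverse T o\<^sub>L T = id_blinfun"
  using someI_ex[of "\<lambda>S. T o\<^sub>L S = id_blinfun \<and> S o\<^sub>L T = id_blinfun"] assms
  unfolding bounded_inverse_def has_bounded_inverse_def by auto

lemma complex_linear_bounded_inverse:
  assumes "has_bounded_inverse T" "complex_linear T"
  shows "complex_linear (bounded_inverse T)"
  unfolding complex_linear_def
proof (intro allI)
  fix c x
  let ?S = "bounded_inverse T"
  have TS: "T (?S y) = y" and ST: "?S (T y) = y" for y
    using bounded_inverse[OF assms(1)] by (metis blinfun_apply_blinfun_compose id_blinfun.rep_eq)+
  have "?S (c *\<^sub>C x) = ?S (T (c *\<^sub>C ?S x))" using assms(2) by (simp add: complex_linear_def TS)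
  then show "?S (c *\<^sub>C x) = c *\<^sub>C ?S x" by (simp add: ST)
qed

text \<open>The mean value inequality bounds the remainder at \<open>h\<close> by the oscillation of
  \<open>G'\<close> in norm times \<open>norm h\<close>. This is uniform in \<open>h\<close>, so
  derivatives taken for each \<open>h\<close> combine to a derivative in operator norm.\<close>

lemma blinfun_has_vector_derivative:
  fixes G G' :: "real \<Rightarrow> 'a::real_normed_vector \<Rightarrow>\<^sub>L 'b::real_normed_vector"
  assumes der: "\<And>h t. t \<in> {a..b} \<Longrightarrow> ((\<lambda>t. G t h) has_vector_derivative G' t h) (at t within {a..b})"
    and cont: "continuous_on {a..b} G'" and t: "t \<in> {a..b}"
  shows "(G has_vector_derivative G' t) (at t within {a..b})"
  unfolding has_vector_derivative_def has_derivative_within_alt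
proof (intro conjI allI impI)
  show "bounded_linear (\<lambda>x. x *\<^sub>R G' t)" by (rule bounded_linear_scaleR_left)
next
  fix e :: real assume e: "e > 0"
  then obtain d where d: "d > 0" "\<And>s. s \<in> {a..b} \<Longrightarrow> dist s t < d \<Longrightarrow> dist (G' s) (G' t) < e"
    using cont t unfolding continuous_on_iff by blast
  have "norm (G s - G t - (s - t) *\<^sub>R G' t) \<le> e * norm (s - t)" if s: "s \<in> {a..b}" "norm (s - t) < d" for s
  proof (rule norm_blinfun_bound)
    fix h
    let ?S = "closed_segment t s"
    have S: "?S \<subseteq> {a..b}" using s t by (simp add: closed_segment_subset convex_real_interval)
    have "norm (G s h - G t h - (s - t) *\<^sub>R G' t h) \<le> norm (s - t) * (e * norm h)"
    proof (rule vector_differentiable_bound_linearization)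
      show "((\<lambda>t. G t h) has_vector_derivative G' x h) (at x within ?S)" if "x \<in> ?S" for x
        by (rule has_vector_derivative_within_subset[OF der S]) (use that S in blast)
      show "norm (G' x h - G' t h) \<le> e * norm h" if x: "x \<in> ?S" for x
      proof -
        have "norm (x - t) \<le> norm (s - t)"
          using x by (auto simp: closed_segment_eq_real_ivl split: if_splits)
        then have "norm (G' x - G' t) < e" using d(2)[of x] x S s by (auto simp: dist_norm)
        then show ?thesis
          unfolding blinfun.diff_left[symmetric]
          by (intro order_trans[OF norm_blinfun] mult_right_mono) auto
      qed
    qed auto
    then show "norm ((G s - G t - (s - t) *\<^sub>R G' t) h) \<le> e * norm (s - t) * norm h"
      by (simp add: blinfun.diff_left blinfun.scaleR_left mult_ac)
  qed (use e in simp)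
  then show "\<exists>d>0. \<forall>y\<in>{a..b}. norm (y - t) < d \<longrightarrow> norm (G y - G t - (y - t) *\<^sub>R G' t) \<le> e * norm (y - t)"
    using d(1) by blast
qed

lemma blinfun_continuous_on:
  fixes G G' :: "real \<Rightarrow> 'a::real_normed_vector \<Rightarrow>\<^sub>L 'b::real_normed_vector"
  assumes der: "\<And>h t. t \<in> {a..b} \<Longrightarrow> ((\<lambda>t. G t h) has_vector_derivative G' t h) (at t within {a..b})"
    and bound: "\<And>t. t \<in> {a..b} \<Longrightarrow> norm (G' t) \<le> C"
  shows "continuous_on {a..b} G"
proof (cases "a \<le> b")
  case True
  then have C: "C \<ge> 0" using order_trans[OF norm_ge_zero bound[of a]] by simp
  \<comment> \<open>In the factor 3, the linearised mean value bound accounts for 2 (the oscillation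
    of \<open>G'\<close>), and the linear term for 1.\<close>
  have "norm (G s - G t) \<le> 3 * C * norm (s - t)" if st: "s \<in> {a..b}" "t \<in> {a..b}" for s t
  proof (rule norm_blinfun_bound)
    fix h
    have b: "norm (G' x h) \<le> C * norm h" if "x \<in> {a..b}" for x
      by (rule order_trans[OF norm_blinfun mult_right_mono]) (use bound that in auto)
    have "norm (G s h - G t h - (s - t) *\<^sub>R G' t h) \<le> norm (s - t) * (2 * C * norm h)"
    proof (rule vector_differentiable_bound_linearization[where S = "{a..b}"])
      show "closed_segment t s \<subseteq> {a..b}" using st by (simp add: closed_segment_subset convex_real_interval)
      show "norm (G' x h - G' t h) \<le> 2 * C * norm h" if "x \<in> {a..b}" for x
        using norm_triangle_ineq4[of "G' x h" "G' t h"] b[OF that] b[OF st(2)] by linarith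
    qed (use der st in auto)
    moreover have "norm ((s - t) *\<^sub>R G' t h) \<le> norm (s - t) * (C * norm h)"
      using b[OF st(2)] by (simp add: mult_left_mono)
    moreover have "norm (G s h - G t h) \<le> norm (G s h - G t h - (s - t) *\<^sub>R G' t h) + norm ((s - t) *\<^sub>R G' t h)"
      by (metis norm_triangle_sub add.commute)
    ultimately show "norm ((G s - G t) h) \<le> 3 * C * norm (s - t) * norm h"
      by (simp add: blinfun.diff_left algebra_simps)
  qed (use C in simp)
  then have "(3 * C)-lipschitz_on {a..b} G"
    using C by (intro lipschitz_onI) (auto simp: dist_norm)
  then show ?thesis by (rule lipschitz_on_continuous_on)
qed simp

section \<open>Absolutely continuous functions\<close>

lemma locally_absolutely_continuous_on_subset:
  assumes "locally_absolutely_continuous_on S f" "T \<subseteq> S"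
  shows "locally_absolutely_continuous_on T f"
  unfolding locally_absolutely_continuous_on_def[of T]
proof (rule allI, rule allI, rule impI)
  fix c d assume "{c..d} \<subseteq> T"
  then have cd: "{c..d} \<subseteq> S" using assms(2) by (rule order_trans)
  show "\<forall>\<epsilon>>0. \<exists>\<delta>>0. \<forall>(m::nat) \<alpha> \<beta>.
        (\<forall>i<m. c \<le> \<alpha> i \<and> \<alpha> i \<le> \<beta> i \<and> \<beta> i \<le> d) \<longrightarrow>
        (\<forall>i<m. \<forall>j<m. i \<noteq> j \<longrightarrow> {\<alpha> i<..<\<beta> i} \<inter> {\<alpha> j<..<\<beta> j} = {}) \<longrightarrow>
        (\<Sum>i<m. \<beta> i - \<alpha> i) < \<delta> \<longrightarrow> (\<Sum>i<m. norm (f (\<beta> i) - f (\<alpha> i))) < \<epsilon>"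
    by (rule assms(1)[unfolded locally_absolutely_continuous_on_def, THEN spec, THEN spec, THEN mp, OF cd])
qed

text \<open>Reindexing from initial segments of the naturals to arbitrary finite sets, so that the
  tagged pieces of a division can serve as their own indices.\<close>

lemma absolutely_continuous_finite_sum:
  assumes ac: "locally_absolutely_continuous_on {a..b} f" and e: "e > 0"
  obtains d where "d > 0"
    "\<forall>(I::'i set) l r. finite I \<longrightarrow> (\<forall>i\<in>I. a \<le> l i \<and> l i \<le> r i \<and> r i \<le> b) \<longrightarrow>
       (\<forall>i\<in>I. \<forall>j\<in>I. i \<noteq> j \<longrightarrow> {l i<..<r i} \<inter> {l j<..<r j} = {}) \<longrightarrow>
       (\<Sum>i\<in>I. r i - l i) < d \<longrightarrow> (\<Sum>i\<in>I. norm (f (r i) - f (l i))) < e"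
proof -
  from ac[unfolded locally_absolutely_continuous_on_def, THEN spec, THEN spec, THEN mp, OF order_refl,
      THEN spec, THEN mp, OF e]
  obtain d where d: "d > 0" "\<forall>(m::nat) \<alpha> \<beta>. (\<forall>i<m. a \<le> \<alpha> i \<and> \<alpha> i \<le> \<beta> i \<and> \<beta> i \<le> b) \<longrightarrow>
        (\<forall>i<m. \<forall>j<m. i \<noteq> j \<longrightarrow> {\<alpha> i<..<\<beta> i} \<inter> {\<alpha> j<..<\<beta> j} = {}) \<longrightarrow>
        (\<Sum>i<m. \<beta> i - \<alpha> i) < d \<longrightarrow> (\<Sum>i<m. norm (f (\<beta> i) - f (\<alpha> i))) < e"
    by (elim exE conjE) (rule that)
  show thesis
  proof (rule that[OF d(1)], intro allI impI)
    fix I :: "'i set" and l r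
    assume I: "finite I" and lr: "\<forall>i\<in>I. a \<le> l i \<and> l i \<le> r i \<and> r i \<le> b"
      and dj: "\<forall>i\<in>I. \<forall>j\<in>I. i \<noteq> j \<longrightarrow> {l i<..<r i} \<inter> {l j<..<r j} = {}"
      and less: "(\<Sum>i\<in>I. r i - l i) < d"
    obtain h where h: "bij_betw h {..<card I} I"
      using ex_bij_betw_nat_finite[OF I] by (auto simp: atLeast0LessThan)
    have "(\<Sum>i<card I. norm (f (r (h i)) - f (l (h i)))) < e"
    proof (rule d(2)[THEN spec, THEN spec, THEN spec, THEN mp, THEN mp, THEN mp])
      show "\<forall>i<card I. a \<le> l (h i) \<and> l (h i) \<le> r (h i) \<and> r (h i) \<le> b"
        using lr bij_betwE[OF h] by auto
      show "\<forall>i<card I. \<forall>j<card I. i \<noteq> j \<longrightarrow> {l (h i)<..<r (h i)} \<inter> {l (h j)<..<r (h j)} = {}"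
      proof (intro allI impI)
        fix i j assume ij: "i < card I" "j < card I" "i \<noteq> j"
        then have "h i \<noteq> h j" using h by (auto simp: bij_betw_def inj_on_def)
        then show "{l (h i)<..<r (h i)} \<inter> {l (h j)<..<r (h j)} = {}"
          using dj bij_betwE[OF h] ij by auto
      qed
      show "(\<Sum>i<card I. r (h i) - l (h i)) < d"
        using less sum.reindex_bij_betw[OF h, of "\<lambda>i. r i - l i"] by simp
    qed
    then show "(\<Sum>i\<in>I. norm (f (r i) - f (l i))) < e"
      using sum.reindex_bij_betw[OF h, of "\<lambda>i. norm (f (r i) - f (l i))"] by simp
  qed
qed

lemma sum_lengths_le_measure:
  fixes l r :: "'i \<Rightarrow> real"
  assumes I: "finite I" "\<And>i. i \<in> I \<Longrightarrow> l i \<le> r i"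
    and dj: "\<And>i j. i \<in> I \<Longrightarrow> j \<in> I \<Longrightarrow> i \<noteq> j \<Longrightarrow> {l i<..<r i} \<inter> {l j<..<r j} = {}"
    and sub: "\<And>i. i \<in> I \<Longrightarrow> {l i<..<r i} \<subseteq> G" and G: "G \<in> lmeasurable"
  shows "(\<Sum>i\<in>I. r i - l i) \<le> measure lebesgue G"
proof -
  have "(\<Sum>i\<in>I. r i - l i) = (\<Sum>i\<in>I. measure lebesgue {l i<..<r i})"
    using I by (intro sum.cong) auto
  also have "\<dots> = measure lebesgue (\<Union>i\<in>I. {l i<..<r i})"
    by (rule measure_finite_Union[symmetric]) (use I dj in \<open>auto simp: disjoint_family_on_def\<close>)
  also have "\<dots> \<le> measure lebesgue G"
    using sub by (intro measure_mono_fmeasurable G) (auto intro!: sets.finite_UN I)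
  finally show ?thesis .
qed

text \<open>Tags in the exceptional null set contribute little by absolute continuity, since their
  intervals lie in an open set of small measure; the other tags are handled by straddling.\<close>

lemma absolutely_continuous_fundamental_theorem:
  fixes f :: "real \<Rightarrow> 'a::banach"
  assumes ac: "locally_absolutely_continuous_on {a..b} f" and ab: "a \<le> b" and E: "negligible E"
    and der: "\<And>t. t \<in> {a..b} - E \<Longrightarrow> (f has_vector_derivative g t) (at t within {a..b})"
  shows "(g has_integral f b - f a) {a..b}"
proof (cases "a = b")
  case False
  with ab have ab: "a < b" by simp
  \<comment> \<open>Nothing is known about \<open>g\<close> on \<open>E\<close>. With the value 0
    there, a tag in \<open>E\<close> contributes only an increment of \<open>f\<close>.\<close>
  let ?g = "\<lambda>t. if t \<in> E then 0 else g t"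
  have "(?g has_integral f b - f a) {a..b}"
    unfolding has_integral_factor_content_real
  proof (intro allI impI)
    fix e :: real assume e: "e > 0"
    then have "e / 2 * (b - a) > 0" using ab by simp
    then obtain \<delta> where \<delta>: "\<delta> > 0"
      "\<forall>(I::(real \<times> real set) set) l r. finite I \<longrightarrow> (\<forall>i\<in>I. a \<le> l i \<and> l i \<le> r i \<and> r i \<le> b) \<longrightarrow>
       (\<forall>i\<in>I. \<forall>j\<in>I. i \<noteq> j \<longrightarrow> {l i<..<r i} \<inter> {l j<..<r j} = {}) \<longrightarrow>
       (\<Sum>i\<in>I. r i - l i) < \<delta> \<longrightarrow> (\<Sum>i\<in>I. norm (f (r i) - f (l i))) < e / 2 * (b - a)"
      by (rule absolutely_continuous_finite_sum[OF ac])
    have Eleb: "E \<in> sets lebesgue" using E by (simp add: negligible_imp_sets)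
    obtain G where G: "open G" "E \<subseteq> G" "G - E \<in> lmeasurable" "emeasure lebesgue (G - E) < ennreal \<delta>"
      using sets_lebesgue_outer_open[OF Eleb \<open>\<delta> > 0\<close>] by blast
    have GE: "G = (G - E) \<union> E" using G by auto
    have "negligible ((G - (G - E)) \<union> ((G - E) - G))" using E by (rule negligible_subset) auto
    then have Gm: "G \<in> lmeasurable" "measure lebesgue G = measure lebesgue (G - E)"
      using measure_negligible_symdiff[OF G(3), of G] lmeasurable_negligible_symdiff[OF G(3), of G]
      by (auto simp: Un_commute)
    have "measure lebesgue (G - E) < \<delta>"
      using G(3,4) \<delta>(1) by (simp add: emeasure_eq_measure2 ennreal_less_iff)
    with Gm have G\<delta>: "measure lebesgue G < \<delta>" by simp
    have "\<forall>x. \<exists>d>0. x \<in> {a..b} - E \<longrightarrow>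
         (\<forall>y\<in>{a..b}. norm (y-x) < d \<longrightarrow> norm (f y - f x - (y-x) *\<^sub>R g x) \<le> e/2 * norm (y-x))"
      using der[unfolded has_vector_derivative_def has_derivative_within_alt] half_gt_zero[OF e] by blast
    then obtain d where d: "\<And>x. 0 < d x"
      "\<And>x y. x \<in> {a..b} - E \<Longrightarrow> y \<in> {a..b} \<Longrightarrow> norm (y-x) < d x \<Longrightarrow>
          norm (f y - f x - (y-x) *\<^sub>R g x) \<le> e/2 * norm (y-x)"
      by metis
    \<comment> \<open>At tags in \<open>E\<close> the gauge confines intervals to the open set
      \<open>G\<close> of measure below \<open>\<delta>\<close>; elsewhere it gives the radius at
      which \<open>f\<close> is approximated by its tangent.\<close>
    define \<gamma> where "\<gamma> x = (if x \<in> E then G else ball x (d x))" for x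
    have g: "gauge \<gamma>" using d(1) G by (auto simp: gauge_def \<gamma>_def)
    have main: "norm ((\<Sum>(x,k)\<in>p. measure lborel k *\<^sub>R ?g x) - (f b - f a)) \<le> e * measure lborel {a..b}"
      if p: "p tagged_division_of {a..b}" and fine: "\<gamma> fine p" for p
    proof -
      let ?E = "{i\<in>p. fst i \<in> E}" and ?N = "{i\<in>p. fst i \<notin> E}"
      define D where "D = (\<lambda>(x::real,k). measure lborel k *\<^sub>R ?g x - (f (Sup k) - f (Inf k)))"
      note pD = tagged_division_ofD[OF p]
      have fin: "finite ?E" "finite ?N" using pD(1) by auto
      have k: "\<exists>u v. k = {u..v} \<and> u \<le> v \<and> Inf k = u \<and> Sup k = v \<and> u \<in> {a..b} \<and> v \<in> {a..b} \<and> x \<in> {u..v}"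
        if xk: "(x,k) \<in> p" for x k
      proof -
        obtain u v where uv: "k = {u..v}" using pD(4)[OF xk] by auto
        moreover have "x \<in> {u..v}" using pD(2)[OF xk] uv by simp
        moreover have "{u..v} \<subseteq> {a..b}" using pD(3)[OF xk] uv by simp
        ultimately show ?thesis by (intro exI[of _ u] exI[of _ v]) auto
      qed
      have int: "interior k = {Inf k<..<Sup k}" if "(x,k) \<in> p" for x k
        using k[OF that] by (elim exE conjE) (simp add: interior_atLeastAtMost_real)
      have tel: "(\<Sum>(x,k)\<in>p. f (Sup k) - f (Inf k)) = f b - f a" "(\<Sum>(x,k)\<in>p. Sup k - Inf k) = b - a"
        using additive_tagged_division_1[OF less_imp_le[OF ab] p, of f]
          additive_tagged_division_1[OF less_imp_le[OF ab] p, of "\<lambda>x. x"] by auto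
      have "(\<Sum>(x,k)\<in>p. measure lborel k *\<^sub>R ?g x) - (f b - f a) = sum D p"
        by (simp add: D_def case_prod_unfold sum_subtractf flip: tel)
      also have "\<dots> = sum D (?E \<union> ?N)" by (rule sum.cong) auto
      also have "sum D (?E \<union> ?N) = sum D ?E + sum D ?N"
        using fin by (intro sum.union_disjoint) auto
      finally have "norm ((\<Sum>(x,k)\<in>p. measure lborel k *\<^sub>R ?g x) - (f b - f a)) \<le> norm (sum D ?E) + norm (sum D ?N)"
        by (simp add: norm_triangle_ineq)
      also have "norm (sum D ?E) \<le> e / 2 * (b - a)"
      proof -
        have "norm (sum D ?E) \<le> (\<Sum>i\<in>?E. norm (D i))" by (rule norm_sum)
        also have "\<dots> = (\<Sum>i\<in>?E. norm (f (Sup (snd i)) - f (Inf (snd i))))"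
          by (intro sum.cong) (auto simp: D_def norm_minus_commute)
        also have "\<dots> < e / 2 * (b - a)"
        proof (rule \<delta>(2)[rule_format])
          show lr: "a \<le> Inf (snd i) \<and> Inf (snd i) \<le> Sup (snd i) \<and> Sup (snd i) \<le> b" if "i \<in> ?E" for i
            using that k[of "fst i" "snd i"] by auto
          show dj: "{Inf (snd i)<..<Sup (snd i)} \<inter> {Inf (snd j)<..<Sup (snd j)} = {}"
            if ij: "i \<in> ?E" "j \<in> ?E" "i \<noteq> j" for i j
          proof -
            have i: "(fst i, snd i) \<in> p" "(fst j, snd j) \<in> p" using ij by auto
            show ?thesis using pD(5)[OF i] ij by (simp add: int[OF i(1)] int[OF i(2)] prod_eq_iff)
          qed
          have "(\<Sum>i\<in>?E. Sup (snd i) - Inf (snd i)) \<le> measure lebesgue G"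
          proof (rule sum_lengths_le_measure[OF fin(1) _ dj _ Gm(1)])
            show "{Inf (snd i)<..<Sup (snd i)} \<subseteq> G" if "i \<in> ?E" for i
            proof -
              have i: "(fst i, snd i) \<in> p" "fst i \<in> E" using that by auto
              then have "snd i \<subseteq> G" using fine by (force simp: fine_def \<gamma>_def)
              then show ?thesis using k[OF i(1)] by force
            qed
          qed (use lr in auto)
          then show "(\<Sum>i\<in>?E. Sup (snd i) - Inf (snd i)) < \<delta>" using G\<delta> by simp
        qed (rule fin)
        finally show ?thesis by simp
      qed
      also have "norm (sum D ?N) \<le> e / 2 * (b - a)"
      proof -
        have "norm (sum D ?N) \<le> (\<Sum>i\<in>?N. e / 2 * (Sup (snd i) - Inf (snd i)))"
        proof (rule sum_norm_le)
          fix i assume "i \<in> ?N"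
          then obtain x K where i: "i = (x, K)" "(x,K) \<in> p" "x \<notin> E" by (cases i) auto
          obtain u v where uv: "K = {u..v}" "u \<le> v" "Inf K = u" "Sup K = v" "u \<in> {a..b}" "v \<in> {a..b}" "x \<in> {u..v}"
            using k[OF i(2)] by blast
          have K: "K \<subseteq> ball x (d x)" using fine i by (force simp: fine_def \<gamma>_def)
          have "u \<in> K" "v \<in> K" using uv(1,2) by simp_all
          with K have "u \<in> ball x (d x)" "v \<in> ball x (d x)" by blast+
          then have near: "norm (u - x) < d x" "norm (v - x) < d x" by (simp_all add: dist_norm norm_minus_commute)
          have x: "x \<in> {a..b} - E" using uv i by auto
          \<comment> \<open>Straddling: each end point of the interval is compared with the tag
            \<open>x\<close>, which lies between them, and the two errors add up to a multiple of
            the length.\<close>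
          have "D i = (f u - f x - (u - x) *\<^sub>R g x) - (f v - f x - (v - x) *\<^sub>R g x)"
            using i uv by (simp add: D_def algebra_simps)
          then have "norm (D i) \<le> norm (f u - f x - (u - x) *\<^sub>R g x) + norm (f v - f x - (v - x) *\<^sub>R g x)"
            by (metis norm_triangle_ineq4)
          also have "\<dots> \<le> e/2 * norm (u - x) + e/2 * norm (v - x)"
            by (intro add_mono d(2) x uv near)
          also have "\<dots> = e / 2 * (v - u)" using uv by (simp add: field_simps)
          finally show "norm (D i) \<le> e / 2 * (Sup (snd i) - Inf (snd i))" using i uv by simp
        qed
        also have "\<dots> \<le> (\<Sum>i\<in>p. e / 2 * (Sup (snd i) - Inf (snd i)))"
        proof (rule sum_mono2)
          fix i assume "i \<in> p - ?N"
          then show "0 \<le> e / 2 * (Sup (snd i) - Inf (snd i))"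
            using k[of "fst i" "snd i"] e by auto
        qed (use pD(1) in auto)
        also have "\<dots> = e / 2 * (\<Sum>i\<in>p. Sup (snd i) - Inf (snd i))" by (rule sum_distrib_left[symmetric])
        also have "\<dots> = e / 2 * (b - a)" using tel(2) by (simp add: case_prod_unfold)
        finally show ?thesis .
      qed
      finally show ?thesis using ab by (simp add: algebra_simps)
    qed
    show "\<exists>d. gauge d \<and> (\<forall>p. p tagged_division_of {a..b} \<and> d fine p \<longrightarrow>
        norm ((\<Sum>(x,k)\<in>p. measure lborel k *\<^sub>R ?g x) - (f b - f a)) \<le> e * measure lborel {a..b})"
      by (intro exI[of _ \<gamma>] conjI allI impI g, elim conjE, rule main)
  qed
  then show ?thesis by (rule has_integral_spike[OF E, rotated]) auto
qed (simp add: has_integral_refl)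

section \<open>Square integrable functions\<close>

lemma ext0_add: "ext0 S (\<lambda>t. f t + g t) = (\<lambda>t. ext0 S f t + ext0 S g t)"
  by (auto simp: ext0_def)

lemma ext0_scaleC: "ext0 S (\<lambda>t. c *\<^sub>C (f t :: 'a::complex_normed_vector)) = (\<lambda>t. c *\<^sub>C ext0 S f t)"
  by (simp add: ext0_def fun_eq_iff)

lemma in_L2_add:
  "in_L2 S f \<Longrightarrow> in_L2 S g \<Longrightarrow> in_L2 S (\<lambda>t. f t + g t :: 'a::{real_normed_vector, second_countable_topology})"
  by (simp add: in_L2_def ext0_add square_integrable_add)

lemma in_L2_scaleC:
  "in_L2 S f \<Longrightarrow> in_L2 S (\<lambda>t. c *\<^sub>C f t :: 'a::{complex_normed_vector, second_countable_topology})"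
  by (simp add: in_L2_def ext0_scaleC square_integrable_scaleC)

lemma L2_class_add:
  "in_L2 S f \<Longrightarrow> in_L2 S g \<Longrightarrow> L2_class S (\<lambda>t. f t + g t) = L2_class S f + L2_class S g"
  by (simp add: in_L2_def L2_class_def ext0_add plus_L2.abs_eq)

lemma L2_class_scaleC:
  "in_L2 S f \<Longrightarrow> L2_class S (\<lambda>t. c *\<^sub>C f t) = c *\<^sub>C L2_class S f"
  by (simp add: in_L2_def L2_class_def ext0_scaleC scaleC_L2.abs_eq)

lemma L2_class_eqD:
  assumes "L2_class S f = L2_class S g" "in_L2 S f" "in_L2 S g"
  shows "AE t in lebesgue. t \<in> S \<longrightarrow> f t = g t"
proof -
  have "AE t in lebesgue. ext0 S f t = ext0 S g t"
    using assms Quotient3_rel[OF Quotient3_L2, of "ext0 S f" "ext0 S g"]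
    by (simp add: in_L2_def L2_class_def)
  then show ?thesis by eventually_elim (auto simp: ext0_def split: if_splits)
qed

lemma L2_class_cong_on:
  "(\<And>t. t \<in> S \<Longrightarrow> f t = g t) \<Longrightarrow> L2_class S f = L2_class S g"
  "(\<And>t. t \<in> S \<Longrightarrow> f t = g t) \<Longrightarrow> in_L2 S f = in_L2 S g"
  unfolding L2_class_def in_L2_def by (auto simp: ext0_def cong: if_cong)

lemma norm_L2_class:
  "in_L2 S f \<Longrightarrow> (norm (L2_class S f))\<^sup>2 = (\<integral>t. (norm (ext0 S f t))\<^sup>2 \<partial>lebesgue)"
  by (simp add: in_L2_def L2_class_def power2_norm_eq_inner inner_L2.abs_eq)

lemma integral_norm_square_le:
  assumes f: "in_L2 S f" and st: "{s..t} \<subseteq> S"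
  shows "(\<lambda>r. (norm (f r))\<^sup>2) integrable_on {s..t}"
    and "integral {s..t} (\<lambda>r. (norm (f r))\<^sup>2) \<le> (norm (L2_class S f))\<^sup>2"
proof -
  let ?h = "\<lambda>r. (norm (ext0 S f r))\<^sup>2"
  have h: "(?h has_integral (norm (L2_class S f))\<^sup>2) UNIV"
    using f has_integral_integral_lebesgue[of ?h] by (simp add: norm_L2_class in_L2_def square_integrable_def)
  then have "?h integrable_on {s..t}" by (auto intro: integrable_on_subinterval)
  moreover have eq: "?h r = (norm (f r))\<^sup>2" if "r \<in> {s..t}" for r using that st by (auto simp: ext0_def)
  ultimately show "(\<lambda>r. (norm (f r))\<^sup>2) integrable_on {s..t}"
    by (rule integrable_eq)
  have "integral {s..t} (\<lambda>r. (norm (f r))\<^sup>2) = integral {s..t} ?h"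
    by (intro integral_cong eq[symmetric])
  also have "\<dots> \<le> integral UNIV ?h"
    using h by (intro integral_subset_le) (auto intro: \<open>?h integrable_on {s..t}\<close>)
  finally show "integral {s..t} (\<lambda>r. (norm (f r))\<^sup>2) \<le> (norm (L2_class S f))\<^sup>2"
    using h by (simp add: integral_unique)
qed

text \<open>The Henstock-Kurzweil integral of \<open>f\<close> suffices here, so the integrability of \<open>norm \<circ> f\<close> never
  has to be discussed.\<close>

lemma norm_integral_le_L2:
  fixes f :: "real \<Rightarrow> 'a::{complex_hilbert, second_countable_topology}"
  assumes f: "in_L2 S f" and st: "{s..t} \<subseteq> S" "s \<le> t" and I: "(f has_integral I) {s..t}"
  shows "norm I \<le> norm (L2_class S f) * sqrt (t - s)"
proof (cases "s = t")
  case True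
  then show ?thesis using I by (simp add: has_integral_refl(2) has_integral_unique)
next
  case False
  with st have st': "t - s > 0" by simp
  let ?N = "norm (L2_class S f)"
  \<comment> \<open>The Cauchy-Schwarz inequality is replaced by the pointwise inequality between
    geometric and arithmetic means with a free weight \<open>\<eta>\<close>, optimised
    afterwards.\<close>
  have *: "norm I \<le> \<eta> * (t - s) / 2 + ?N\<^sup>2 / (2 * \<eta>)" if \<eta>: "\<eta> > 0" for \<eta>
  proof -
    have int: "((\<lambda>r. \<eta> / 2 + (norm (f r))\<^sup>2 / (2 * \<eta>)) has_integral
        (t - s) * (\<eta> / 2) + integral {s..t} (\<lambda>r. (norm (f r))\<^sup>2) / (2 * \<eta>)) {s..t}"
      using has_integral_const_real[of "\<eta> / 2" s t] st(2)
      by (intro has_integral_add has_integral_divide integrable_integral integral_norm_square_le(1)[OF f st(1)]) simp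
    have "norm (f r) \<le> \<eta> / 2 + (norm (f r))\<^sup>2 / (2 * \<eta>)" for r
    proof -
      have "2 * \<eta> * norm (f r) \<le> \<eta>\<^sup>2 + (norm (f r))\<^sup>2" using sum_squares_bound[of \<eta> "norm (f r)"] by simp
      then show ?thesis using \<eta> by (simp add: field_simps power2_eq_square)
    qed
    then have "norm I \<le> (t - s) * (\<eta> / 2) + integral {s..t} (\<lambda>r. (norm (f r))\<^sup>2) / (2 * \<eta>)"
      using integral_norm_bound_integral[of f "{s..t}" "\<lambda>r. \<eta> / 2 + (norm (f r))\<^sup>2 / (2 * \<eta>)"] I int
      by (simp add: integral_unique has_integral_integrable)
    also have "\<dots> \<le> (t - s) * (\<eta> / 2) + ?N\<^sup>2 / (2 * \<eta>)"
      using integral_norm_square_le(2)[OF f st(1)] \<eta> by (intro add_left_mono divide_right_mono) auto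
    finally show ?thesis by (simp add: algebra_simps)
  qed
  have "norm I \<le> (?N + e) * sqrt (t - s)" if e: "e > 0" for e
  proof -
    \<comment> \<open>The optimal weight is \<open>norm (L2_class S f) / sqrt (t - s)\<close>;
      adding \<open>e\<close> keeps it positive when the class is zero.\<close>
    let ?r = "sqrt (t - s)" and ?M = "?N + e"
    have calc: "M / r * (r * r) / 2 + M\<^sup>2 / (2 * (M / r)) = M * r" if "M > 0" "r > 0" for M r :: real
      using that by (simp add: field_simps power2_eq_square)
    have r: "?r > 0" "?r * ?r = t - s" using st' by auto
    have M: "?M > 0" "?N\<^sup>2 \<le> ?M\<^sup>2" using e by (auto intro!: power_mono add_nonneg_pos)
    have "norm I \<le> (?M / ?r) * (t - s) / 2 + ?N\<^sup>2 / (2 * (?M / ?r))" by (intro * divide_pos_pos r M)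
    also have "\<dots> \<le> (?M / ?r) * (t - s) / 2 + ?M\<^sup>2 / (2 * (?M / ?r))"
      using M r by (intro add_left_mono divide_right_mono) auto
    also have "\<dots> = ?M * ?r"
      using calc[OF M(1) r(1)] by (simp only: r(2))
    finally show ?thesis .
  qed
  then have "norm I \<le> ?N * sqrt (t - s) + d" if "d > 0" for d
    using st' that by (elim allE[of _ "d / sqrt (t - s)"] meta_allE[of _ "d / sqrt (t - s)"]) (simp add: algebra_simps)
  then show ?thesis by (rule field_le_epsilon)
qed

text \<open>Fatou's lemma, applied to \<open>f k - f m\<close> as \<open>k\<close> grows, bounds
  \<open>g - f m\<close> in the mean. Pointwise convergence thus identifies the limit in
  \<open>L2\<close> without appealing to completeness of that space.\<close>

lemma L2_limit:
  fixes f :: "nat \<Rightarrow> real \<Rightarrow> 'a::{complex_hilbert, second_countable_topology}"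
  assumes f: "\<And>m. in_L2 S (f m)" and cauchy: "Cauchy (\<lambda>m. L2_class S (f m))"
    and lim: "\<And>t. t \<in> S \<Longrightarrow> (\<lambda>m. f m t) \<longlonglongrightarrow> g t"
  shows "in_L2 S g" and "(\<lambda>m. L2_class S (f m)) \<longlonglongrightarrow> L2_class S g"
proof -
  have lim0: "(\<lambda>m. ext0 S (f m) t) \<longlonglongrightarrow> ext0 S g t" for t using lim by (auto simp: ext0_def)
  have meas[measurable]: "ext0 S (f m) \<in> borel_measurable lebesgue" for m
    using f[of m] by (simp add: in_L2_def square_integrable_def)
  have [measurable]: "ext0 S g \<in> borel_measurable lebesgue"
    by (rule borel_measurable_LIMSEQ_metric[OF meas lim0])
  have diff: "in_L2 S (\<lambda>t. f k t - f m t)" "L2_class S (\<lambda>t. f k t - f m t) = L2_class S (f k) - L2_class S (f m)" for k m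
  proof -
    have eq: "(\<lambda>t. f k t - f m t) = (\<lambda>t. f k t + (-1) *\<^sub>C f m t)"
      using scaleR_scaleC[of "-1"] by (auto simp: fun_eq_iff)
    show "in_L2 S (\<lambda>t. f k t - f m t)" unfolding eq by (intro in_L2_add in_L2_scaleC f)
    have "L2_class S (\<lambda>t. f k t - f m t) = L2_class S (f k) + (-1) *\<^sub>C L2_class S (f m)"
      unfolding eq by (simp add: L2_class_add L2_class_scaleC in_L2_scaleC f)
    then show "L2_class S (\<lambda>t. f k t - f m t) = L2_class S (f k) - L2_class S (f m)"
      using scaleR_scaleC[of "-1" "L2_class S (f m)"] by simp
  qed
  have nn: "(\<integral>\<^sup>+t. ennreal ((norm (ext0 S h t))\<^sup>2) \<partial>lebesgue) = ennreal ((norm (L2_class S h))\<^sup>2)"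
    if "in_L2 S h" for h :: "real \<Rightarrow> 'a"
    using that by (simp add: norm_L2_class nn_integral_eq_integral in_L2_def square_integrable_def)
  have bound: "\<exists>M. \<forall>m\<ge>M. in_L2 S (\<lambda>t. g t - f m t) \<and> norm (L2_class S (\<lambda>t. g t - f m t)) \<le> e" if e: "e > 0" for e
  proof -
    from cauchy e obtain M where M: "\<And>k m. k \<ge> M \<Longrightarrow> m \<ge> M \<Longrightarrow> norm (L2_class S (f k) - L2_class S (f m)) < e"
      unfolding Cauchy_def dist_norm by blast
    have "in_L2 S (\<lambda>t. g t - f m t) \<and> norm (L2_class S (\<lambda>t. g t - f m t)) \<le> e" if m: "m \<ge> M" for m
    proof -
      let ?h = "\<lambda>t. ext0 S (\<lambda>t. g t - f m t) t"
      have sub: "ext0 S (\<lambda>t. h t - f m t) = (\<lambda>t. ext0 S h t - ext0 S (f m) t)" for h by (auto simp: ext0_def)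
      have hm[measurable]: "?h \<in> borel_measurable lebesgue" unfolding sub by measurable
      have "(\<integral>\<^sup>+t. ennreal ((norm (?h t))\<^sup>2) \<partial>lebesgue)
          = (\<integral>\<^sup>+t. liminf (\<lambda>k. ennreal ((norm (ext0 S (\<lambda>t. f k t - f m t) t))\<^sup>2)) \<partial>lebesgue)"
      proof (rule nn_integral_cong)
        fix t
        have "(\<lambda>k. ennreal ((norm (ext0 S (\<lambda>t. f k t - f m t) t))\<^sup>2)) \<longlonglongrightarrow> ennreal ((norm (?h t))\<^sup>2)"
          unfolding sub by (intro tendsto_intros tendsto_ennrealI lim0)
        then show "ennreal ((norm (?h t))\<^sup>2) = liminf (\<lambda>k. ennreal ((norm (ext0 S (\<lambda>t. f k t - f m t) t))\<^sup>2))"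
          by (intro lim_imp_Liminf[symmetric]) auto
      qed
      also have "\<dots> \<le> liminf (\<lambda>k. \<integral>\<^sup>+t. ennreal ((norm (ext0 S (\<lambda>t. f k t - f m t) t))\<^sup>2) \<partial>lebesgue)"
        by (rule nn_integral_liminf) (unfold sub, measurable)
      also have "\<dots> \<le> liminf (\<lambda>k. ennreal (e\<^sup>2))"
      proof (rule Liminf_mono, rule eventually_sequentiallyI[of M])
        fix k assume "k \<ge> M"
        then have "norm (L2_class S (f k) - L2_class S (f m)) \<le> e" using M m by (simp add: less_imp_le)
        then show "(\<integral>\<^sup>+t. ennreal ((norm (ext0 S (\<lambda>t. f k t - f m t) t))\<^sup>2) \<partial>lebesgue) \<le> ennreal (e\<^sup>2)"
          unfolding nn[OF diff(1)] diff(2) by (intro ennreal_leI power_mono) auto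
      qed
      also have "\<dots> = ennreal (e\<^sup>2)" by (simp add: Liminf_const)
      finally have le: "(\<integral>\<^sup>+t. ennreal ((norm (?h t))\<^sup>2) \<partial>lebesgue) \<le> ennreal (e\<^sup>2)" .
      then have "(\<integral>\<^sup>+t. ennreal (norm ((norm (?h t))\<^sup>2)) \<partial>lebesgue) < \<infinity>"
        by (simp only: real_norm_def abs_power2 infinity_ennreal_def) (rule order_le_less_trans[OF le ennreal_less_top])
      then have "integrable lebesgue (\<lambda>t. (norm (?h t))\<^sup>2)"
        by (intro integrableI_bounded) measurable
      then have L: "in_L2 S (\<lambda>t. g t - f m t)"
        using hm unfolding in_L2_def square_integrable_def by simp
      have "ennreal ((norm (L2_class S (\<lambda>t. g t - f m t)))\<^sup>2) \<le> ennreal (e\<^sup>2)" using le unfolding nn[OF L] .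
      then have "norm (L2_class S (\<lambda>t. g t - f m t)) \<le> e"
        unfolding ennreal_le_iff[OF zero_le_power2] by (rule power2_le_imp_le) (use e in simp)
      with L show ?thesis ..
    qed
    then show ?thesis by blast
  qed
  obtain M where "in_L2 S (\<lambda>t. g t - f M t)" using bound[of 1] by auto
  then have "in_L2 S (\<lambda>t. (g t - f M t) + f M t)" by (rule in_L2_add[OF _ f])
  then show g: "in_L2 S g" by simp
  show "(\<lambda>m. L2_class S (f m)) \<longlonglongrightarrow> L2_class S g"
  proof (rule LIMSEQ_I)
    fix e :: real assume e: "e > 0"
    then obtain M where M: "\<And>m. m \<ge> M \<Longrightarrow> in_L2 S (\<lambda>t. g t - f m t)"
        "\<And>m. m \<ge> M \<Longrightarrow> norm (L2_class S (\<lambda>t. g t - f m t)) \<le> e / 2"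
      using bound[of "e / 2"] by auto
    have "norm (L2_class S (f m) - L2_class S g) < e" if "m \<ge> M" for m
    proof -
      have "L2_class S g = L2_class S (\<lambda>t. (g t - f m t) + f m t)" by simp
      also have "\<dots> = L2_class S (\<lambda>t. g t - f m t) + L2_class S (f m)" by (rule L2_class_add[OF M(1)[OF that] f])
      finally show ?thesis using M(2)[OF that] e by (simp add: norm_minus_commute)
    qed
    then show "\<exists>M. \<forall>m\<ge>M. norm (L2_class S (f m) - L2_class S g) < e" by blast
  qed
qed

section \<open>Hessenberg systems\<close>

lemma uniform_limit_sum:
  fixes f :: "'i \<Rightarrow> 'n \<Rightarrow> 'x \<Rightarrow> 'a::real_normed_vector"
  assumes "\<And>i. i \<in> I \<Longrightarrow> uniform_limit S (f i) (l i) G"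
  shows "uniform_limit S (\<lambda>n x. \<Sum>i\<in>I. f i n x) (\<lambda>x. \<Sum>i\<in>I. l i x) G"
  using assms by (induction I rule: infinite_finite_induct) (auto intro!: uniform_limit_add uniform_limit_const)

lemma continuous_on_if_const:
  "(b \<Longrightarrow> continuous_on S f) \<Longrightarrow> continuous_on S (\<lambda>t. if b then f t else 0)"
  by (cases b) simp_all

text \<open>Row \<open>k\<close> of the system expresses the derivative of component
  \<open>k\<close>, and its last nonzero coefficient, the superdiagonal one, has the left inverse
  \<open>B k\<close>. So component \<open>Suc k\<close> can be recovered from this derivative and
  the components up to \<open>k\<close>. The final row has no superdiagonal entry; the inhomogeneity
  will enter there. The set \<open>\<Delta>\<close> is an interval starting at 0 of unspecified
  right end.\<close>

locale hessenberg_system =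
  fixes N :: nat and \<Delta> :: "real set"
    and M :: "nat \<Rightarrow> nat \<Rightarrow> real \<Rightarrow> 'h::{complex_hilbert, second_countable_topology} \<Rightarrow>\<^sub>L 'h"
    and B :: "nat \<Rightarrow> real \<Rightarrow> 'h \<Rightarrow>\<^sub>L 'h"
  assumes N: "N > 0"
    and zero: "0 \<in> \<Delta>" and nonneg: "t \<in> \<Delta> \<Longrightarrow> 0 \<le> t" and down: "t \<in> \<Delta> \<Longrightarrow> {0..t} \<subseteq> \<Delta>"
    and nontrivial: "\<exists>c\<in>\<Delta>. 0 < c"
    and M_cont: "k < N \<Longrightarrow> j < N \<Longrightarrow> continuous_on \<Delta> (M k j)"
    and M_lin: "k < N \<Longrightarrow> j < N \<Longrightarrow> t \<in> \<Delta> \<Longrightarrow> complex_linear (M k j t)"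
    and M_zero: "Suc k < j \<Longrightarrow> M k j t = 0"
    and B_cont: "Suc k < N \<Longrightarrow> continuous_on \<Delta> (B k)"
    and B_inv: "Suc k < N \<Longrightarrow> t \<in> \<Delta> \<Longrightarrow> B k t o\<^sub>L M k (Suc k) t = id_blinfun"
begin

section \<open>A priori bounds for approximate solutions\<close>

definition F :: "nat \<Rightarrow> (nat \<Rightarrow> real \<Rightarrow> 'h) \<Rightarrow> real \<Rightarrow> 'h" where
  "F k u t = (\<Sum>j<N. M k j t (u j t))"

text \<open>For a solution with inhomogeneity \<open>f\<close>, the square roots come from the Cauchy-Schwarz inequality,
  with \<open>a\<close> and \<open>b\<close> the \<open>L\<^sub>2\<close> norms of \<open>u 0\<close> and \<open>f\<close>.\<close>

definition approx_solution :: "real \<Rightarrow> (nat \<Rightarrow> real \<Rightarrow> 'h) \<Rightarrow> real \<Rightarrow> real \<Rightarrow> bool" where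
  "approx_solution c u a b \<longleftrightarrow> 0 \<le> a \<and> 0 \<le> b \<and> (\<forall>k<N. continuous_on {0..c} (u k)) \<and>
     (\<forall>k<N. \<forall>s t. 0 \<le> s \<longrightarrow> s \<le> t \<longrightarrow> t \<le> c \<longrightarrow>
        norm (u k t - u k s - integral {s..t} (F k u)) \<le> b * sqrt (t - s)) \<and>
     (\<forall>s t. 0 \<le> s \<longrightarrow> s \<le> t \<longrightarrow> t \<le> c \<longrightarrow> norm (integral {s..t} (u 0)) \<le> a * sqrt (t - s))"

definition bounded_by :: "real \<Rightarrow> (nat \<Rightarrow> real \<Rightarrow> 'h) \<Rightarrow> real \<Rightarrow> bool" where
  "bounded_by c u S \<longleftrightarrow> (\<forall>j<N. \<forall>t\<in>{0..c}. norm (u j t) \<le> S)"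

lemma approx_solutionD:
  assumes "approx_solution c u a b"
  shows "0 \<le> a" "0 \<le> b" "k < N \<Longrightarrow> continuous_on {0..c} (u k)"
    "k < N \<Longrightarrow> 0 \<le> s \<Longrightarrow> s \<le> t \<Longrightarrow> t \<le> c \<Longrightarrow>
      norm (u k t - u k s - integral {s..t} (F k u)) \<le> b * sqrt (t - s)"
    "0 \<le> s \<Longrightarrow> s \<le> t \<Longrightarrow> t \<le> c \<Longrightarrow> norm (integral {s..t} (u 0)) \<le> a * sqrt (t - s)"
  using assms unfolding approx_solution_def by blast+

lemma bounded_by_nonneg: "bounded_by c u S \<Longrightarrow> t \<in> {0..c} \<Longrightarrow> S \<ge> 0"
  using N norm_ge_zero order_trans unfolding bounded_by_def by blast

lemma continuous_on_F:
  assumes "k < N" "S \<subseteq> \<Delta>" "\<And>j. j < N \<Longrightarrow> continuous_on S (u j)"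
  shows "continuous_on S (F k u)"
  unfolding F_def
  by (intro continuous_intros continuous_on_subset[OF M_cont] assms) (use assms in auto)

lemma coefficient_bound:
  assumes "c \<in> \<Delta>"
  obtains L where "L > 0" "\<And>k j t. k < N \<Longrightarrow> j < N \<Longrightarrow> t \<in> {0..c} \<Longrightarrow> norm (M k j t) \<le> L"
    "\<And>k t. Suc k < N \<Longrightarrow> t \<in> {0..c} \<Longrightarrow> norm (B k t) \<le> L"
proof -
  have c: "{0..c} \<subseteq> \<Delta>" by (rule down[OF assms])
  have bd: "bounded (f ` {0..c})" if "continuous_on \<Delta> f" for f :: "real \<Rightarrow> 'h \<Rightarrow>\<^sub>L 'h"
    by (intro compact_imp_bounded compact_continuous_image continuous_on_subset[OF that c] compact_Icc)
  have "bounded ((\<Union>k\<in>{..<N}. \<Union>j\<in>{..<N}. M k j ` {0..c}) \<union> (\<Union>k\<in>{k. Suc k < N}. B k ` {0..c}))"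
    by (auto intro!: bounded_UN bd M_cont B_cont simp: Suc_less_eq2 intro: finite_subset[of _ "{..<N}"])
  then obtain L where L: "L > 0"
    "\<forall>x \<in> (\<Union>k\<in>{..<N}. \<Union>j\<in>{..<N}. M k j ` {0..c}) \<union> (\<Union>k\<in>{k. Suc k < N}. B k ` {0..c}). norm x \<le> L"
    unfolding bounded_pos by (elim exE conjE) (rule that)
  show thesis by (rule that[OF L(1)]) (rule L(2)[THEN bspec], blast)+
qed

text \<open>Uniform continuity on a compact interval, phrased as an eventual statement so that it
  can be combined with the other smallness conditions on the window length \<open>d\<close>.\<close>

lemma coefficient_modulus:
  assumes c: "c \<in> \<Delta>" and e: "e > 0" and k: "k < N"
  shows "\<forall>\<^sub>F d in at_right 0. \<forall>j\<in>{..<N}. \<forall>s\<in>{0..c}. \<forall>t\<in>{0..c}. \<bar>s - t\<bar> \<le> d \<longrightarrow> norm (M k j s - M k j t) \<le> e"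
proof (rule eventually_ball_finite[OF finite_lessThan], rule ballI)
  fix j assume "j \<in> {..<N}"
  then have "uniformly_continuous_on {0..c} (M k j)"
    using k by (intro compact_uniformly_continuous continuous_on_subset[OF M_cont down[OF c]]) auto
  then obtain d where d: "d > 0" "\<And>s t. s \<in> {0..c} \<Longrightarrow> t \<in> {0..c} \<Longrightarrow> dist s t < d \<Longrightarrow> dist (M k j s) (M k j t) < e"
    using e unfolding uniformly_continuous_on_def by metis
  have "\<forall>\<^sub>F x in at_right 0. x < d" by (rule order_tendstoD(2)[OF tendsto_ident_at d(1)])
  then show "\<forall>\<^sub>F d in at_right 0. \<forall>s\<in>{0..c}. \<forall>t\<in>{0..c}. \<bar>s - t\<bar> \<le> d \<longrightarrow> norm (M k j s - M k j t) \<le> e"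
  proof eventually_elim
    case (elim x)
    then show ?case using d(2) by (force simp: dist_norm intro: less_imp_le)
  qed
qed

lemma norm_F_le:
  assumes "bounded_by c u S" "k < N" "t \<in> {0..c}" "\<And>j. j < N \<Longrightarrow> norm (M k j t) \<le> L" "L \<ge> 0"
  shows "norm (F k u t) \<le> real N * L * S"
proof -
  have "norm (F k u t) \<le> (\<Sum>j<N. L * S :: real)"
    unfolding F_def
  proof (rule sum_norm_le)
    fix j assume "j \<in> {..<N}"
    then have "norm (M k j t (u j t)) \<le> norm (M k j t) * norm (u j t)" "norm (M k j t) \<le> L" "norm (u j t) \<le> S"
      using assms by (auto simp: bounded_by_def norm_blinfun)
    then show "norm (M k j t (u j t)) \<le> L * S"
      using assms(5) by (meson mult_mono norm_ge_zero order_trans)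
  qed
  then show ?thesis by simp
qed

lemma mean_value_estimate:
  fixes g :: "real \<Rightarrow> 'a::banach"
  assumes "continuous_on {s..s + d} g" "0 \<le> d" "\<And>r. r \<in> {s..s + d} \<Longrightarrow> norm (g r - g t) \<le> w"
  shows "d * norm (g t) \<le> norm (integral {s..s + d} g) + w * d"
proof -
  have "integral {s..s + d} (\<lambda>r. g r - g t) = integral {s..s + d} g - d *\<^sub>R g t"
    using assms by (subst integral_diff) (auto intro: integrable_continuous_real)
  moreover have "norm (integral {s..s + d} (\<lambda>r. g r - g t)) \<le> w * (s + d - s)"
    using assms by (intro integral_bound continuous_intros) auto
  moreover have "norm (d *\<^sub>R g t) \<le> norm (integral {s..s + d} g) + norm (integral {s..s + d} g - d *\<^sub>R g t)"
    by (metis norm_triangle_sub norm_minus_commute)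
  ultimately show ?thesis using assms(2) by simp
qed

text \<open>A modulus of continuity common to all components: the integral of \<open>F k u\<close>
  contributes order \<open>d\<close> and the inhomogeneity order \<open>sqrt d\<close>.\<close>

lemma approx_solution_increment:
  assumes c: "c \<in> \<Delta>" and u: "approx_solution c u a b" "bounded_by c u S" and k: "k < N"
    and L: "L \<ge> 0" "\<And>j t. j < N \<Longrightarrow> t \<in> {0..c} \<Longrightarrow> norm (M k j t) \<le> L"
    and st: "s \<in> {0..c}" "t \<in> {0..c}" "\<bar>s - t\<bar> \<le> d"
  shows "norm (u k t - u k s) \<le> real N * L * S * d + b * sqrt d"
proof -
  have S: "S \<ge> 0" by (rule bounded_by_nonneg[OF u(2) st(1)])
  note b = approx_solutionD(2)[OF u(1)]
  have *: "norm (u k t - u k s) \<le> real N * L * S * d + b * sqrt d"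
    if "s \<in> {0..c}" "t \<in> {0..c}" "s \<le> t" "t - s \<le> d" for s t :: real
  proof -
    have "continuous_on {s..t} (F k u)"
      using that by (intro continuous_on_F k order_trans[OF _ down[OF c]])
        (auto intro: continuous_on_subset[OF approx_solutionD(3)[OF u(1)]])
    then have "norm (integral {s..t} (F k u)) \<le> real N * L * S * (t - s)"
      using that by (intro integral_bound norm_F_le[OF u(2) k]) (auto intro!: L)
    also have "\<dots> \<le> real N * L * S * d" using that S L by (intro mult_left_mono) auto
    finally have "norm (integral {s..t} (F k u)) \<le> real N * L * S * d" .
    moreover have "norm (u k t - u k s - integral {s..t} (F k u)) \<le> b * sqrt (t - s)"
      using that by (intro approx_solutionD(4)[OF u(1) k]) auto
    moreover have "b * sqrt (t - s) \<le> b * sqrt d" using that b by (intro mult_left_mono) auto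
    moreover have "norm (u k t - u k s) \<le> norm (u k t - u k s - integral {s..t} (F k u)) + norm (integral {s..t} (F k u))"
      by (metis norm_triangle_sub add.commute)
    ultimately show ?thesis by linarith
  qed
  show ?thesis
  proof (cases "s \<le> t")
    case True
    then show ?thesis using * st by simp
  next
    case False
    then show ?thesis using *[of t s] st by (simp add: norm_minus_commute)
  qed
qed

text \<open>The window starts at \<open>t\<close> unless this would overrun \<open>c\<close>, in
  which case it is moved back to end at \<open>c\<close>.\<close>

lemma window:
  assumes "t \<in> {0..c::real}" "0 < d" "d \<le> c"
  obtains s where "0 \<le> s" "s + d \<le> c" "t \<in> {s..s + d}"
  by (rule that[of "min t (c - d)"]) (use assms in \<open>auto simp: min_def\<close>)

text \<open>Averages of \<open>u 0\<close> over a window are controlled by \<open>a\<close>, and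
  \<open>u 0\<close> differs from its average by at most its oscillation, whose dependence on
  \<open>S\<close> is small for a short window.\<close>

lemma first_component_estimate:
  assumes c: "c \<in> \<Delta>" "0 < c" and e: "e > 0"
  shows "\<exists>C\<ge>0. \<forall>u a b S. approx_solution c u a b \<longrightarrow> bounded_by c u S \<longrightarrow>
      (\<forall>t\<in>{0..c}. norm (u 0 t) \<le> e * S + C * (a + b))"
proof -
  obtain L where L: "L > 0" "\<And>k j t. k < N \<Longrightarrow> j < N \<Longrightarrow> t \<in> {0..c} \<Longrightarrow> norm (M k j t) \<le> L"
    using coefficient_bound[OF c(1)] by metis
  \<comment> \<open>Chosen so that the coefficient \<open>real N * L * d\<close> of \<open>S\<close>
    in the oscillation is at most \<open>e\<close>.\<close>
  define d where "d = min c (e / (real N * L))"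
  have d: "0 < d" "d \<le> c" using c e L N by (auto simp: d_def)
  \<comment> \<open>Dividing the bound \<open>a * sqrt d\<close> for the integral by the window
    length leaves \<open>a * q\<close>.\<close>
  define q where "q = 1 / sqrt d"
  have q: "q \<ge> 0" "sqrt d = q * d" using d by (simp_all add: q_def real_div_sqrt)
  have "d \<le> e / (real N * L)" by (simp add: d_def)
  then have NLd: "real N * L * d \<le> e" using L N by (simp add: field_simps)
  have "norm (u 0 t) \<le> e * S + (q + sqrt d) * (a + b)"
    if u: "approx_solution c u a b" "bounded_by c u S" and t: "t \<in> {0..c}" for u a b S t
  proof -
    have S: "S \<ge> 0" by (rule bounded_by_nonneg[OF u(2) t])
    note ab = approx_solutionD(1,2)[OF u(1)]
    obtain s where s: "0 \<le> s" "s + d \<le> c" "t \<in> {s..s + d}" using window[OF t d] .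
    have "d * norm (u 0 t) \<le> norm (integral {s..s + d} (u 0)) + (real N * L * S * d + b * sqrt d) * d"
    proof (rule mean_value_estimate)
      show "continuous_on {s..s + d} (u 0)"
        using s by (auto intro: continuous_on_subset[OF approx_solutionD(3)[OF u(1) N]])
      show "norm (u 0 r - u 0 t) \<le> real N * L * S * d + b * sqrt d" if "r \<in> {s..s + d}" for r
        using that s t L by (intro approx_solution_increment[OF c(1) u N]) auto
    qed (use d in simp)
    also have "norm (integral {s..s + d} (u 0)) \<le> a * sqrt (s + d - s)"
      using s d by (intro approx_solutionD(5)[OF u(1)]) auto
    also have "s + d - s = d" by simp
    also have "a * sqrt d = (a * q) * d" by (simp add: q(2))
    finally have "d * norm (u 0 t) \<le> (a * q + (real N * L * S * d + b * sqrt d)) * d"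
      by (simp add: algebra_simps)
    then have "norm (u 0 t) \<le> a * q + real N * L * d * S + b * sqrt d"
      using d by (simp add: mult.commute mult.left_commute)
    also have "\<dots> \<le> a * q + e * S + b * sqrt d"
      using mult_right_mono[OF NLd S] by simp
    also have "\<dots> \<le> e * S + (q + sqrt d) * (a + b)"
      using mult_right_mono[of a "a + b" q] mult_right_mono[of b "a + b" "sqrt d"] ab d q(1)
      by (simp add: distrib_right distrib_left mult.commute)
    finally show ?thesis .
  qed
  moreover have "q + sqrt d \<ge> 0" using d q by simp
  ultimately show ?thesis by blast
qed

text \<open>The mean of \<open>F k u\<close> over a window of length \<open>d\<close> is a difference quotient of \<open>u k\<close>, up to an error
  \<open>b / sqrt d\<close>; for small \<open>d\<close> it is close to the value of \<open>F k u\<close> at a point of the window.\<close>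

lemma right_hand_side_estimate:
  assumes c: "c \<in> \<Delta>" "0 < c" and e: "e > 0" and k: "k < N"
    and IH: "\<And>e. e > 0 \<Longrightarrow> \<exists>C\<ge>0. \<forall>u a b S. approx_solution c u a b \<longrightarrow> bounded_by c u S \<longrightarrow>
      (\<forall>t\<in>{0..c}. norm (u k t) \<le> e * S + C * (a + b))"
  shows "\<exists>C\<ge>0. \<forall>u a b S. approx_solution c u a b \<longrightarrow> bounded_by c u S \<longrightarrow>
      (\<forall>t\<in>{0..c}. norm (F k u t) \<le> e * S + C * (a + b))"
proof -
  obtain L where L: "L > 0" "\<And>k j t. k < N \<Longrightarrow> j < N \<Longrightarrow> t \<in> {0..c} \<Longrightarrow> norm (M k j t) \<le> L"
    using coefficient_bound[OF c(1)] by metis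
  \<comment> \<open>The multiple \<open>e\<close> of \<open>S\<close> is split into
    \<open>e/2\<close> for the values of \<open>u k\<close> at the two ends of the window,
    \<open>e/4\<close> for the oscillation of the coefficients and \<open>e/4\<close> for that of
    the components.\<close>
  define e1 where "e1 = e / (4 * real N)"
  have e1: "e1 > 0" "real N * e1 = e / 4" using e N by (auto simp: e1_def)
  have "((\<lambda>d. real N * L * (real N * L) * d) \<longlongrightarrow> real N * L * (real N * L) * 0) (at_right 0)" by (intro tendsto_intros)
  then have ev: "\<forall>\<^sub>F d in at_right 0. real N * L * (real N * L) * d < e / 4" using e by (intro order_tendstoD(2)) auto
  have "\<forall>\<^sub>F d in at_right 0. d < c" by (rule order_tendstoD(2)[OF tendsto_ident_at c(2)])
  with ev coefficient_modulus[OF c(1) e1(1) k] eventually_at_right_less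
  have "\<forall>\<^sub>F d in at_right 0. 0 < d \<and> d < c \<and> real N * L * (real N * L) * d < e / 4 \<and>
     (\<forall>j\<in>{..<N}. \<forall>s\<in>{0..c}. \<forall>t\<in>{0..c}. \<bar>s - t\<bar> \<le> d \<longrightarrow> norm (M k j s - M k j t) \<le> e1)"
    by eventually_elim blast
  from eventually_happens'[OF trivial_limit_at_right_real this]
  obtain d where d: "0 < d" "d < c" and NLd: "real N * L * (real N * L) * d < e / 4"
     and mod: "\<forall>j\<in>{..<N}. \<forall>s\<in>{0..c}. \<forall>t\<in>{0..c}. \<bar>s - t\<bar> \<le> d \<longrightarrow> norm (M k j s - M k j t) \<le> e1"
    by (elim exE conjE) (rule that)
  \<comment> \<open>The difference quotient divides by \<open>d\<close>, so the bound on
    \<open>u k\<close> is taken with a tolerance proportional to \<open>d\<close>. The constant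
    \<open>C\<close> may depend on \<open>d\<close>, which is already fixed.\<close>
  have "e * d / 4 > 0" using e d by simp
  from IH[OF this] obtain C where C: "C \<ge> 0" "\<forall>u a b S. approx_solution c u a b \<longrightarrow> bounded_by c u S \<longrightarrow>
      (\<forall>t\<in>{0..c}. norm (u k t) \<le> e * d / 4 * S + C * (a + b))" by (elim exE conjE) (rule that)
  define q where "q = 1 / sqrt d"
  have q: "q \<ge> 0" "sqrt d = q * d" using d by (simp_all add: q_def real_div_sqrt)
  define C' where "C' = 2 * C / d + q + real N * L * sqrt d"
  have "norm (F k u t) \<le> e * S + C' * (a + b)"
    if u: "approx_solution c u a b" "bounded_by c u S" and t: "t \<in> {0..c}" for u a b S t
  proof -
    have S: "S \<ge> 0" by (rule bounded_by_nonneg[OF u(2) t])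
    note ab = approx_solutionD(1,2)[OF u(1)]
    obtain s where s: "0 \<le> s" "s + d \<le> c" "t \<in> {s..s + d}" using window[OF t d(1) less_imp_le[OF d(2)]] .
    let ?w = "real N * (e1 * S + L * (real N * L * S * d + b * sqrt d))"
    have "d * norm (F k u t) \<le> norm (integral {s..s + d} (F k u)) + ?w * d"
    proof (rule mean_value_estimate)
      show "continuous_on {s..s + d} (F k u)"
        using s by (intro continuous_on_F k order_trans[OF _ down[OF c(1)]])
          (auto intro: continuous_on_subset[OF approx_solutionD(3)[OF u(1)]])
      show "norm (F k u r - F k u t) \<le> ?w" if r: "r \<in> {s..s + d}" for r
      proof -
        have r': "r \<in> {0..c}" "\<bar>r - t\<bar> \<le> d" using r s by auto
        have "norm (F k u r - F k u t) \<le> (\<Sum>j<N. e1 * S + L * (real N * L * S * d + b * sqrt d))"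
          unfolding F_def sum_subtractf[symmetric]
        proof (rule sum_norm_le)
          fix j assume "j \<in> {..<N}"
          then have j: "j < N" by simp
          have "norm (M k j r (u j r) - M k j t (u j t)) = norm ((M k j r - M k j t) (u j r) + M k j t (u j r - u j t))"
            by (simp add: blinfun.diff_left blinfun.diff_right)
          also have "\<dots> \<le> norm (M k j r - M k j t) * norm (u j r) + norm (M k j t) * norm (u j r - u j t)"
            by (intro norm_triangle_le add_mono norm_blinfun)
          also have "\<dots> \<le> e1 * S + L * (real N * L * S * d + b * sqrt d)"
          proof (intro add_mono mult_mono mod[rule_format] L k j r' t)
            show "norm (u j r) \<le> S" using u(2) j r' by (simp add: bounded_by_def)
            show "norm (u j r - u j t) \<le> real N * L * S * d + b * sqrt d"
              using r' t L by (intro approx_solution_increment[OF c(1) u j]) (auto simp: j)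
          qed (use e1 L j in auto)
          finally show "norm (M k j r (u j r) - M k j t (u j t)) \<le> e1 * S + L * (real N * L * S * d + b * sqrt d)" .
        qed
        then show ?thesis by simp
      qed
    qed (use d in simp)
    also have "norm (integral {s..s + d} (F k u)) \<le> (e * d / 4 * S + C * (a + b)) + (e * d / 4 * S + C * (a + b)) + b * sqrt d"
    proof -
      have "norm (u k (s + d) - u k s - integral {s..s + d} (F k u)) \<le> b * sqrt d"
        using approx_solutionD(4)[OF u(1) k, of s "s + d"] s d by simp
      moreover have "norm (u k (s + d)) \<le> e * d / 4 * S + C * (a + b)" "norm (u k s) \<le> e * d / 4 * S + C * (a + b)"
        by (rule C(2)[rule_format, OF u], use s d in simp)+
      moreover have "norm (integral {s..s + d} (F k u)) \<le> norm (u k (s + d)) + norm (u k s)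
          + norm (u k (s + d) - u k s - integral {s..s + d} (F k u))"
        by norm
      ultimately show ?thesis by linarith
    qed
    finally have "d * norm (F k u t) \<le> 2 * (e * d / 4 * S + C * (a + b)) + b * sqrt d + ?w * d" by simp
    also have "b * sqrt d = (b * q) * d" by (simp add: q(2))
    also have "2 * (e * d / 4 * S + C * (a + b)) = (e / 2 * S + 2 * C / d * (a + b)) * d" using d by (simp add: field_simps)
    finally have "d * norm (F k u t) \<le> d * (e / 2 * S + 2 * C / d * (a + b) + b * q + ?w)"
      by (simp add: q(2) algebra_simps)
    then have "norm (F k u t) \<le> e / 2 * S + 2 * C / d * (a + b) + b * q + ?w"
      using d by simp
    also have "?w = (real N * e1) * S + real N * L * (real N * L) * d * S + real N * L * sqrt d * b" by (simp add: algebra_simps)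
    also have "\<dots> \<le> e / 4 * S + e / 4 * S + real N * L * sqrt d * (a + b)"
      unfolding e1(2) using NLd S ab L d by (intro add_mono mult_right_mono mult_left_mono) auto
    also have "b * q \<le> q * (a + b)" using ab q by (simp add: mult.commute[of b] mult_left_mono)
    finally show ?thesis by (simp add: C'_def algebra_simps)
  qed
  moreover have "C' \<ge> 0" using C d L q by (simp add: C'_def)
  ultimately show ?thesis by blast
qed

text \<open>By the Hessenberg shape the sum in \<open>F k u\<close> stops at \<open>Suc k\<close>,
  so row \<open>k\<close> can be solved for that component.\<close>

lemma component_recovery:
  assumes k: "Suc k < N" and t: "t \<in> \<Delta>"
  shows "u (Suc k) t = B k t (F k u t - (\<Sum>j\<le>k. M k j t (u j t)))"
proof -
  have "F k u t = (\<Sum>j\<le>Suc k. M k j t (u j t))"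
    unfolding F_def using k by (intro sum.mono_neutral_right) (auto simp: M_zero)
  then have "F k u t - (\<Sum>j\<le>k. M k j t (u j t)) = M k (Suc k) t (u (Suc k) t)" by simp
  moreover have "B k t (M k (Suc k) t x) = x" for x
    using B_inv[OF k t] by (metis blinfun_apply_blinfun_compose id_blinfun.rep_eq)
  ultimately show ?thesis by simp
qed

text \<open>An interpolation inequality proved along the superdiagonal. The tolerance
  \<open>e\<close> must be arbitrary at every stage, because the step to \<open>Suc k\<close> uses
  the bound for \<open>k\<close> with much smaller tolerances.\<close>

lemma component_estimate:
  assumes c: "c \<in> \<Delta>" "0 < c"
  shows "k < N \<Longrightarrow> e > 0 \<Longrightarrow> \<exists>C\<ge>0. \<forall>u a b S. approx_solution c u a b \<longrightarrow> bounded_by c u S \<longrightarrow>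
      (\<forall>j\<le>k. \<forall>t\<in>{0..c}. norm (u j t) \<le> e * S + C * (a + b))"
proof (induction k arbitrary: e)
  case 0
  then show ?case using first_component_estimate[OF c, of e] by simp
next
  case (Suc k)
  obtain L where L: "L > 0" "\<And>k j t. k < N \<Longrightarrow> j < N \<Longrightarrow> t \<in> {0..c} \<Longrightarrow> norm (M k j t) \<le> L"
    "\<And>k t. Suc k < N \<Longrightarrow> t \<in> {0..c} \<Longrightarrow> norm (B k t) \<le> L"
    using coefficient_bound[OF c(1)] by metis
  \<comment> \<open>In the recovery formula \<open>B k\<close> costs a factor \<open>L\<close>. The
    lower components, \<open>Suc k\<close> terms each with another factor \<open>L\<close>, and
    \<open>F k u\<close> are allotted \<open>e/2\<close> apiece; the minimum with \<open>e\<close>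
    serves the components of index at most \<open>k\<close>.\<close>
  define e1 where "e1 = min e (e / (2 * (L * (real (Suc k) * L))))"
  define e2 where "e2 = e / (2 * L)"
  have e: "e1 > 0" "e1 \<le> e" "e2 > 0" using Suc.prems L by (auto simp: e1_def e2_def)
  have "e1 \<le> e / (2 * (L * (real (Suc k) * L)))" by (simp add: e1_def)
  then have eL: "L * (real (Suc k) * L) * e1 \<le> e / 2" "L * e2 = e / 2"
    using L(1) by (simp_all add: e2_def field_simps del: of_nat_Suc)
  have "k < N" using Suc.prems by simp
  from Suc.IH[OF this e(1)] obtain C1 where C1: "C1 \<ge> 0" "\<forall>u a b S. approx_solution c u a b \<longrightarrow> bounded_by c u S \<longrightarrow>
      (\<forall>j\<le>k. \<forall>t\<in>{0..c}. norm (u j t) \<le> e1 * S + C1 * (a + b))" by (elim exE conjE) (rule that)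
  have uk: "\<exists>C\<ge>0. \<forall>u a b S. approx_solution c u a b \<longrightarrow> bounded_by c u S \<longrightarrow>
      (\<forall>t\<in>{0..c}. norm (u k t) \<le> e * S + C * (a + b))" if "e > 0" for e
  proof -
    from Suc.IH[OF \<open>k < N\<close> that] obtain C where "C \<ge> 0" "\<forall>u a b S. approx_solution c u a b \<longrightarrow> bounded_by c u S \<longrightarrow>
      (\<forall>j\<le>k. \<forall>t\<in>{0..c}. norm (u j t) \<le> e * S + C * (a + b))" by (elim exE conjE) (rule that)
    then show ?thesis by (intro exI[of _ C]) simp
  qed
  have "\<exists>C\<ge>0. \<forall>u a b S. approx_solution c u a b \<longrightarrow> bounded_by c u S \<longrightarrow>
      (\<forall>t\<in>{0..c}. norm (F k u t) \<le> e2 * S + C * (a + b))"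
    by (rule right_hand_side_estimate[OF c e(3) \<open>k < N\<close> uk])
  then obtain C2 where C2: "C2 \<ge> 0" "\<forall>u a b S. approx_solution c u a b \<longrightarrow> bounded_by c u S \<longrightarrow>
      (\<forall>t\<in>{0..c}. norm (F k u t) \<le> e2 * S + C2 * (a + b))" by (elim exE conjE) (rule that)
  define C where "C = C1 + L * (C2 + real (Suc k) * L * C1)"
  have "norm (u j t) \<le> e * S + C * (a + b)"
    if u: "approx_solution c u a b" "bounded_by c u S" and j: "j \<le> Suc k" and t: "t \<in> {0..c}" for u a b S j t
  proof -
    have S: "S \<ge> 0" by (rule bounded_by_nonneg[OF u(2) t])
    note ab = approx_solutionD(1,2)[OF u(1)]
    have low: "norm (u j t) \<le> e1 * S + C1 * (a + b)" if "j \<le> k" for j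
      using C1(2)[rule_format, OF u that t] .
    show ?thesis
    proof (cases "j \<le> k")
      case True
      have "e1 * S \<le> e * S" "C1 * (a + b) \<le> C * (a + b)"
        using e S ab C1 C2 L by (auto intro!: mult_right_mono simp: C_def)
      with low[OF True] show ?thesis by linarith
    next
      case False
      then have j: "j = Suc k" using j by simp
      have tD: "t \<in> \<Delta>" using t down[OF c(1)] by auto
      have "norm (u j t) \<le> norm (B k t) * norm (F k u t - (\<Sum>j\<le>k. M k j t (u j t)))"
        unfolding j component_recovery[OF Suc.prems(1) tD] by (rule norm_blinfun)
      also have "\<dots> \<le> L * ((e2 * S + C2 * (a + b)) + real (Suc k) * (L * (e1 * S + C1 * (a + b))))"
      proof (intro mult_mono L(3) Suc.prems t norm_triangle_le_diff add_mono)
        show "norm (F k u t) \<le> e2 * S + C2 * (a + b)" using C2(2)[rule_format, OF u t] .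
        have "norm (\<Sum>j\<le>k. M k j t (u j t)) \<le> (\<Sum>j\<le>k. L * (e1 * S + C1 * (a + b)))"
        proof (rule sum_norm_le)
          fix j assume "j \<in> {..k}"
          then have jk: "j \<le> k" "j < N" using \<open>k < N\<close> by auto
          show "norm (M k j t (u j t)) \<le> L * (e1 * S + C1 * (a + b))"
            by (rule order_trans[OF norm_blinfun mult_mono]) (use jk low t L \<open>k < N\<close> in auto)
        qed
        then show "norm (\<Sum>j\<le>k. M k j t (u j t)) \<le> real (Suc k) * (L * (e1 * S + C1 * (a + b)))" by simp
      qed (use L in auto)
      also have "\<dots> = (L * e2) * S + (L * (real (Suc k) * L) * e1) * S + L * (C2 + real (Suc k) * L * C1) * (a + b)"
        by (simp add: algebra_simps)
      also have "\<dots> \<le> e / 2 * S + e / 2 * S + C * (a + b)"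
        unfolding eL(2) using eL(1) S ab C1(1) by (intro add_mono mult_right_mono) (auto simp: C_def)
      also have "\<dots> = e * S + C * (a + b)" by simp
      finally show ?thesis .
    qed
  qed
  moreover have "C \<ge> 0" using C1 C2 L by (simp add: C_def)
  ultimately show ?case by blast
qed

text \<open>Take \<open>S\<close> to be the supremum of all components and absorb the term \<open>S / 2\<close>.\<close>

lemma approx_solution_estimate:
  assumes c: "c \<in> \<Delta>" "0 < c"
  shows "\<exists>C\<ge>0. \<forall>u a b. approx_solution c u a b \<longrightarrow>
      (\<forall>k<N. \<forall>t\<in>{0..c}. norm (u k t) \<le> C * (a + b))"
proof -
  have "N - 1 < N" using N by simp
  from component_estimate[OF c this, of "1/2"] obtain C where C: "C \<ge> 0"
    "\<forall>u a b S. approx_solution c u a b \<longrightarrow> bounded_by c u S \<longrightarrow>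
      (\<forall>j\<le>N - 1. \<forall>t\<in>{0..c}. norm (u j t) \<le> 1/2 * S + C * (a + b))" by auto
  have "norm (u k t) \<le> 2 * C * (a + b)" if u: "approx_solution c u a b" and k: "k < N" and t: "t \<in> {0..c}" for u a b k t
  proof -
    define X where "X = (\<Union>j\<in>{..<N}. (\<lambda>t. norm (u j t)) ` {0..c})"
    have "bounded X" unfolding X_def
      by (intro bounded_UN finite_lessThan ballI compact_imp_bounded compact_continuous_image continuous_on_norm
          compact_Icc approx_solutionD(3)[OF u]) auto
    then have bdd: "bdd_above X" by (rule bounded_imp_bdd_above)
    have ne: "norm (u k t) \<in> X" unfolding X_def by (rule UN_I[of k], use k in simp, rule imageI, rule t)
    have "bounded_by c u (Sup X)"
      unfolding bounded_by_def using bdd by (auto intro!: cSup_upper simp: X_def)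
    then have le: "x \<le> 1/2 * Sup X + C * (a + b)" if "x \<in> X" for x
      using C(2)[rule_format, OF u] that by (auto simp: X_def)
    have "Sup X \<le> 1/2 * Sup X + C * (a + b)"
      by (rule cSup_least[OF _ le]) (use ne in auto)
    moreover have "norm (u k t) \<le> Sup X" by (rule cSup_upper[OF ne bdd])
    ultimately show ?thesis by simp
  qed
  then show ?thesis using C(1) by (intro exI[of _ "2 * C"]) auto
qed

section \<open>Solutions as pairs of square integrable classes\<close>

text \<open>\<open>u\<close> solves the system with first component in the class \<open>v\<close> and inhomogeneity \<open>f\<close> in the
  class \<open>w\<close>, entering the last equation with a minus sign. In terms of the differential expression,
  \<open>v\<close> is in the domain of the maximal operator and \<open>w\<close> is its image.\<close>

definition Sol :: "(nat \<Rightarrow> real \<Rightarrow> 'h) \<Rightarrow> 'h L2 \<Rightarrow> 'h L2 \<Rightarrow> bool" where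
  "Sol u v w \<longleftrightarrow> in_L2 \<Delta> (u 0) \<and> L2_class \<Delta> (u 0) = v \<and>
     (\<forall>k<N. continuous_on \<Delta> (u k)) \<and>
     (\<exists>f. in_L2 \<Delta> f \<and> L2_class \<Delta> f = w \<and>
       (\<forall>k<N. \<forall>s\<in>\<Delta>. \<forall>t\<in>\<Delta>. s \<le> t \<longrightarrow>
         ((\<lambda>r. F k u r - (if Suc k = N then f r else 0)) has_integral u k t - u k s) {s..t}))"

lemma SolE:
  assumes "Sol u v w"
  obtains f where "in_L2 \<Delta> (u 0)" "L2_class \<Delta> (u 0) = v" "\<And>k. k < N \<Longrightarrow> continuous_on \<Delta> (u k)"
    "in_L2 \<Delta> f" "L2_class \<Delta> f = w"
    "\<And>k s t. k < N \<Longrightarrow> s \<in> \<Delta> \<Longrightarrow> t \<in> \<Delta> \<Longrightarrow> s \<le> t \<Longrightarrow>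
         ((\<lambda>r. F k u r - (if Suc k = N then f r else 0)) has_integral u k t - u k s) {s..t}"
  using assms unfolding Sol_def by (elim conjE exE) (rule that, auto)

lemma interval_subset: "s \<in> \<Delta> \<Longrightarrow> t \<in> \<Delta> \<Longrightarrow> {s..t} \<subseteq> \<Delta>"
  using down[of t] nonneg[of s] by auto

lemma F_add: "F k (\<lambda>k t. u k t + u' k t) t = F k u t + F k u' t"
  by (simp add: F_def blinfun.add_right sum.distrib)

lemma F_scaleC: "k < N \<Longrightarrow> t \<in> \<Delta> \<Longrightarrow> F k (\<lambda>k t. c *\<^sub>C u k t) t = c *\<^sub>C F k u t"
  unfolding F_def scaleC_sum by (intro sum.cong) (use M_lin in \<open>auto simp: complex_linear_def\<close>)

lemma Sol_add:
  assumes "Sol u v w" "Sol u' v' w'"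
  shows "Sol (\<lambda>k t. u k t + u' k t) (v + v') (w + w')"
proof -
  obtain f where f: "in_L2 \<Delta> (u 0)" "L2_class \<Delta> (u 0) = v" "\<And>k. k < N \<Longrightarrow> continuous_on \<Delta> (u k)"
    "in_L2 \<Delta> f" "L2_class \<Delta> f = w"
    "\<And>k s t. k < N \<Longrightarrow> s \<in> \<Delta> \<Longrightarrow> t \<in> \<Delta> \<Longrightarrow> s \<le> t \<Longrightarrow>
         ((\<lambda>r. F k u r - (if Suc k = N then f r else 0)) has_integral u k t - u k s) {s..t}"
    using assms(1) by (rule SolE) blast
  obtain f' where f': "in_L2 \<Delta> (u' 0)" "L2_class \<Delta> (u' 0) = v'" "\<And>k. k < N \<Longrightarrow> continuous_on \<Delta> (u' k)"
    "in_L2 \<Delta> f'" "L2_class \<Delta> f' = w'"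
    "\<And>k s t. k < N \<Longrightarrow> s \<in> \<Delta> \<Longrightarrow> t \<in> \<Delta> \<Longrightarrow> s \<le> t \<Longrightarrow>
         ((\<lambda>r. F k u' r - (if Suc k = N then f' r else 0)) has_integral u' k t - u' k s) {s..t}"
    using assms(2) by (rule SolE) blast
  show ?thesis
    unfolding Sol_def
  proof (intro conjI exI[of _ "\<lambda>t. f t + f' t"] allI impI ballI)
    fix k s t assume "k < N" "s \<in> \<Delta>" "t \<in> \<Delta>" "s \<le> t"
    from has_integral_add[OF f(6)[OF this] f'(6)[OF this]]
    show "((\<lambda>r. F k (\<lambda>k t. u k t + u' k t) r - (if Suc k = N then f r + f' r else 0))
        has_integral u k t + u' k t - (u k s + u' k s)) {s..t}"
      by (cases "Suc k = N") (simp_all add: F_add algebra_simps)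
  qed (use f f' in \<open>auto intro!: in_L2_add L2_class_add continuous_on_add\<close>)
qed

lemma Sol_scaleC:
  assumes "Sol u v w"
  shows "Sol (\<lambda>k t. c *\<^sub>C u k t) (c *\<^sub>C v) (c *\<^sub>C w)"
proof -
  obtain f where f: "in_L2 \<Delta> (u 0)" "L2_class \<Delta> (u 0) = v" "\<And>k. k < N \<Longrightarrow> continuous_on \<Delta> (u k)"
    "in_L2 \<Delta> f" "L2_class \<Delta> f = w"
    "\<And>k s t. k < N \<Longrightarrow> s \<in> \<Delta> \<Longrightarrow> t \<in> \<Delta> \<Longrightarrow> s \<le> t \<Longrightarrow>
         ((\<lambda>r. F k u r - (if Suc k = N then f r else 0)) has_integral u k t - u k s) {s..t}"
    using assms(1) by (rule SolE) blast
  interpret scaleC: bounded_linear "\<lambda>x::'h. c *\<^sub>C x" by (rule bounded_linear_scaleC)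
  show ?thesis
    unfolding Sol_def
  proof (intro conjI exI[of _ "\<lambda>t. c *\<^sub>C f t"] allI impI ballI)
    fix k s t assume kst: "k < N" "s \<in> \<Delta>" "t \<in> \<Delta>" "s \<le> t"
    from has_integral_linear[OF f(6)[OF kst] bounded_linear_scaleC[of c]]
    have "((\<lambda>r. c *\<^sub>C (F k u r - (if Suc k = N then f r else 0))) has_integral c *\<^sub>C u k t - c *\<^sub>C u k s) {s..t}"
      by (simp add: o_def scaleC.diff)
    then show "((\<lambda>r. F k (\<lambda>k t. c *\<^sub>C u k t) r - (if Suc k = N then c *\<^sub>C f r else 0))
        has_integral c *\<^sub>C u k t - c *\<^sub>C u k s) {s..t}"
      by (rule has_integral_eq[rotated])
        (use interval_subset[OF kst(2,3)] F_scaleC[OF kst(1)] in \<open>auto simp: scaleC.diff\<close>)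
  next
    show "continuous_on \<Delta> (\<lambda>t. c *\<^sub>C u k t)" if "k < N" for k
      by (rule bounded_linear.continuous_on[OF bounded_linear_scaleC f(3)[OF that]])
  qed (use f in \<open>auto intro!: in_L2_scaleC L2_class_scaleC\<close>)
qed

lemma Sol_approx_solution:
  assumes u: "Sol u v w" and c: "c \<in> \<Delta>"
  shows "approx_solution c u (norm v) (norm w)"
proof -
  obtain f where f: "in_L2 \<Delta> (u 0)" "L2_class \<Delta> (u 0) = v" "\<And>k. k < N \<Longrightarrow> continuous_on \<Delta> (u k)"
    "in_L2 \<Delta> f" "L2_class \<Delta> f = w"
    "\<And>k s t. k < N \<Longrightarrow> s \<in> \<Delta> \<Longrightarrow> t \<in> \<Delta> \<Longrightarrow> s \<le> t \<Longrightarrow>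
         ((\<lambda>r. F k u r - (if Suc k = N then f r else 0)) has_integral u k t - u k s) {s..t}"
    using u by (rule SolE) blast
  have sub: "{0..c} \<subseteq> \<Delta>" by (rule down[OF c])
  show ?thesis
    unfolding approx_solution_def
  proof (intro conjI allI impI)
    show "continuous_on {0..c} (u k)" if "k < N" for k
      by (rule continuous_on_subset[OF f(3)[OF that] sub])
  next
    fix k s t assume k: "k < N" and st: "0 \<le> s" "s \<le> t" "t \<le> c"
    have st': "s \<in> \<Delta>" "t \<in> \<Delta>" using sub st by auto
    have "continuous_on {s..t} (F k u)"
      by (intro continuous_on_F k interval_subset st' continuous_on_subset[OF f(3)])
    then have "(F k u has_integral integral {s..t} (F k u)) {s..t}"
      by (intro integrable_integral integrable_continuous_real)
    from has_integral_diff[OF this f(6)[OF k st' st(2)]]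
    have int: "((\<lambda>r. if Suc k = N then f r else 0) has_integral integral {s..t} (F k u) - (u k t - u k s)) {s..t}"
      by simp
    have "norm (integral {s..t} (F k u) - (u k t - u k s)) \<le> norm w * sqrt (t - s)"
    proof (cases "Suc k = N")
      case True
      then show ?thesis
        using norm_integral_le_L2[OF f(4) interval_subset[OF st'] st(2)] int f(5) by simp
    next
      case False
      then have "integral {s..t} (F k u) - (u k t - u k s) = 0" using int by simp
      then show ?thesis using st by simp
    qed
    then show "norm (u k t - u k s - integral {s..t} (F k u)) \<le> norm w * sqrt (t - s)"
      by (simp add: norm_minus_commute)
  next
    fix s t assume st: "0 \<le> s" "s \<le> t" "t \<le> c"
    have st': "s \<in> \<Delta>" "t \<in> \<Delta>" using sub st by auto
    have "continuous_on {s..t} (u 0)"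
      by (rule continuous_on_subset[OF f(3)[OF N] interval_subset[OF st']])
    then show "norm (integral {s..t} (u 0)) \<le> norm v * sqrt (t - s)"
      using norm_integral_le_L2[OF f(1) interval_subset[OF st'] st(2)] f(2)
      by (simp add: integrable_integral integrable_continuous_real)
  qed auto
qed

lemma Sol_estimate:
  assumes c: "c \<in> \<Delta>"
  obtains C where "C \<ge> 0" "\<forall>u v w. Sol u v w \<longrightarrow> (\<forall>k<N. \<forall>t\<in>{0..c}. norm (u k t) \<le> C * (norm v + norm w))"
proof -
  \<comment> \<open>The averaging windows need an interval of positive length, whereas
    \<open>c\<close> may be 0.\<close>
  obtain c' where c': "c' \<in> \<Delta>" "0 < c'" "c \<le> c'"
  proof (cases "c > 0")
    case True
    then show thesis using that[of c] c by simp
  next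
    case False
    then show thesis using nontrivial that by auto
  qed
  from approx_solution_estimate[OF c'(1,2)] obtain C where C: "C \<ge> 0"
    "\<forall>u a b. approx_solution c' u a b \<longrightarrow> (\<forall>k<N. \<forall>t\<in>{0..c'}. norm (u k t) \<le> C * (a + b))" by (elim exE conjE) (rule that)
  show thesis
    by (rule that[OF C(1)], intro allI impI ballI, rule C(2)[rule_format], use c' Sol_approx_solution in auto)
qed

lemma Sol_diff:
  assumes "Sol u v w" "Sol u' v' w'"
  shows "Sol (\<lambda>k t. u k t - u' k t) (v - v') (w - w')"
proof -
  have *: "(-1) *\<^sub>C x = - x" for x :: "'b::complex_normed_vector" using scaleR_scaleC[of "-1" x] by simp
  show ?thesis using Sol_add[OF assms(1) Sol_scaleC[OF assms(2), of "-1"]] by (simp add: *)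
qed

text \<open>The a priori bound for a difference of solutions with the same classes is zero. Hence
  all components are functions of the pair of classes, at every point and not merely almost
  everywhere.\<close>

lemma Sol_unique:
  assumes "Sol u v w" "Sol u' v w" "k < N" "t \<in> \<Delta>"
  shows "u k t = u' k t"
proof -
  obtain C where C: "C \<ge> 0" "\<forall>u v w. Sol u v w \<longrightarrow> (\<forall>k<N. \<forall>s\<in>{0..t}. norm (u k s) \<le> C * (norm v + norm w))"
    using Sol_estimate[OF assms(4)] .
  have "norm (u k t - u' k t) \<le> C * (norm (v - v) + norm (w - w))"
    by (rule C(2)[rule_format, OF Sol_diff[OF assms(1,2)] assms(3)]) (use nonneg[OF assms(4)] in simp)
  then show ?thesis by simp
qed

text \<open>Localises limits and derivatives within \<open>\<Delta>\<close> to a compact interval,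
  where the uniform bounds are available. If \<open>t\<close> is the right end point of
  \<open>\<Delta>\<close>, that interval is \<open>\<Delta>\<close> itself.\<close>

lemma at_within_eq_initial_interval:
  assumes t: "t \<in> \<Delta>"
  obtains c where "c \<in> \<Delta>" "t \<in> {0..c}" "at t within \<Delta> = at t within {0..c}"
proof (cases "\<exists>c\<in>\<Delta>. t < c")
  case True
  then obtain c where c: "c \<in> \<Delta>" "t < c" by blast
  have "at t within \<Delta> = at t within {0..c}"
    using down[OF c(1)] nonneg c(2) by (intro at_within_nhd[of _ "{..<c}"]) auto
  then show ?thesis using that[of c] c nonneg[OF t] by simp
next
  case False
  then have "\<Delta> = {0..t}" using down[OF t] nonneg by force
  then show ?thesis using that[of t] t nonneg[OF t] by simp
qed

section \<open>Homogeneous solutions and their closed spaces\<close>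

text \<open>Plays the part of \<open>Ker (L - \<mu>)\<close>, but consists of classes rather than
  functions, so that it is a subspace of a Hilbert space and can serve as \<open>K'\<close>.\<close>

definition eigenspace :: "complex \<Rightarrow> 'h L2 set" where
  "eigenspace \<mu> = {v. \<exists>u. Sol u v (\<mu> *\<^sub>C v)}"

text \<open>For an eigenfunction the inhomogeneity agrees almost everywhere with
  \<open>\<mu> *\<^sub>C u 0\<close>. Substituting this makes the right-hand side continuous, so the
  integral equations can be differentiated at every point.\<close>

definition Phi :: "complex \<Rightarrow> nat \<Rightarrow> (nat \<Rightarrow> real \<Rightarrow> 'h) \<Rightarrow> real \<Rightarrow> 'h" where
  "Phi \<mu> k u t = F k u t - (if Suc k = N then \<mu> *\<^sub>C u 0 t else 0)"

lemma continuous_on_Phi: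
  assumes "k < N" "S \<subseteq> \<Delta>" "\<And>j. j < N \<Longrightarrow> continuous_on S (u j)"
  shows "continuous_on S (Phi \<mu> k u)"
  unfolding Phi_def
proof (intro continuous_on_diff continuous_on_F assms)
  show "continuous_on S (\<lambda>x. if Suc k = N then \<mu> *\<^sub>C u 0 x else 0)"
    by (cases "Suc k = N") (simp_all add: bounded_linear.continuous_on[OF bounded_linear_scaleC assms(3)[OF N]])
qed

lemma Sol_eigenspace_integral:
  assumes u: "Sol u v (\<mu> *\<^sub>C v)" and k: "k < N" and st: "s \<in> \<Delta>" "t \<in> \<Delta>" "s \<le> t"
  shows "(Phi \<mu> k u has_integral u k t - u k s) {s..t}"
proof -
  obtain f where f: "in_L2 \<Delta> (u 0)" "L2_class \<Delta> (u 0) = v" "\<And>k. k < N \<Longrightarrow> continuous_on \<Delta> (u k)"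
    "in_L2 \<Delta> f" "L2_class \<Delta> f = \<mu> *\<^sub>C v"
    "\<And>k s t. k < N \<Longrightarrow> s \<in> \<Delta> \<Longrightarrow> t \<in> \<Delta> \<Longrightarrow> s \<le> t \<Longrightarrow>
         ((\<lambda>r. F k u r - (if Suc k = N then f r else 0)) has_integral u k t - u k s) {s..t}"
    using u by (rule SolE) blast
  have "L2_class \<Delta> f = L2_class \<Delta> (\<lambda>t. \<mu> *\<^sub>C u 0 t)" using f by (simp add: L2_class_scaleC)
  from L2_class_eqD[OF this f(4) in_L2_scaleC[OF f(1)]]
  obtain E where E: "{t \<in> space lebesgue. \<not> (t \<in> \<Delta> \<longrightarrow> f t = \<mu> *\<^sub>C u 0 t)} \<subseteq> E"
    "emeasure lebesgue E = 0" "E \<in> sets lebesgue"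
    by (rule AE_E)
  then have "negligible E" by (simp add: negligible_iff_null_sets null_sets_def)
  moreover have "Phi \<mu> k u r = F k u r - (if Suc k = N then f r else 0)" if "r \<in> {s..t} - E" for r
  proof -
    have "r \<in> \<Delta>" using interval_subset[OF st(1,2)] that by blast
    then have "f r = \<mu> *\<^sub>C u 0 r" using E(1) that by auto
    then show ?thesis by (simp add: Phi_def)
  qed
  ultimately show ?thesis
    by (rule has_integral_spike[OF _ _ f(6)[OF k st], of E])
qed

lemma SolI_eigenspace:
  assumes "in_L2 \<Delta> (u 0)" "\<And>k. k < N \<Longrightarrow> continuous_on \<Delta> (u k)"
    "\<And>k s t. k < N \<Longrightarrow> s \<in> \<Delta> \<Longrightarrow> t \<in> \<Delta> \<Longrightarrow> s \<le> t \<Longrightarrow> (Phi \<mu> k u has_integral u k t - u k s) {s..t}"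
  shows "Sol u (L2_class \<Delta> (u 0)) (\<mu> *\<^sub>C L2_class \<Delta> (u 0))"
  unfolding Sol_def
  using assms by (intro conjI exI[of _ "\<lambda>t. \<mu> *\<^sub>C u 0 t"])
    (auto intro!: in_L2_scaleC L2_class_scaleC simp: Phi_def[abs_def])

lemma Sol_continuous: "Sol u v w \<Longrightarrow> k < N \<Longrightarrow> continuous_on \<Delta> (u k)"
  by (simp add: Sol_def)

lemma Sol_eigenspace_derivative:
  assumes u: "Sol u v (\<mu> *\<^sub>C v)" and k: "k < N" and t: "t \<in> \<Delta>"
  shows "(u k has_vector_derivative Phi \<mu> k u t) (at t within \<Delta>)"
proof -
  obtain c where c: "c \<in> \<Delta>" "t \<in> {0..c}" "at t within \<Delta> = at t within {0..c}"
    using at_within_eq_initial_interval[OF t] .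
  have sub: "{0..c} \<subseteq> \<Delta>" by (rule down[OF c(1)])
  have "continuous_on {0..c} (Phi \<mu> k u)"
    by (intro continuous_on_Phi k sub continuous_on_subset[OF Sol_continuous[OF u]])
  from integral_has_vector_derivative[OF this c(2)]
  have d: "((\<lambda>x. u k 0 + integral {0..x} (Phi \<mu> k u)) has_vector_derivative Phi \<mu> k u t) (at t within {0..c})"
    by (auto intro!: derivative_eq_intros)
  have eq: "u k x = u k 0 + integral {0..x} (Phi \<mu> k u)" if "x \<in> {0..c}" for x
    using Sol_eigenspace_integral[OF u k zero, of x] sub that by (auto simp: integral_unique)
  show ?thesis
    unfolding c(3) by (rule has_vector_derivative_transform[OF c(2) eq d])
qed

lemma L2_class_in_L2_on: "in_L2 \<Delta> y \<Longrightarrow> L2_class \<Delta> y \<in> L2_on \<Delta>"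
  by (auto simp: L2_on_def)

lemma Sol_in_L2_on: "Sol u v w \<Longrightarrow> v \<in> L2_on \<Delta>"
  by (auto simp: Sol_def intro: L2_class_in_L2_on)

lemma in_L2_zero: "in_L2 \<Delta> (\<lambda>t. 0)"
  by (simp add: in_L2_def ext0_def square_integrable_zero)

lemma Sol_zero: "Sol (\<lambda>k t. 0) 0 0"
proof -
  have "L2_class \<Delta> (\<lambda>t. 0 :: 'h) = 0"
    using L2_class_add[OF in_L2_zero in_L2_zero] by simp
  then show ?thesis
    unfolding Sol_def using in_L2_zero
    by (intro conjI exI[of _ "\<lambda>t. 0"]) (auto simp: F_def has_integral_0 cong: if_cong)
qed

lemma csubspace_eigenspace: "csubspace (eigenspace \<mu>)"
  unfolding csubspace_def eigenspace_def
proof (intro conjI ballI allI)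
  show "0 \<in> {v. \<exists>u. Sol u v (\<mu> *\<^sub>C v)}" using Sol_zero by auto
next
  fix v w assume "v \<in> {v. \<exists>u. Sol u v (\<mu> *\<^sub>C v)}" "w \<in> {v. \<exists>u. Sol u v (\<mu> *\<^sub>C v)}"
  then show "v + w \<in> {v. \<exists>u. Sol u v (\<mu> *\<^sub>C v)}" using Sol_add by (auto simp: scaleC_add_right) blast
next
  fix c v assume "v \<in> {v. \<exists>u. Sol u v (\<mu> *\<^sub>C v)}"
  then obtain u where "Sol u v (\<mu> *\<^sub>C v)" by blast
  from Sol_scaleC[OF this, of c] show "c *\<^sub>C v \<in> {v. \<exists>u. Sol u v (\<mu> *\<^sub>C v)}"
    by (auto simp: scaleC_scaleC mult.commute)
qed

text \<open>A Cauchy sequence of classes has representatives whose components are uniformly Cauchy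
  on compact intervals, by the a priori bound. The integral equations pass to the uniform limit, and
  \<open>L2_limit\<close> shows that its class is the limit in \<open>L2\<close>.\<close>

lemma complete_eigenspace: "complete (eigenspace \<mu>)"
  unfolding complete_def
proof (intro allI impI, elim conjE)
  fix v assume v: "\<forall>m. v m \<in> eigenspace \<mu>" and cauchy: "Cauchy v"
  then obtain u where u: "\<And>m. Sol (u m) (v m) (\<mu> *\<^sub>C v m)" unfolding eigenspace_def by (auto simp: choice_iff)
  define U where "U k t = lim (\<lambda>m. u m k t)" for k t
  have unif: "uniform_limit {0..c} (\<lambda>m. u m k) (U k) sequentially" if c: "c \<in> \<Delta>" and k: "k < N" for c k
  proof -
    obtain C where C: "C \<ge> 0" "\<forall>u v w. Sol u v w \<longrightarrow> (\<forall>k<N. \<forall>t\<in>{0..c}. norm (u k t) \<le> C * (norm v + norm w))"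
      using Sol_estimate[OF c] .
    have le: "norm (u m k t - u j k t) \<le> C * (1 + cmod \<mu>) * norm (v m - v j)" if "t \<in> {0..c}" for m j t
    proof -
      have "\<mu> *\<^sub>C v m - \<mu> *\<^sub>C v j = \<mu> *\<^sub>C (v m - v j)"
        by (simp add: scaleC_diff)
      then have "norm (u m k t - u j k t) \<le> C * (norm (v m - v j) + norm (\<mu> *\<^sub>C (v m - v j)))"
        using C(2)[rule_format, OF Sol_diff[OF u u] k that, of m j] by simp
      then show ?thesis by (simp add: norm_scaleC algebra_simps)
    qed
    have "uniformly_Cauchy_on {0..c} (\<lambda>m. u m k)"
    proof (rule uniformly_Cauchy_onI)
      fix e :: real assume e: "e > 0"
      define q where "q = C * (1 + cmod \<mu>) + 1"
      have q: "q > 0" using C(1) by (simp add: q_def add_nonneg_pos)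
      then obtain J where J: "\<And>m j. m \<ge> J \<Longrightarrow> j \<ge> J \<Longrightarrow> norm (v m - v j) < e / q"
        using cauchy e unfolding Cauchy_def dist_norm by (meson divide_pos_pos)
      have "dist (u m k t) (u j k t) < e" if "t \<in> {0..c}" "m \<ge> J" "j \<ge> J" for t m j
      proof -
        have "norm (u m k t - u j k t) \<le> q * norm (v m - v j)"
          using le[OF that(1), of m j] norm_ge_zero[of "v m - v j"]
          by (simp add: q_def distrib_right add_increasing2)
        also have "\<dots> < q * (e / q)" using J[OF that(2,3)] q by (rule mult_strict_left_mono)
        finally show ?thesis using q by (simp add: dist_norm)
      qed
      then show "\<exists>M. \<forall>x\<in>{0..c}. \<forall>m\<ge>M. \<forall>n\<ge>M. dist (u m k x) (u n k x) < e" by blast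
    qed
    then have "uniformly_convergent_on {0..c} (\<lambda>m. u m k)" by (rule Cauchy_uniformly_convergent)
    then show ?thesis by (simp add: uniformly_convergent_uniform_limit_iff U_def[abs_def])
  qed
  have lim: "(\<lambda>m. u m k t) \<longlonglongrightarrow> U k t" if "k < N" "t \<in> \<Delta>" for k t
    using tendsto_uniform_limitI[OF unif[OF that(2,1)]] nonneg[OF that(2)] by simp
  have cont: "continuous_on \<Delta> (U k)" if k: "k < N" for k
    unfolding continuous_on_eq_continuous_within
  proof
    fix t assume t: "t \<in> \<Delta>"
    obtain c where c: "c \<in> \<Delta>" "t \<in> {0..c}" "at t within \<Delta> = at t within {0..c}"
      using at_within_eq_initial_interval[OF t] .
    have "continuous_on {0..c} (U k)"
      by (rule uniform_limit_theorem[OF _ unif[OF c(1) k]])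
        (auto intro!: always_eventually continuous_on_subset[OF Sol_continuous[OF u k] down[OF c(1)]])
    then show "continuous (at t within \<Delta>) (U k)"
      using c by (simp add: continuous_on_eq_continuous_within)
  qed
  have int: "(Phi \<mu> k U has_integral U k t - U k s) {s..t}" if k: "k < N" and st: "s \<in> \<Delta>" "t \<in> \<Delta>" "s \<le> t" for k s t
  proof -
    have sub: "{s..t} \<subseteq> \<Delta>" "{s..t} \<subseteq> {0..t}" using interval_subset[OF st(1,2)] nonneg[OF st(1)] by auto
    have un: "uniform_limit {s..t} (\<lambda>m. u m j) (U j) sequentially" if "j < N" for j
      by (rule uniform_limit_on_subset[OF unif[OF st(2) that] sub(2)])
    have bd: "bounded (f ` {s..t})" if "continuous_on \<Delta> f" for f :: "real \<Rightarrow> 'c::metric_space"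
      by (intro compact_imp_bounded compact_continuous_image continuous_on_subset[OF that sub(1)] compact_Icc)
    have "uniform_limit {s..t} (\<lambda>m x. M k j x (u m j x)) (\<lambda>x. M k j x (U j x)) sequentially" if "j < N" for j
      by (intro bounded_bilinear.bounded_uniform_limit[OF bounded_bilinear_blinfun_apply] uniform_limit_const un bd that M_cont k cont)
    then have unF: "uniform_limit {s..t} (\<lambda>m x. F k (u m) x) (\<lambda>x. F k U x) sequentially"
      unfolding F_def by (intro uniform_limit_sum) auto
    have un0: "uniform_limit {s..t} (\<lambda>m x. if Suc k = N then \<mu> *\<^sub>C u m 0 x else 0) (\<lambda>x. if Suc k = N then \<mu> *\<^sub>C U 0 x else 0) sequentially"
      using bounded_linear.uniform_limit[OF bounded_linear_scaleC un[OF N]]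
      by (cases "Suc k = N") (simp_all add: uniform_limit_const)
    have "uniform_limit {s..t} (\<lambda>m. Phi \<mu> k (u m)) (Phi \<mu> k U) sequentially"
      unfolding Phi_def[abs_def] by (intro uniform_limit_minus unF un0)
    then obtain I J where IJ: "\<And>m. (Phi \<mu> k (u m) has_integral I m) {s..t}" "(Phi \<mu> k U has_integral J) {s..t}" "I \<longlonglongrightarrow> J"
      by (rule uniform_limit_integral) (auto intro!: continuous_on_Phi k sub(1) continuous_on_subset[OF Sol_continuous[OF u] sub(1)])
    have "I m = u m k t - u m k s" for m
      using IJ(1) Sol_eigenspace_integral[OF u k st] by (rule has_integral_unique)
    then have "I = (\<lambda>m. u m k t - u m k s)" by blast
    then have "I \<longlonglongrightarrow> U k t - U k s" using tendsto_diff[OF lim[OF k st(2)] lim[OF k st(1)]] by simp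
    then have "J = U k t - U k s" using IJ(3) LIMSEQ_unique by blast
    then show ?thesis using IJ(2) by simp
  qed
  have v_eq: "v = (\<lambda>m. L2_class \<Delta> (u m 0))" and uL: "\<And>m. in_L2 \<Delta> (u m 0)" using u by (auto simp: Sol_def)
  have "in_L2 \<Delta> (U 0)" and conv: "v \<longlonglongrightarrow> L2_class \<Delta> (U 0)"
    using L2_limit[of \<Delta> "\<lambda>m. u m 0" "U 0"] uL cauchy lim[OF N] by (auto simp flip: v_eq)
  then have "Sol U (L2_class \<Delta> (U 0)) (\<mu> *\<^sub>C L2_class \<Delta> (U 0))" by (intro SolI_eigenspace cont int)
  then show "\<exists>l\<in>eigenspace \<mu>. v \<longlonglongrightarrow> l" using conv by (auto simp: eigenspace_def)
qed

section \<open>Point evaluations as bounded operators\<close>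

text \<open>By \<open>Sol_unique\<close> the value is independent of the chosen solution for
  \<open>k < N\<close> and \<open>t\<close> in \<open>\<Delta>\<close>.\<close>

definition evaluation :: "nat \<Rightarrow> real \<Rightarrow> 'h L2 \<Rightarrow> 'h L2 \<Rightarrow> 'h" where
  "evaluation k t v w = (SOME u. Sol u v w) k t"

lemma evaluation_eq:
  assumes "Sol u v w" "k < N" "t \<in> \<Delta>"
  shows "evaluation k t v w = u k t"
  unfolding evaluation_def by (rule Sol_unique[OF someI[of "\<lambda>u. Sol u v w"]]) (fact assms)+

text \<open>A bounded linear map into pairs of solution classes with the graph norm. The second
  class is kept separate from the first, because differentiating in \<open>\<mu>\<close> produces
  pairs in which it is no longer a multiple of the first.\<close>

definition sol_family :: "real \<Rightarrow> ('k::complex_normed_vector \<Rightarrow> 'h L2) \<Rightarrow> ('k \<Rightarrow> 'h L2) \<Rightarrow> bool" where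
  "sol_family C V W \<longleftrightarrow> (\<forall>h. \<exists>u. Sol u (V h) (W h)) \<and>
     (\<forall>g h. V (g + h) = V g + V h \<and> W (g + h) = W g + W h) \<and>
     (\<forall>c h. V (c *\<^sub>C h) = c *\<^sub>C V h \<and> W (c *\<^sub>C h) = c *\<^sub>C W h) \<and>
     (\<forall>h. norm (V h) + norm (W h) \<le> C * norm h)"

lemma sol_family_obtain:
  assumes "sol_family C V W"
  obtains u where "Sol u (V h) (W h)"
  using assms unfolding sol_family_def by blast

definition evaluation_op :: "nat \<Rightarrow> real \<Rightarrow> ('k::complex_normed_vector \<Rightarrow> 'h L2) \<Rightarrow> ('k \<Rightarrow> 'h L2) \<Rightarrow> 'k \<Rightarrow>\<^sub>L 'h" where
  "evaluation_op k t V W = Blinfun (\<lambda>h. evaluation k t (V h) (W h))"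

lemma
  assumes fam: "sol_family C V W" and k: "k < N" and t: "t \<in> \<Delta>"
  shows evaluation_op_apply: "evaluation_op k t V W h = evaluation k t (V h) (W h)"
    and complex_linear_evaluation_op: "complex_linear (evaluation_op k t V W)"
proof -
  let ?e = "\<lambda>h. evaluation k t (V h) (W h)"
  from fam have "\<exists>u. \<forall>h. Sol (u h) (V h) (W h)" by (auto simp: sol_family_def choice_iff)
  then obtain u where u: "\<And>h. Sol (u h) (V h) (W h)" by blast
  have add: "?e (g + h) = ?e g + ?e h" for g h
  proof -
    have "Sol (\<lambda>k t. u g k t + u h k t) (V (g + h)) (W (g + h))"
      using Sol_add[OF u u, of g h] fam by (simp add: sol_family_def)
    from evaluation_eq[OF this k t] show ?thesis unfolding evaluation_eq[OF u k t] .
  qed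
  have scale: "?e (c *\<^sub>C h) = c *\<^sub>C ?e h" for c h
  proof -
    have "Sol (\<lambda>k t. c *\<^sub>C u h k t) (V (c *\<^sub>C h)) (W (c *\<^sub>C h))"
      using Sol_scaleC[OF u, of c h] fam by (simp add: sol_family_def)
    from evaluation_eq[OF this k t] show ?thesis unfolding evaluation_eq[OF u k t] .
  qed
  obtain D where D: "D \<ge> 0" "\<forall>u v w. Sol u v w \<longrightarrow> (\<forall>k<N. \<forall>s\<in>{0..t}. norm (u k s) \<le> D * (norm v + norm w))"
    using Sol_estimate[OF t] .
  have "bounded_linear ?e"
  proof (rule bounded_linear_intro[where K = "D * C"])
    fix h
    have "norm (?e h) \<le> D * (norm (V h) + norm (W h))"
      unfolding evaluation_eq[OF u k t] by (rule D(2)[rule_format, OF u k]) (use nonneg[OF t] in simp)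
    also have "\<dots> \<le> D * (C * norm h)" using fam D(1) by (intro mult_left_mono) (auto simp: sol_family_def)
    finally show "norm (?e h) \<le> norm h * (D * C)" by (simp add: mult_ac)
  qed (use add scale in \<open>auto simp: scaleR_scaleC\<close>)
  then have app: "evaluation_op k t V W h = ?e h" for h
    unfolding evaluation_op_def by (simp add: bounded_linear_Blinfun_apply)
  show "evaluation_op k t V W h = ?e h" by (rule app)
  show "complex_linear (evaluation_op k t V W)" by (simp add: complex_linear_def app scale)
qed

lemma norm_evaluation_op_le:
  assumes c: "c \<in> \<Delta>"
  obtains D where "D \<ge> 0" "\<forall>C (V::'k::complex_normed_vector \<Rightarrow> 'h L2) W. sol_family C V W \<longrightarrow> C \<ge> 0 \<longrightarrow>
    (\<forall>k<N. \<forall>t\<in>{0..c}. norm (evaluation_op k t V W) \<le> D * C)"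
proof -
  obtain D where D: "D \<ge> 0" "\<forall>u v w. Sol u v w \<longrightarrow> (\<forall>k<N. \<forall>t\<in>{0..c}. norm (u k t) \<le> D * (norm v + norm w))"
    using Sol_estimate[OF c] .
  show thesis
  proof (rule that[OF D(1)], intro allI impI ballI)
    fix C and V W :: "'k \<Rightarrow> 'h L2" and k t
    assume fam: "sol_family C V W" and C: "C \<ge> 0" and k: "k < N" and t: "t \<in> {0..c}"
    have t': "t \<in> \<Delta>" using down[OF c] t by blast
    show "norm (evaluation_op k t V W) \<le> D * C"
    proof (rule norm_blinfun_bound)
      fix h
      obtain u where u: "Sol u (V h) (W h)" by (rule sol_family_obtain[OF fam])
      have "norm (u k t) \<le> D * (norm (V h) + norm (W h))" by (rule D(2)[rule_format, OF u k t])
      also have "\<dots> \<le> D * (C * norm h)" using fam D(1) by (intro mult_left_mono) (auto simp: sol_family_def)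
      finally show "norm (evaluation_op k t V W h) \<le> D * C * norm h"
        by (simp add: evaluation_op_apply[OF fam k t'] evaluation_eq[OF u k t'] mult_ac)
    qed (use D C in simp)
  qed
qed

definition Psi :: "complex \<Rightarrow> nat \<Rightarrow> (nat \<Rightarrow> real \<Rightarrow> 'k::complex_normed_vector \<Rightarrow>\<^sub>L 'h) \<Rightarrow> real \<Rightarrow> 'k \<Rightarrow>\<^sub>L 'h" where
  "Psi \<mu> k G t = (\<Sum>j<N. M k j t o\<^sub>L G j t) - (if Suc k = N then \<mu> *\<^sub>C G 0 t else 0)"

lemma Psi_apply: "Psi \<mu> k G t h = Phi \<mu> k (\<lambda>j t. G j t h) t"
  by (simp add: Psi_def Phi_def F_def blinfun.diff_left blinfun.sum_left scaleC_blinfun.rep_eq)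

text \<open>The estimate is uniform in \<open>h\<close>, which upgrades differentiability for each \<open>h\<close> to differentiability
  in norm.\<close>

lemma evaluation_op_derivative:
  fixes V :: "'k::complex_normed_vector \<Rightarrow> 'h L2"
  assumes fam: "sol_family C V (\<lambda>h. \<mu> *\<^sub>C V h)" and C: "C \<ge> 0" and k: "k < N" and t: "t \<in> \<Delta>"
  defines "G \<equiv> \<lambda>k t. evaluation_op k t V (\<lambda>h. \<mu> *\<^sub>C V h)"
  shows "(G k has_vector_derivative Psi \<mu> k G t) (at t within \<Delta>)"
    and "continuous (at t within \<Delta>) (Psi \<mu> k G)"
proof -
  obtain c where c: "c \<in> \<Delta>" "t \<in> {0..c}" "at t within \<Delta> = at t within {0..c}"
    using at_within_eq_initial_interval[OF t] .
  have sub: "{0..c} \<subseteq> \<Delta>" by (rule down[OF c(1)])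
  obtain D where D: "D \<ge> 0" "\<forall>C (V::'k \<Rightarrow> 'h L2) W. sol_family C V W \<longrightarrow> C \<ge> 0 \<longrightarrow>
    (\<forall>k<N. \<forall>t\<in>{0..c}. norm (evaluation_op k t V W) \<le> D * C)"
    using norm_evaluation_op_le[OF c(1)] .
  have G: "norm (G j s) \<le> D * C" if "j < N" "s \<in> {0..c}" for j s
    unfolding G_def by (rule D(2)[rule_format, OF fam C that])
  obtain L where L: "L > 0" "\<And>k j t. k < N \<Longrightarrow> j < N \<Longrightarrow> t \<in> {0..c} \<Longrightarrow> norm (M k j t) \<le> L"
    using coefficient_bound[OF c(1)] by metis
  have der: "((\<lambda>t. G j t h) has_vector_derivative Psi \<mu> j G s h) (at s within {0..c})"
    if j: "j < N" and s: "s \<in> {0..c}" for j s h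
  proof -
    obtain u where u: "Sol u (V h) (\<mu> *\<^sub>C V h)" by (rule sol_family_obtain[OF fam])
    have eq: "G i r h = u i r" if "i < N" "r \<in> {0..c}" for i r
      using that sub unfolding G_def by (subst evaluation_op_apply[OF fam]) (auto intro!: evaluation_eq[OF u])
    have P: "Psi \<mu> j G s h = Phi \<mu> j u s"
      unfolding Psi_apply Phi_def F_def using eq s N by (auto intro!: arg_cong2[of _ _ _ _ "(-)"] sum.cong)
    have d: "(u j has_vector_derivative Phi \<mu> j u s) (at s within {0..c})"
      by (rule has_vector_derivative_within_subset[OF Sol_eigenspace_derivative[OF u j] sub]) (use s sub in blast)
    show ?thesis unfolding P by (rule has_vector_derivative_transform[OF s eq[OF j] d])
  qed
  have bound: "norm (Psi \<mu> j G s) \<le> real N * (L * (D * C)) + cmod \<mu> * (D * C)" if j: "j < N" and s: "s \<in> {0..c}" for j s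
    unfolding Psi_def
  proof (rule norm_triangle_le_diff[OF add_mono])
    have "norm (\<Sum>i<N. M j i s o\<^sub>L G i s) \<le> (\<Sum>i<N. L * (D * C))"
    proof (rule sum_norm_le)
      fix i assume "i \<in> {..<N}"
      then have "norm (M j i s) \<le> L" "norm (G i s) \<le> D * C" using L G j s by auto
      then have "norm (M j i s) * norm (G i s) \<le> L * (D * C)" using L(1) by (intro mult_mono) auto
      then show "norm (M j i s o\<^sub>L G i s) \<le> L * (D * C)" by (rule order_trans[OF norm_blinfun_compose])
    qed
    then show "norm (\<Sum>i<N. M j i s o\<^sub>L G i s) \<le> real N * (L * (D * C))" by simp
    show "norm (if Suc j = N then \<mu> *\<^sub>C G 0 s else 0) \<le> cmod \<mu> * (D * C)"
      using G[OF N s] D(1) C by (auto simp: norm_scaleC intro!: mult_left_mono)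
  qed
  \<comment> \<open>The continuity is obtained in two stages: the bound on \<open>Psi\<close> makes
    every \<open>G j\<close> continuous in norm, and this in turn makes \<open>Psi\<close>
    continuous, as the derivative in norm requires.\<close>
  have contG: "continuous_on {0..c} (G j)" if "j < N" for j
    by (rule blinfun_continuous_on[OF der[OF that] bound[OF that]])
  have contP: "continuous_on {0..c} (Psi \<mu> k G)"
    unfolding Psi_def[abs_def]
  proof (intro continuous_on_diff continuous_on_sum)
    show "continuous_on {0..c} (\<lambda>t. M k j t o\<^sub>L G j t)" if "j \<in> {..<N}" for j
      using that k by (intro bounded_bilinear.continuous_on[OF bounded_bilinear_blinfun_compose] contG
          continuous_on_subset[OF M_cont sub]) auto
    show "continuous_on {0..c} (\<lambda>t. if Suc k = N then \<mu> *\<^sub>C G 0 t else 0)"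
      by (cases "Suc k = N") (simp_all add: bounded_linear.continuous_on[OF bounded_linear_scaleC contG[OF N]])
  qed
  show "(G k has_vector_derivative Psi \<mu> k G t) (at t within \<Delta>)"
    unfolding c(3) by (rule blinfun_has_vector_derivative[OF der[OF k] contP c(2)])
  show "continuous (at t within \<Delta>) (Psi \<mu> k G)"
    unfolding c(3) using contP c(2) by (simp add: continuous_on_eq_continuous_within)
qed

lemma L2_on_add: "v \<in> L2_on \<Delta> \<Longrightarrow> w \<in> L2_on \<Delta> \<Longrightarrow> v + w \<in> L2_on \<Delta>"
  by (auto simp: L2_on_def L2_class_add[symmetric] intro: in_L2_add)

lemma L2_on_scaleC: "v \<in> L2_on \<Delta> \<Longrightarrow> c *\<^sub>C v \<in> L2_on \<Delta>"
  by (auto simp: L2_on_def L2_class_scaleC[symmetric] intro: in_L2_scaleC)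

end

section \<open>The resolvent and the transfer between eigenspaces\<close>

locale hessenberg_resolvent = hessenberg_system N \<Delta> M B
  for N \<Delta> and M :: "nat \<Rightarrow> nat \<Rightarrow> real \<Rightarrow> 'h::{complex_hilbert, second_countable_topology} \<Rightarrow>\<^sub>L 'h" and B +
  fixes A :: "('h L2 \<times> 'h L2) set"
  assumes A_add: "(u, f) \<in> A \<Longrightarrow> (v, g) \<in> A \<Longrightarrow> (u + v, f + g) \<in> A"
    and A_scaleC: "(u, f) \<in> A \<Longrightarrow> (c *\<^sub>C u, c *\<^sub>C f) \<in> A"
    and A_Sol: "(v, w) \<in> A \<Longrightarrow> \<exists>u. Sol u v w"
begin

abbreviation "\<rho> \<equiv> resolvent_set (L2_on \<Delta>) A"

definition R :: "complex \<Rightarrow> 'h L2 \<Rightarrow> 'h L2" where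
  "R \<mu> g = (THE v. (v, g + \<mu> *\<^sub>C v) \<in> A)"

lemma resolvent_ex1:
  assumes "\<mu> \<in> \<rho>" "g \<in> L2_on \<Delta>"
  shows "\<exists>!v. (v, g + \<mu> *\<^sub>C v) \<in> A"
proof -
  have eq: "(\<exists>f. (v, f) \<in> A \<and> f - \<mu> *\<^sub>C v = g) \<longleftrightarrow> (v, g + \<mu> *\<^sub>C v) \<in> A" for v
    by (auto simp: diff_eq_eq)
  have "\<exists>!v. \<exists>f. (v, f) \<in> A \<and> f - \<mu> *\<^sub>C v = g"
    using assms unfolding resolvent_set_def by blast
  then show ?thesis unfolding eq .
qed

lemma R_in: "\<mu> \<in> \<rho> \<Longrightarrow> g \<in> L2_on \<Delta> \<Longrightarrow> (R \<mu> g, g + \<mu> *\<^sub>C R \<mu> g) \<in> A"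
  unfolding R_def by (rule theI'[OF resolvent_ex1])

lemma R_eqI: "\<mu> \<in> \<rho> \<Longrightarrow> g \<in> L2_on \<Delta> \<Longrightarrow> (v, g + \<mu> *\<^sub>C v) \<in> A \<Longrightarrow> R \<mu> g = v"
  unfolding R_def by (rule the1_equality[OF resolvent_ex1])

lemma R_L2_on: "\<mu> \<in> \<rho> \<Longrightarrow> g \<in> L2_on \<Delta> \<Longrightarrow> R \<mu> g \<in> L2_on \<Delta>"
  using A_Sol[OF R_in] Sol_in_L2_on by blast

lemma R_add:
  assumes "\<mu> \<in> \<rho>" "g \<in> L2_on \<Delta>" "h \<in> L2_on \<Delta>"
  shows "R \<mu> (g + h) = R \<mu> g + R \<mu> h"
  using A_add[OF R_in[OF assms(1,2)] R_in[OF assms(1,3)]]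
  by (intro R_eqI assms L2_on_add) (simp add: scaleC_add_right algebra_simps)

lemma R_scaleC:
  assumes "\<mu> \<in> \<rho>" "g \<in> L2_on \<Delta>"
  shows "R \<mu> (c *\<^sub>C g) = c *\<^sub>C R \<mu> g"
  using A_scaleC[OF R_in[OF assms], of c]
  by (intro R_eqI assms L2_on_scaleC) (simp add: scaleC_add_right scaleC_scaleC mult.commute)

lemma R_bound:
  assumes "\<mu> \<in> \<rho>"
  obtains C where "C \<ge> 0" "\<forall>g\<in>L2_on \<Delta> :: 'h L2 set. norm (R \<mu> g) \<le> C * norm g"
proof -
  from assms obtain C where C: "\<And>u f. (u, f) \<in> A \<Longrightarrow> norm u \<le> C * norm (f - \<mu> *\<^sub>C u)"
    unfolding resolvent_set_def by blast
  show thesis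
  proof (rule that[of "max C 0"])
    show "\<forall>g\<in>L2_on \<Delta> :: 'h L2 set. norm (R \<mu> g) \<le> max C 0 * norm g"
    proof
      fix g :: "'h L2" assume "g \<in> L2_on \<Delta>"
      then have "norm (R \<mu> g) \<le> C * norm g" using C[OF R_in[OF assms]] by simp
      also have "\<dots> \<le> max C 0 * norm g" by (intro mult_right_mono) auto
      finally show "norm (R \<mu> g) \<le> max C 0 * norm g" .
    qed
  qed simp
qed

text \<open>The equation \<open>(A - \<mu>) v = g\<close> is the same as
  \<open>(A - \<nu>) v = g + (\<mu> - \<nu>) v\<close>; applying the resolvent at
  \<open>\<nu>\<close> gives the claim.\<close>

lemma resolvent_identity:
  assumes "\<mu> \<in> \<rho>" "\<nu> \<in> \<rho>" "g \<in> L2_on \<Delta>"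
  shows "R \<mu> g = R \<nu> g + (\<mu> - \<nu>) *\<^sub>C R \<nu> (R \<mu> g)"
proof -
  let ?v = "R \<mu> g"
  have v: "?v \<in> L2_on \<Delta>" by (rule R_L2_on[OF assms(1,3)])
  have "g + \<mu> *\<^sub>C ?v = g + (\<mu> - \<nu>) *\<^sub>C ?v + \<nu> *\<^sub>C ?v"
    using scaleC_add_left[of "\<mu> - \<nu>" \<nu> ?v] by simp
  then have "R \<nu> (g + (\<mu> - \<nu>) *\<^sub>C ?v) = ?v"
    using R_in[OF assms(1,3)] assms v by (intro R_eqI L2_on_add L2_on_scaleC) (auto simp: add.assoc)
  then show ?thesis
    using assms v by (simp add: R_add R_scaleC L2_on_scaleC)
qed

text \<open>This is \<open>(A - \<nu>) R(\<mu>)\<close>, written without applying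
  \<open>A\<close>.\<close>

definition U :: "complex \<Rightarrow> complex \<Rightarrow> 'h L2 \<Rightarrow> 'h L2" where
  "U \<nu> \<mu> v = v + (\<mu> - \<nu>) *\<^sub>C R \<mu> v"

lemma eigenspace_L2_on: "v \<in> eigenspace \<nu> \<Longrightarrow> v \<in> L2_on \<Delta>"
  unfolding eigenspace_def using Sol_in_L2_on by blast

lemma U_eigenspace:
  assumes \<mu>: "\<mu> \<in> \<rho>" and v: "v \<in> eigenspace \<nu>"
  shows "U \<nu> \<mu> v \<in> eigenspace \<mu>"
proof -
  obtain u where u: "Sol u v (\<nu> *\<^sub>C v)" using v by (auto simp: eigenspace_def)
  obtain u' where "Sol u' (R \<mu> v) (v + \<mu> *\<^sub>C R \<mu> v)"
    using A_Sol[OF R_in[OF \<mu> eigenspace_L2_on[OF v]]] by blast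
  from Sol_add[OF u Sol_scaleC[OF this, of "\<mu> - \<nu>"]]
  obtain u'' where "Sol u'' (U \<nu> \<mu> v) (\<nu> *\<^sub>C v + (\<mu> - \<nu>) *\<^sub>C (v + \<mu> *\<^sub>C R \<mu> v))"
    unfolding U_def by blast
  moreover have "\<nu> *\<^sub>C v + (\<mu> - \<nu>) *\<^sub>C (v + \<mu> *\<^sub>C R \<mu> v) = \<mu> *\<^sub>C U \<nu> \<mu> v"
    using scaleC_add_left[of \<nu> "\<mu> - \<nu>" v]
    by (simp add: U_def scaleC_add_right scaleC_scaleC mult.commute add.assoc[symmetric])
  ultimately show ?thesis by (auto simp: eigenspace_def)
qed

text \<open>In the product of \<open>(A - \<mu>) R(\<mu>')\<close> and
  \<open>(A - \<nu>) R(\<mu>)\<close> the factors belonging to \<open>\<mu>\<close> cancel. The rule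
  gives both the inverse of \<open>U\<close> and an exact formula for increments in the spectral
  parameter.\<close>

lemma U_compose:
  assumes \<mu>: "\<mu> \<in> \<rho>" "\<mu>' \<in> \<rho>" and v: "v \<in> L2_on \<Delta>"
  shows "U \<mu> \<mu>' (U \<nu> \<mu> v) = U \<nu> \<mu>' v"
proof -
  let ?a = "R \<mu> v" and ?b = "R \<mu>' v"
  have a: "?a \<in> L2_on \<Delta>" by (rule R_L2_on[OF \<mu>(1) v])
  have cancel: "y = b - a" if "a = b + x" "x + y = 0" for a b x y :: "'h L2"
    using that(1) minus_unique[OF that(2)] by simp
  have id: "(\<mu>' - \<mu>) *\<^sub>C R \<mu>' ?a = ?b - ?a"
    by (rule cancel[OF resolvent_identity[OF \<mu> v]]) (simp flip: scaleC_add_left)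
  have "(\<mu>' - \<mu>) *\<^sub>C R \<mu>' (U \<nu> \<mu> v) = (\<mu>' - \<mu>) *\<^sub>C ?b + (\<mu> - \<nu>) *\<^sub>C ((\<mu>' - \<mu>) *\<^sub>C R \<mu>' ?a)"
    unfolding U_def using \<mu> v a
    by (simp add: R_add R_scaleC L2_on_scaleC scaleC_add_right scaleC_scaleC mult.commute)
  also have "\<dots> = ((\<mu>' - \<mu>) *\<^sub>C ?b + (\<mu> - \<nu>) *\<^sub>C ?b) - (\<mu> - \<nu>) *\<^sub>C ?a"
    unfolding id by (simp add: scaleC_diff)
  also have "\<dots> = (\<mu>' - \<nu>) *\<^sub>C ?b - (\<mu> - \<nu>) *\<^sub>C ?a"
    by (simp flip: scaleC_add_left)
  finally have *: "(\<mu>' - \<mu>) *\<^sub>C R \<mu>' (U \<nu> \<mu> v) = (\<mu>' - \<nu>) *\<^sub>C ?b - (\<mu> - \<nu>) *\<^sub>C ?a" .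
  have "U \<mu> \<mu>' (U \<nu> \<mu> v) = U \<nu> \<mu> v + (\<mu>' - \<mu>) *\<^sub>C R \<mu>' (U \<nu> \<mu> v)" by (simp add: U_def)
  also have "\<dots> = U \<nu> \<mu>' v" unfolding * by (simp add: U_def)
  finally show ?thesis .
qed

lemma U_inverse:
  assumes \<mu>: "\<mu> \<in> \<rho>" "\<nu> \<in> \<rho>" and v: "v \<in> L2_on \<Delta>"
  shows "U \<mu> \<nu> (U \<nu> \<mu> v) = v"
  unfolding U_compose[OF \<mu> v] by (simp add: U_def)

end

section \<open>The family of fundamental solutions and its holomorphy\<close>

locale hessenberg_family = hessenberg_resolvent N \<Delta> M B A
  for N \<Delta> and M :: "nat \<Rightarrow> nat \<Rightarrow> real \<Rightarrow> 'h::{complex_hilbert, second_countable_topology} \<Rightarrow>\<^sub>L 'h" and B A +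
  fixes \<nu> :: complex and P :: "'h L2 \<Rightarrow>\<^sub>L 'h L2"
  assumes \<nu>: "\<nu> \<in> resolvent_set (L2_on \<Delta>) A"
    and P_linear: "complex_linear P" and P_in: "P x \<in> eigenspace \<nu>"
    and P_id: "x \<in> eigenspace \<nu> \<Longrightarrow> P x = x"
    and P_orth: "(\<forall>k\<in>eigenspace \<nu>. cinner x k = 0) \<Longrightarrow> P x = 0"
begin

text \<open>Projecting first makes the map total on \<open>L2\<close> and zero on the orthogonal
  complement of \<open>K'\<close>.\<close>

definition V :: "complex \<Rightarrow> 'h L2 \<Rightarrow> 'h L2" where
  "V \<mu> h = U \<nu> \<mu> (P h)"

text \<open>The intended fundamental solution is \<open>Z 0\<close>. The other components come from
  the system and are identified with the quasi-derivatives of \<open>Z 0\<close> only in the final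
  theorem.\<close>

definition Z :: "nat \<Rightarrow> complex \<Rightarrow> real \<Rightarrow> 'h L2 \<Rightarrow>\<^sub>L 'h" where
  "Z k \<mu> t = evaluation_op k t (V \<mu>) (\<lambda>h. \<mu> *\<^sub>C V \<mu> h)"

lemma P_scaleC: "P (c *\<^sub>C x) = c *\<^sub>C P x"
  using P_linear by (simp add: complex_linear_def)

lemma P_L2_on: "P x \<in> L2_on \<Delta>"
  by (rule eigenspace_L2_on[OF P_in])

lemma V_add: "\<mu> \<in> \<rho> \<Longrightarrow> V \<mu> (g + h) = V \<mu> g + V \<mu> h"
  by (simp add: V_def U_def blinfun.add_right R_add P_L2_on scaleC_add_right)

lemma V_scaleC: "\<mu> \<in> \<rho> \<Longrightarrow> V \<mu> (c *\<^sub>C h) = c *\<^sub>C V \<mu> h"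
  by (simp add: V_def U_def P_scaleC R_scaleC P_L2_on scaleC_add_right scaleC_scaleC mult.commute)

lemma V_eigenspace: "\<mu> \<in> \<rho> \<Longrightarrow> V \<mu> h \<in> eigenspace \<mu>"
  unfolding V_def by (rule U_eigenspace[OF _ P_in])

lemma V_L2_on: "\<mu> \<in> \<rho> \<Longrightarrow> V \<mu> h \<in> L2_on \<Delta>"
  by (rule eigenspace_L2_on[OF V_eigenspace])

lemma V_Sol:
  assumes "\<mu> \<in> \<rho>"
  obtains u where "Sol u (V \<mu> h) (\<mu> *\<^sub>C V \<mu> h)"
  using V_eigenspace[OF assms] unfolding eigenspace_def by blast

lemma V_bound:
  assumes \<mu>: "\<mu> \<in> \<rho>"
  obtains C where "C \<ge> 0" "\<forall>h. norm (V \<mu> h) \<le> C * norm h"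
proof -
  obtain C where C: "C \<ge> 0" "\<forall>g\<in>L2_on \<Delta>. norm (R \<mu> g) \<le> C * norm g" using R_bound[OF \<mu>] .
  have "norm (V \<mu> h) \<le> ((1 + cmod (\<mu> - \<nu>) * C) * norm P) * norm h" for h
  proof -
    have "norm (V \<mu> h) \<le> norm (P h) + cmod (\<mu> - \<nu>) * norm (R \<mu> (P h))"
      unfolding V_def U_def by (rule order_trans[OF norm_triangle_ineq]) (simp add: norm_scaleC)
    also have "\<dots> \<le> norm (P h) + cmod (\<mu> - \<nu>) * (C * norm (P h))"
      using C(2) P_L2_on by (intro add_left_mono mult_left_mono) auto
    also have "\<dots> = (1 + cmod (\<mu> - \<nu>) * C) * norm (P h)" by (simp add: algebra_simps)
    also have "\<dots> \<le> (1 + cmod (\<mu> - \<nu>) * C) * (norm P * norm h)"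
      using C(1) by (intro mult_left_mono norm_blinfun) auto
    finally show ?thesis by (simp add: mult.assoc)
  qed
  then show thesis using C(1) by (intro that[of "(1 + cmod (\<mu> - \<nu>) * C) * norm P"]) auto
qed

lemma V_sol_family:
  assumes \<mu>: "\<mu> \<in> \<rho>"
  obtains C where "C \<ge> 0" "sol_family C (V \<mu>) (\<lambda>h. \<mu> *\<^sub>C V \<mu> h)"
proof -
  obtain C where C: "C \<ge> 0" "\<forall>h. norm (V \<mu> h) \<le> C * norm h" using V_bound[OF \<mu>] .
  have "sol_family ((1 + cmod \<mu>) * C) (V \<mu>) (\<lambda>h. \<mu> *\<^sub>C V \<mu> h)"
    unfolding sol_family_def
  proof (intro conjI allI)
    show "\<exists>u. Sol u (V \<mu> h) (\<mu> *\<^sub>C V \<mu> h)" for h by (rule V_Sol[OF \<mu>, of h]) blast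
    show "norm (V \<mu> h) + norm (\<mu> *\<^sub>C V \<mu> h) \<le> (1 + cmod \<mu>) * C * norm h" for h
    proof -
      have "norm (V \<mu> h) + norm (\<mu> *\<^sub>C V \<mu> h) = (1 + cmod \<mu>) * norm (V \<mu> h)" by (simp add: norm_scaleC algebra_simps)
      also have "\<dots> \<le> (1 + cmod \<mu>) * (C * norm h)" using C(2) by (intro mult_left_mono) auto
      finally show ?thesis by (simp add: mult.assoc)
    qed
  qed (simp_all add: V_add[OF \<mu>] V_scaleC[OF \<mu>] scaleC_add_right scaleC_scaleC mult.commute)
  then show thesis using C(1) by (intro that[of "(1 + cmod \<mu>) * C"]) auto
qed

lemma Z_apply:
  assumes \<mu>: "\<mu> \<in> \<rho>" and k: "k < N" and t: "t \<in> \<Delta>" and u: "Sol u (V \<mu> h) (\<mu> *\<^sub>C V \<mu> h)"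
  shows "Z k \<mu> t h = u k t"
proof -
  obtain C where "C \<ge> 0" and fam: "sol_family C (V \<mu>) (\<lambda>h. \<mu> *\<^sub>C V \<mu> h)" using V_sol_family[OF \<mu>] .
  show ?thesis unfolding Z_def evaluation_op_apply[OF fam k t] by (rule evaluation_eq[OF u k t])
qed

lemma Z_ops_on:
  assumes \<mu>: "\<mu> \<in> \<rho>" and k: "k < N" and t: "t \<in> \<Delta>"
  shows "Z k \<mu> t \<in> ops_on (eigenspace \<nu>)"
proof -
  obtain C where C: "C \<ge> 0" "sol_family C (V \<mu>) (\<lambda>h. \<mu> *\<^sub>C V \<mu> h)" using V_sol_family[OF \<mu>] .
  have "Z k \<mu> t x = 0" if "\<forall>k\<in>eigenspace \<nu>. cinner x k = 0" for x
  proof -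
    have "V \<mu> x = 0" using P_orth[OF that] R_scaleC[OF \<mu> P_L2_on, of 0] by (simp add: V_def U_def)
    then have "Sol (\<lambda>k t. 0) (V \<mu> x) (\<mu> *\<^sub>C V \<mu> x)" using Sol_zero by simp
    then show ?thesis by (rule Z_apply[OF \<mu> k t])
  qed
  then show ?thesis
    unfolding ops_on_def using complex_linear_evaluation_op[OF C(2) k t] by (simp add: Z_def)
qed

lemma Z_derivative:
  assumes \<mu>: "\<mu> \<in> \<rho>" and k: "k < N" and t: "t \<in> \<Delta>"
  shows "(Z k \<mu> has_vector_derivative Psi \<mu> k (\<lambda>k. Z k \<mu>) t) (at t within \<Delta>)"
    and "continuous (at t within \<Delta>) (Psi \<mu> k (\<lambda>k. Z k \<mu>))"
proof -
  obtain C where C: "C \<ge> 0" "sol_family C (V \<mu>) (\<lambda>h. \<mu> *\<^sub>C V \<mu> h)" using V_sol_family[OF \<mu>] .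
  show "(Z k \<mu> has_vector_derivative Psi \<mu> k (\<lambda>k. Z k \<mu>) t) (at t within \<Delta>)"
    "continuous (at t within \<Delta>) (Psi \<mu> k (\<lambda>k. Z k \<mu>))"
    using evaluation_op_derivative[OF C(2,1) k t] unfolding Z_def .
qed

lemma Z_in_L2:
  assumes \<mu>: "\<mu> \<in> \<rho>"
  shows "in_L2 \<Delta> (\<lambda>t. Z 0 \<mu> t h)" and "L2_class \<Delta> (\<lambda>t. Z 0 \<mu> t h) = V \<mu> h"
proof -
  obtain u where u: "Sol u (V \<mu> h) (\<mu> *\<^sub>C V \<mu> h)" using V_Sol[OF \<mu>] .
  have eq: "Z 0 \<mu> t h = u 0 t" if "t \<in> \<Delta>" for t by (rule Z_apply[OF \<mu> N that u])
  show "in_L2 \<Delta> (\<lambda>t. Z 0 \<mu> t h)" "L2_class \<Delta> (\<lambda>t. Z 0 \<mu> t h) = V \<mu> h"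
    using u L2_class_cong_on[OF eq] by (simp_all add: Sol_def)
qed

text \<open>The representing vector is obtained by transporting \<open>v\<close> back with
  \<open>U \<mu> \<nu>\<close>. Two such vectors give the same class, and the same inverse then
  identifies them.\<close>

lemma Z_represents:
  assumes \<mu>: "\<mu> \<in> \<rho>" and u: "Sol u v (\<mu> *\<^sub>C v)"
  shows "\<exists>!h. h \<in> eigenspace \<nu> \<and> (\<forall>t\<in>\<Delta>. u 0 t = Z 0 \<mu> t h)"
proof -
  have v: "v \<in> eigenspace \<mu>" using u by (auto simp: eigenspace_def)
  define h where "h = U \<mu> \<nu> v"
  have h: "h \<in> eigenspace \<nu>" unfolding h_def by (rule U_eigenspace[OF \<nu> v])
  have "V \<mu> h = v"
    unfolding V_def P_id[OF h] unfolding h_def by (rule U_inverse[OF \<nu> \<mu> eigenspace_L2_on[OF v]])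
  then have eq: "u 0 t = Z 0 \<mu> t h" if "t \<in> \<Delta>" for t
    using Z_apply[OF \<mu> N that, of u h] u by simp
  show ?thesis
  proof (rule ex1I[of _ h])
    show "h \<in> eigenspace \<nu> \<and> (\<forall>t\<in>\<Delta>. u 0 t = Z 0 \<mu> t h)" using h eq by blast
  next
    fix g assume g: "g \<in> eigenspace \<nu> \<and> (\<forall>t\<in>\<Delta>. u 0 t = Z 0 \<mu> t g)"
    have "V \<mu> g = V \<mu> h"
      unfolding Z_in_L2(2)[OF \<mu>, symmetric] by (rule L2_class_cong_on) (use g eq in auto)
    then have "U \<mu> \<nu> (U \<nu> \<mu> g) = U \<mu> \<nu> (U \<nu> \<mu> h)" using g h by (simp add: V_def P_id)
    then show "g = h" using g h U_inverse[OF \<mu> \<nu> eigenspace_L2_on, of _ \<nu>] by simp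
  qed
qed

text \<open>The difference quotient in the holomorphy proof contains the resolvent at the moving
  point, so one bound valid for all nearby points is needed.\<close>

lemma R_locally_bounded:
  assumes \<mu>: "\<mu> \<in> \<rho>"
  obtains C d where "C \<ge> 0" "d > 0" "\<forall>\<mu>'\<in>\<rho>. cmod (\<mu>' - \<mu>) < d \<longrightarrow> (\<forall>g\<in>L2_on \<Delta> :: 'h L2 set. norm (R \<mu>' g) \<le> C * norm g)"
proof -
  obtain C where C: "C \<ge> 0" "\<forall>g\<in>L2_on \<Delta>. norm (R \<mu> g) \<le> C * norm g" using R_bound[OF \<mu>] .
  \<comment> \<open>With \<open>d * C\<close> at most 1/2, the term of the resolvent identity
    containing the unknown resolvent can be absorbed; the added 1 keeps \<open>d\<close> defined and
    positive when \<open>C\<close> is 0.\<close>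
  define d where "d = 1 / (2 * (C + 1))"
  have d: "d > 0" "d * C \<le> 1 / 2" using C(1) by (simp_all add: d_def field_simps)
  have "norm (R \<mu>' g) \<le> 2 * C * norm g" if \<mu>': "\<mu>' \<in> \<rho>" "cmod (\<mu>' - \<mu>) < d" and g: "g \<in> L2_on \<Delta>" for \<mu>' g
  proof -
    have "R \<mu>' g = R \<mu> g + (\<mu>' - \<mu>) *\<^sub>C R \<mu> (R \<mu>' g)" by (rule resolvent_identity[OF \<mu>'(1) \<mu> g])
    then have "norm (R \<mu>' g) \<le> norm (R \<mu> g) + cmod (\<mu>' - \<mu>) * norm (R \<mu> (R \<mu>' g))"
      by (metis norm_triangle_ineq norm_scaleC)
    also have "\<dots> \<le> C * norm g + d * (C * norm (R \<mu>' g))"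
      using C g R_L2_on[OF \<mu>'(1) g] \<mu>'(2) d by (intro add_mono mult_mono) auto
    also have "\<dots> \<le> C * norm g + 1 / 2 * norm (R \<mu>' g)"
      using mult_right_mono[OF d(2), of "norm (R \<mu>' g)"] by (simp add: mult.assoc)
    finally show ?thesis by simp
  qed
  then show thesis using C(1) d(1) by (intro that[of "2 * C" d]) auto
qed

text \<open>The difference quotient of \<open>V\<close> in the spectral parameter is thereby exactly
  one resolvent applied to \<open>V \<mu> h\<close>.\<close>

lemma V_difference:
  assumes "\<mu>' \<in> \<rho>" "\<mu> \<in> \<rho>"
  shows "V \<mu>' h = V \<mu> h + (\<mu>' - \<mu>) *\<^sub>C R \<mu>' (V \<mu> h)"
  using U_compose[OF assms(2,1) P_L2_on, of \<nu> h] by (simp add: V_def U_def)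

text \<open>Evaluation of component \<open>k\<close> at \<open>t\<close> is bounded for the graph
  norm. It therefore suffices that the pair of classes \<open>V \<mu> h\<close> and
  \<open>\<mu> *\<^sub>C V \<mu> h\<close> be differentiable in \<open>\<mu>\<close>, with an error
  uniform in \<open>h\<close>.\<close>

lemma Z_holomorphic:
  assumes k: "k < N" and t: "t \<in> \<Delta>"
  shows "vholomorphic_on (\<lambda>\<mu>. Z k \<mu> t) \<rho>"
  unfolding vholomorphic_on_def
proof (intro ballI exI)
  fix \<mu> assume \<mu>: "\<mu> \<in> \<rho>"
  \<comment> \<open>\<open>X\<close> is the derivative of \<open>V\<close> with respect to
    \<open>\<mu>\<close>, and \<open>Y\<close>, by the product rule, that of
    \<open>\<mu> *\<^sub>C V \<mu>\<close>. The pair lies in \<open>A\<close> by the definition of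
    the resolvent.\<close>
  define X where "X h = R \<mu> (V \<mu> h)" for h
  define Y where "Y h = V \<mu> h + \<mu> *\<^sub>C X h" for h
  let ?D = "evaluation_op k t X Y"
  obtain CV where CV: "CV \<ge> 0" "\<forall>h. norm (V \<mu> h) \<le> CV * norm h" using V_bound[OF \<mu>] .
  obtain C1 where C1: "C1 \<ge> 0" "\<forall>g\<in>L2_on \<Delta>. norm (R \<mu> g) \<le> C1 * norm g" using R_bound[OF \<mu>] .
  obtain C2 d where C2: "C2 \<ge> 0" "d > 0"
    "\<forall>\<mu>'\<in>\<rho>. cmod (\<mu>' - \<mu>) < d \<longrightarrow> (\<forall>g\<in>L2_on \<Delta> :: 'h L2 set. norm (R \<mu>' g) \<le> C2 * norm g)"
    using R_locally_bounded[OF \<mu>] .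
  obtain E where E: "E \<ge> 0" "\<forall>u v w. Sol u v w \<longrightarrow> (\<forall>k<N. \<forall>s\<in>{0..t}. norm (u k s) \<le> E * (norm v + norm w))"
    using Sol_estimate[OF t] .
  have XSol: "\<exists>u. Sol u (X h) (Y h)" for h
    unfolding X_def Y_def using A_Sol[OF R_in[OF \<mu> V_L2_on[OF \<mu>, of h]]] .
  have Xn: "norm (X h) \<le> C1 * (CV * norm h)" for h
    unfolding X_def by (rule order_trans[OF C1(2)[rule_format, OF V_L2_on[OF \<mu>]]]) (intro mult_left_mono CV(2)[rule_format] C1(1))
  have fam: "sol_family (C1 * CV + CV + cmod \<mu> * (C1 * CV)) X Y"
    unfolding sol_family_def
  proof (intro conjI allI XSol)
    fix h
    have "norm (Y h) \<le> norm (V \<mu> h) + cmod \<mu> * norm (X h)"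
      unfolding Y_def by (rule order_trans[OF norm_triangle_ineq]) (simp add: norm_scaleC)
    also have "\<dots> \<le> CV * norm h + cmod \<mu> * (C1 * (CV * norm h))"
      using Xn CV by (intro add_mono mult_left_mono) auto
    finally show "norm (X h) + norm (Y h) \<le> (C1 * CV + CV + cmod \<mu> * (C1 * CV)) * norm h"
      using Xn[of h] by (simp add: algebra_simps)
  qed (simp_all add: X_def Y_def V_add[OF \<mu>] V_scaleC[OF \<mu>] R_add[OF \<mu>] R_scaleC[OF \<mu>] V_L2_on[OF \<mu>]
      scaleC_add_right scaleC_scaleC mult.commute algebra_simps)
  \<comment> \<open>\<open>E\<close> is the evaluation bound. The first summand bounds the error in
    \<open>X\<close>, the others the error in \<open>Y\<close>, each divided by
    \<open>cmod (\<mu>' - \<mu>) * norm h\<close>; \<open>cmod \<mu> + d\<close> bounds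
    \<open>cmod \<mu>'\<close>.\<close>
  define Q where "Q = E * (C1 * C2 * CV + ((cmod \<mu> + d) * (C1 * C2 * CV) + C1 * CV))"
  have est: "norm (inverse (\<mu>' - \<mu>) *\<^sub>C (Z k \<mu>' t - Z k \<mu> t) - ?D) \<le> Q * cmod (\<mu>' - \<mu>)"
    if \<mu>': "\<mu>' \<in> \<rho>" "cmod (\<mu>' - \<mu>) < d" "\<mu>' \<noteq> \<mu>" for \<mu>'
  proof (rule norm_blinfun_bound)
    show "0 \<le> Q * cmod (\<mu>' - \<mu>)" using E C1 C2 CV by (simp add: Q_def)
    fix h
    let ?c = "\<mu>' - \<mu>" and ?x = "V \<mu> h" and ?R = "R \<mu>' (V \<mu> h)"
    have x: "?x \<in> L2_on \<Delta>" by (rule V_L2_on[OF \<mu>])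
    have R': "?R \<in> L2_on \<Delta>" by (rule R_L2_on[OF \<mu>'(1) x])
    obtain u' where u': "Sol u' (V \<mu>' h) (\<mu>' *\<^sub>C V \<mu>' h)" using V_Sol[OF \<mu>'(1)] .
    obtain u where u: "Sol u ?x (\<mu> *\<^sub>C ?x)" using V_Sol[OF \<mu>] .
    obtain uD where uD: "Sol uD (X h) (Y h)" using XSol by blast
    have res: "?R - X h = ?c *\<^sub>C R \<mu> ?R"
      using resolvent_identity[OF \<mu>'(1) \<mu> x] unfolding X_def by (metis add_diff_cancel_left')
    have v: "inverse ?c *\<^sub>C (V \<mu>' h - ?x) - X h = ?R - X h"
      using \<mu>'(3) by (simp add: V_difference[OF \<mu>'(1) \<mu>] scaleC_scaleC)
    have w: "inverse ?c *\<^sub>C (\<mu>' *\<^sub>C V \<mu>' h - \<mu> *\<^sub>C ?x) - Y h = \<mu>' *\<^sub>C (?R - X h) + ?c *\<^sub>C X h"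
    proof -
      have "\<mu>' *\<^sub>C V \<mu>' h - \<mu> *\<^sub>C ?x = ?c *\<^sub>C (?x + \<mu>' *\<^sub>C ?R)"
        using scaleC_add_left[of ?c \<mu> ?x]
        by (simp add: V_difference[OF \<mu>'(1) \<mu>] scaleC_add_right scaleC_scaleC mult.commute)
      then have "inverse ?c *\<^sub>C (\<mu>' *\<^sub>C V \<mu>' h - \<mu> *\<^sub>C ?x) = ?x + \<mu>' *\<^sub>C ?R"
        using \<mu>'(3) by (simp add: scaleC_scaleC)
      then show ?thesis
        using scaleC_add_left[of ?c \<mu> "X h"] by (simp add: Y_def scaleC_diff)
    qed
    have "Sol (\<lambda>k t. inverse ?c *\<^sub>C (u' k t - u k t) - uD k t) (?R - X h) (\<mu>' *\<^sub>C (?R - X h) + ?c *\<^sub>C X h)"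
      using Sol_diff[OF Sol_scaleC[OF Sol_diff[OF u' u]] uD, of "inverse ?c"] unfolding v w .
    then have "norm (inverse ?c *\<^sub>C (u' k t - u k t) - uD k t) \<le> E * (norm (?R - X h) + norm (\<mu>' *\<^sub>C (?R - X h) + ?c *\<^sub>C X h))"
      by (rule E(2)[rule_format, OF _ k]) (use nonneg[OF t] in simp)
    also have "\<dots> \<le> E * (cmod ?c * (C1 * C2 * CV * norm h) + ((cmod \<mu> + d) * (cmod ?c * (C1 * C2 * CV * norm h)) + cmod ?c * (C1 * CV * norm h)))"
    proof (intro mult_left_mono add_mono E(1))
      have "norm (R \<mu> ?R) \<le> C1 * norm ?R" using C1(2) R' by blast
      also have "\<dots> \<le> C1 * (C2 * norm ?x)" using C2(3) \<mu>' x C1(1) by (intro mult_left_mono) auto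
      also have "\<dots> \<le> C1 * (C2 * (CV * norm h))" using CV(2) C1(1) C2(1) by (intro mult_left_mono) auto
      finally have RR: "norm (R \<mu> ?R) \<le> C1 * C2 * CV * norm h" by (simp add: mult.assoc)
      then show *: "norm (?R - X h) \<le> cmod ?c * (C1 * C2 * CV * norm h)"
        unfolding res norm_scaleC by (rule mult_left_mono) simp
      have "cmod \<mu>' \<le> cmod \<mu> + d" using \<mu>'(2) norm_triangle_sub[of \<mu>' \<mu>] by simp
      then have "cmod \<mu>' * norm (?R - X h) \<le> (cmod \<mu> + d) * (cmod ?c * (C1 * C2 * CV * norm h))"
        using * C2(2) by (intro mult_mono) auto
      moreover have "cmod ?c * norm (X h) \<le> cmod ?c * (C1 * CV * norm h)"
        using Xn[of h] by (intro mult_left_mono) (auto simp: mult.assoc)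
      ultimately show "norm (\<mu>' *\<^sub>C (?R - X h) + ?c *\<^sub>C X h)
          \<le> (cmod \<mu> + d) * (cmod ?c * (C1 * C2 * CV * norm h)) + cmod ?c * (C1 * CV * norm h)"
        by (intro order_trans[OF norm_triangle_ineq] add_mono) (simp_all add: norm_scaleC)
    qed
    also have "\<dots> = Q * cmod ?c * norm h" by (simp add: Q_def algebra_simps)
    finally show "norm ((inverse ?c *\<^sub>C (Z k \<mu>' t - Z k \<mu> t) - ?D) h) \<le> Q * cmod ?c * norm h"
      by (simp add: blinfun.diff_left scaleC_blinfun.rep_eq Z_apply[OF \<mu>'(1) k t u'] Z_apply[OF \<mu> k t u]
          evaluation_op_apply[OF fam k t] evaluation_eq[OF uD k t])
  qed
  have "((\<lambda>\<mu>'. Q * cmod (\<mu>' - \<mu>)) \<longlongrightarrow> Q * cmod (\<mu> - \<mu>)) (at \<mu> within \<rho>)" by (intro tendsto_intros)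
  then have lim: "((\<lambda>\<mu>'. Q * cmod (\<mu>' - \<mu>)) \<longlongrightarrow> 0) (at \<mu> within \<rho>)" by simp
  have "\<forall>\<^sub>F \<mu>' in at \<mu> within \<rho>. norm (inverse (\<mu>' - \<mu>) *\<^sub>C (Z k \<mu>' t - Z k \<mu> t) - ?D) \<le> Q * cmod (\<mu>' - \<mu>)"
    unfolding eventually_at using est C2(2) by (auto simp: dist_norm)
  then have "((\<lambda>\<mu>'. inverse (\<mu>' - \<mu>) *\<^sub>C (Z k \<mu>' t - Z k \<mu> t) - ?D) \<longlongrightarrow> 0) (at \<mu> within \<rho>)"
    by (rule Lim_null_comparison[OF _ lim])
  then show "((\<lambda>\<mu>'. inverse (\<mu>' - \<mu>) *\<^sub>C (Z k \<mu>' t - Z k \<mu> t)) \<longlongrightarrow> ?D) (at \<mu> within \<rho>)"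
    by (simp add: LIM_zero_iff)
qed

end

section \<open>The system of quasi-derivatives\<close>

text \<open>The algebra shared by applying an operator to a vector and composing it with an
  operator, so that one computation serves the quasi-derivatives of vector functions and of operator
  functions.\<close>

locale coefficient_action =
  fixes act :: "('h::complex_hilbert \<Rightarrow>\<^sub>L 'h) \<Rightarrow> 'v::complex_normed_vector \<Rightarrow> 'v"
  assumes act_add_left: "act (S + T) v = act S v + act T v"
    and act_scaleC_left: "act (c *\<^sub>C T) v = c *\<^sub>C act T v"
    and act_add_right: "act T (v + w) = act T v + act T w"
    and act_compose: "act (S o\<^sub>L T) v = act S (act T v)"
    and act_id: "act id_blinfun v = v"
begin

lemma act_zero_left: "act 0 v = 0"
  using act_scaleC_left[of 0 0 v] by simp

lemma act_minus_left: "act (- T) v = - act T v"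
  using act_add_left[of T "- T" v] minus_unique[of "act T v" "act (- T) v"] by (simp add: act_zero_left)

lemma act_if: "act (if b then T else 0) v = (if b then act T v else 0)"
  by (simp add: act_zero_left)

end

interpretation apply_action: coefficient_action blinfun_apply
  by standard (simp_all add: blinfun.add_left blinfun.add_right scaleC_blinfun.rep_eq)

lemma blinfun_compose_scaleC_left: "(c *\<^sub>C S) o\<^sub>L T = c *\<^sub>C (S o\<^sub>L T)"
  by (rule blinfun_eqI) (simp add: scaleC_blinfun.rep_eq)

interpretation compose_action: coefficient_action "blinfun_compose :: ('h::complex_hilbert \<Rightarrow>\<^sub>L 'h) \<Rightarrow> ('k::complex_normed_vector \<Rightarrow>\<^sub>L 'h) \<Rightarrow> _"
proof
  fix S T :: "'h \<Rightarrow>\<^sub>L 'h" and v w :: "'k \<Rightarrow>\<^sub>L 'h" and c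
  show "(S + T) o\<^sub>L v = (S o\<^sub>L v) + (T o\<^sub>L v)" by (rule bounded_bilinear.add_left[OF bounded_bilinear_blinfun_compose])
  show "T o\<^sub>L (v + w) = (T o\<^sub>L v) + (T o\<^sub>L w)" by (rule bounded_bilinear.add_right[OF bounded_bilinear_blinfun_compose])
  show "(c *\<^sub>C T) o\<^sub>L v = c *\<^sub>C (T o\<^sub>L v)" by (rule blinfun_compose_scaleC_left)
  show "(S o\<^sub>L T) o\<^sub>L v = S o\<^sub>L (T o\<^sub>L v)" by (rule blinfun_eqI) simp
  show "id_blinfun o\<^sub>L v = v" by (rule blinfun_eqI) simp
qed

lemma Ck_on_imp_continuous_on: "Ck_on m \<Delta> f \<Longrightarrow> continuous_on \<Delta> f"
proof (cases "m = 0")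
  case False
  moreover assume "Ck_on m \<Delta> f"
  ultimately have "differentiable_in \<Delta> ((D \<Delta> ^^ 0) f)" unfolding Ck_on_def by blast
  then show ?thesis
    by (auto simp: differentiable_in_def continuous_on_eq_continuous_within intro: differentiable_imp_continuous_within)
qed (simp add: Ck_on_def)

text \<open>The matrix of the first-order system for the quasi-derivatives: entry \<open>(k, j)\<close> is the
  coefficient of \<open>y\<^bsup>[j]\<^esup>\<close> in \<open>D y\<^bsup>[k]\<^esup>\<close>, after substituting
  \<open>D\<^sup>n y = p\<^sub>0\<^sup>-\<^sup>1 (y\<^bsup>[n]\<^esup> + i/2 q\<^sub>0 y\<^bsup>[n-1]\<^esup>)\<close>. For \<open>k \<ge> n\<close> the paper's index is \<open>k + 1 - n\<close>.\<close>

definition system_matrix :: "nat \<Rightarrow> (nat \<Rightarrow> real \<Rightarrow> 'h::complex_hilbert \<Rightarrow>\<^sub>L 'h) \<Rightarrow> (nat \<Rightarrow> real \<Rightarrow> 'h \<Rightarrow>\<^sub>L 'h) \<Rightarrow>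
    nat \<Rightarrow> nat \<Rightarrow> real \<Rightarrow> 'h \<Rightarrow>\<^sub>L 'h" where
  "system_matrix n p q k j t =
     (if Suc k < n then if j = Suc k then id_blinfun else 0 else 0)
   + (if Suc k = n then if j = n then bounded_inverse (p 0 t) else 0 else 0)
   + (if Suc k = n then if j = n - 1 then bounded_inverse (p 0 t) o\<^sub>L ((\<i> / 2) *\<^sub>C q 0 t) else 0 else 0)
   + (if n \<le> k then if j = Suc k then - id_blinfun else 0 else 0)
   + (if n \<le> k then if j = 2 * n - 1 - k then p (Suc k - n) t else 0 else 0)
   + (if n < k then if j = 2 * n - k then (\<i> / 2) *\<^sub>C cadjoint (q (k - n) t) else 0 else 0)
   + (if n = k then if j = n then (\<i> / 2) *\<^sub>C (cadjoint (q 0 t) o\<^sub>L bounded_inverse (p 0 t)) else 0 else 0)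
   + (if n = k then if j = n - 1 then (\<i> / 2) *\<^sub>C (cadjoint (q 0 t) o\<^sub>L (bounded_inverse (p 0 t) o\<^sub>L ((\<i> / 2) *\<^sub>C q 0 t))) else 0 else 0)
   + (if n \<le> k \<and> Suc k < 2 * n then if j = 2 * n - 2 - k then - ((\<i> / 2) *\<^sub>C q (Suc k - n) t) else 0 else 0)"

definition superdiagonal_inverse :: "nat \<Rightarrow> (nat \<Rightarrow> real \<Rightarrow> 'h::real_normed_vector \<Rightarrow>\<^sub>L 'h) \<Rightarrow> nat \<Rightarrow> real \<Rightarrow> 'h \<Rightarrow>\<^sub>L 'h" where
  "superdiagonal_inverse n p k t = (if Suc k < n then id_blinfun else if Suc k = n then p 0 t else - id_blinfun)"

context coefficient_action
begin

lemma sum_if_outer: "(\<Sum>j\<in>J. if b then f j else 0) = (if b then \<Sum>j\<in>J. f j else (0::'v))"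
  by simp

text \<open>Several coefficients can fall into one column: in row \<open>n\<close> both
  \<open>p 1\<close> and the product of \<open>q 0\<close>, its adjoint and the inverse of
  \<open>p 0\<close> stand in column \<open>n - 1\<close>. This is why the matrix is a sum of
  conditionals, which is summed over \<open>j\<close> one conditional at a time.\<close>

lemma system_matrix_row:
  assumes n: "n \<ge> 1" and k: "k < 2 * n"
  shows "(\<Sum>j<2 * n. act (system_matrix n p q k j t) (u j)) =
     (if Suc k < n then u (Suc k)
      else if Suc k = n then act (bounded_inverse (p 0 t)) (u n + (\<i> / 2) *\<^sub>C act (q 0 t) (u (n - 1)))
      else (if Suc k < 2 * n then - u (Suc k) else 0) + act (p (Suc k - n) t) (u (2 * n - 1 - k))
        + (\<i> / 2) *\<^sub>C (act (cadjoint (q (k - n) t))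
            (if k = n then act (bounded_inverse (p 0 t)) (u n + (\<i> / 2) *\<^sub>C act (q 0 t) (u (n - 1))) else u (2 * n - k))
          - (if Suc k < 2 * n then act (q (Suc k - n) t) (u (2 * n - 2 - k)) else 0)))"
proof -
  consider "Suc k < n" | "Suc k = n" | "k = n" | "n < k" by linarith
  then show ?thesis
  proof cases
    case 1
    then have "system_matrix n p q k j t = (if j = Suc k then id_blinfun else 0)" for j
      by (simp add: system_matrix_def)
    then show ?thesis using 1 by (simp add: act_if act_id)
  next
    case 2
    then have "system_matrix n p q k j t = (if j = n then bounded_inverse (p 0 t) else 0)
        + (if j = n - 1 then bounded_inverse (p 0 t) o\<^sub>L ((\<i> / 2) *\<^sub>C q 0 t) else 0)" for j
      by (simp add: system_matrix_def)
    moreover have "n - 1 < 2 * n" using n by simp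
    ultimately show ?thesis using 2 n
      by (simp add: act_if act_add_left sum.distrib act_compose act_scaleC_left act_add_right)
  next
    case 3
    \<comment> \<open>For \<open>n = 1\<close> the column \<open>n - 2\<close> is truncated to 0,
      but the guard \<open>Suc k < 2 * n\<close> then fails and the term is absent.\<close>
    then have "system_matrix n p q k j t = (if j = Suc k then - id_blinfun else 0)
        + (if j = n - 1 then p 1 t else 0)
        + (if j = n then (\<i> / 2) *\<^sub>C (cadjoint (q 0 t) o\<^sub>L bounded_inverse (p 0 t)) else 0)
        + (if j = n - 1 then (\<i> / 2) *\<^sub>C (cadjoint (q 0 t) o\<^sub>L (bounded_inverse (p 0 t) o\<^sub>L ((\<i> / 2) *\<^sub>C q 0 t))) else 0)
        + (if Suc k < 2 * n then if j = n - 2 then - ((\<i> / 2) *\<^sub>C q 1 t) else 0 else 0)" for j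
      using n by (auto simp: system_matrix_def mult_2)
    moreover have "n - 1 < n + n" "n - 2 < n + n" using n by simp_all
    ultimately show ?thesis using 3 n
      by (simp add: act_if act_add_left sum.distrib act_compose act_scaleC_left act_add_right act_minus_left act_id
          sum_if_outer scaleC_add_right scaleC_diff mult_2 cong: if_cong)
  next
    case 4
    then have "system_matrix n p q k j t = (if j = Suc k then - id_blinfun else 0)
        + (if j = 2 * n - 1 - k then p (Suc k - n) t else 0)
        + (if j = 2 * n - k then (\<i> / 2) *\<^sub>C cadjoint (q (k - n) t) else 0)
        + (if Suc k < 2 * n then if j = 2 * n - 2 - k then - ((\<i> / 2) *\<^sub>C q (Suc k - n) t) else 0 else 0)" for j
      by (simp add: system_matrix_def)
    then show ?thesis using 4 n k
      by (simp add: act_if act_add_left sum.distrib act_compose act_scaleC_left act_add_right act_minus_left act_id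
          sum_if_outer scaleC_diff cong: if_cong)
  qed
qed

text \<open>\<open>D\<close> is total, so this is pure algebra and involves no differentiability.\<close>

lemma D_quasi_deriv:
  assumes n: "n \<ge> 1" and k: "k < 2 * n" and p0: "has_bounded_inverse (p 0 t)"
  shows "D \<Delta> (quasi_deriv act \<Delta> n p q k y) t =
    (\<Sum>j<2 * n. act (system_matrix n p q k j t) (quasi_deriv act \<Delta> n p q j y t))
     - (if Suc k = 2 * n then quasi_deriv act \<Delta> n p q (2 * n) y t else 0)"
proof -
  let ?u = "\<lambda>j. quasi_deriv act \<Delta> n p q j y"
  have low: "?u j = (D \<Delta> ^^ j) y" if "j < n" for j using that by (simp add: quasi_deriv_def)
  have upper: "?u (n + m) = upper_quasi_deriv act \<Delta> n p q y m" for m by (simp add: quasi_deriv_def)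
  \<comment> \<open>The derivative of order \<open>n\<close> is not itself a quasi-derivative; it is
    recovered by inverting \<open>p 0\<close> in the definition of the quasi-derivative of order
    \<open>n\<close>.\<close>
  have Dn: "act (bounded_inverse (p 0 t)) (?u n t + (\<i> / 2) *\<^sub>C act (q 0 t) (?u (n - 1) t)) = (D \<Delta> ^^ n) y t"
  proof -
    have "?u n t + (\<i> / 2) *\<^sub>C act (q 0 t) (?u (n - 1) t) = act (p 0 t) ((D \<Delta> ^^ n) y t)"
      using upper[of 0] low[of "n - 1"] n by simp
    then show ?thesis by (simp add: act_compose[symmetric] bounded_inverse[OF p0] act_id)
  qed
  consider "Suc k < n" | "Suc k = n" | m where "k = n + m" "m < n"
    using k by (metis add_diff_inverse_nat less_diff_conv2 linorder_not_less mult_2 nat_add_left_cancel_less not_less_eq not_less_less_Suc_eq)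
  then show ?thesis
  proof cases
    case 1
    then show ?thesis unfolding system_matrix_row[OF n k] using low[of k] low[of "Suc k"] by simp
  next
    case 2
    then show ?thesis unfolding system_matrix_row[OF n k] using low[of k] n Dn by (auto simp: numeral_2_eq_2)
  next
    case (3 m)
    \<comment> \<open>The recursion for the next upper quasi-derivative, to be solved for the
      derivative on its right. When \<open>Suc m = n\<close> this next function is
      \<open>l[y]\<close>, which explains the extra term in the last row.\<close>
    have next_eq: "?u (Suc k) t = - D \<Delta> (?u k) t + (act (p (Suc m) t) ((D \<Delta> ^^ (n - Suc m)) y t)
         + (\<i> / 2) *\<^sub>C (act (cadjoint (q m t)) ((D \<Delta> ^^ (n - Suc m + 1)) y t)
             - (if Suc m < n then act (q (Suc m) t) ((D \<Delta> ^^ (n - Suc m - 1)) y t) else 0)))"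
      using upper[of "Suc m"] upper[of m] 3 by simp
    have "2 * n - 1 - k = n - Suc m" "2 * n - k = n - m" "2 * n - 2 - k = n - Suc m - 1" "Suc k - n = Suc m" "k - n = m"
      "Suc k < 2 * n \<longleftrightarrow> Suc m < n" "Suc k = 2 * n \<longleftrightarrow> Suc m = n" "n - Suc m + 1 = n - m" "\<not> Suc k < n" "Suc k \<noteq> n"
      using 3 by auto
    note idx = this
    have w: "(if k = n then act (bounded_inverse (p 0 t)) (?u n t + (\<i> / 2) *\<^sub>C act (q 0 t) (?u (n - 1) t)) else ?u (n - m) t)
        = (D \<Delta> ^^ (n - m)) y t"
      using Dn low[of "n - m"] 3 by auto
    have eq: "?u (n - Suc m) t = (D \<Delta> ^^ (n - Suc m)) y t" "Suc m < n \<Longrightarrow> ?u (n - Suc m - 1) t = (D \<Delta> ^^ (n - Suc m - 1)) y t"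
      using low 3 n by simp_all
    have "(\<Sum>j<2 * n. act (system_matrix n p q k j t) (?u j t)) = (if Suc m < n then - ?u (Suc k) t else 0)
        + (D \<Delta> (?u k) t + ?u (Suc k) t)"
      unfolding system_matrix_row[OF n k] w next_eq idx using eq idx(9,10) by (cases "Suc m < n") simp_all
    moreover have "Suc k = 2 * n" if "\<not> Suc m < n" using that 3 by simp
    ultimately show ?thesis using idx(7) by (cases "Suc m < n") auto
  qed
qed

end

section \<open>Derivatives within the interval\<close>

context hessenberg_system
begin

text \<open>Every point of \<open>\<Delta>\<close> is a limit point of it, which is what makes
  \<open>vector_derivative\<close> within \<open>\<Delta>\<close> unique.\<close>

lemma at_within_not_bot: "t \<in> \<Delta> \<Longrightarrow> at t within \<Delta> \<noteq> bot"
proof -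
  assume t: "t \<in> \<Delta>"
  obtain c where c: "c \<in> \<Delta>" "0 < c" using nontrivial by blast
  define d where "d = max c t"
  have d: "d \<in> \<Delta>" "0 < d" "t \<le> d" using c t by (auto simp: d_def max_def)
  have "t islimpt {0..d}"
  proof (rule connected_imp_perfect)
    show "{0..d} \<noteq> {a}" for a using d(2) by (simp add: atLeastAtMost_singleton_iff)
  qed (use d nonneg[OF t] in auto)
  then show ?thesis
    using islimpt_subset[OF _ down[OF d(1)]] by (simp add: trivial_limit_within)
qed

lemma D_eqI:
  assumes t: "t \<in> \<Delta>" and eq: "\<And>s. s \<in> \<Delta> \<Longrightarrow> f s = g s"
    and g: "(g has_vector_derivative g') (at t within \<Delta>)"
  shows "(f has_vector_derivative g') (at t within \<Delta>)" "D \<Delta> f t = g'"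
proof -
  show f: "(f has_vector_derivative g') (at t within \<Delta>)"
    by (rule has_vector_derivative_transform[OF t eq g])
  show "D \<Delta> f t = g'"
    unfolding D_def by (rule vector_derivative_within[OF at_within_not_bot[OF t] f])
qed

lemma Ck_on_1I:
  assumes eq: "\<And>s. s \<in> \<Delta> \<Longrightarrow> f s = g s"
    and g: "\<And>t. t \<in> \<Delta> \<Longrightarrow> (g has_vector_derivative g' t) (at t within \<Delta>)" "continuous_on \<Delta> g'"
  shows "Ck_on 1 \<Delta> f"
proof -
  have "differentiable_in \<Delta> f"
    unfolding differentiable_in_def using D_eqI(1)[OF _ eq g(1)] by (auto intro: differentiableI_vector)
  moreover have "continuous_on \<Delta> (D \<Delta> f)"
    using g(2) D_eqI(2)[OF _ eq g(1)] by (simp cong: continuous_on_cong)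
  ultimately show ?thesis by (simp add: Ck_on_def)
qed

text \<open>Absolute continuity is used for a single interval, whence the one-element index type
  \<open>unit\<close>.\<close>

lemma locally_absolutely_continuous_on_imp_continuous_on:
  fixes f :: "real \<Rightarrow> 'a::real_normed_vector"
  assumes ac: "locally_absolutely_continuous_on \<Delta> f"
  shows "continuous_on \<Delta> f"
  unfolding continuous_on_eq_continuous_within
proof
  fix t assume t: "t \<in> \<Delta>"
  obtain c where c: "c \<in> \<Delta>" "t \<in> {0..c}" "at t within \<Delta> = at t within {0..c}"
    using at_within_eq_initial_interval[OF t] .
  have ac': "locally_absolutely_continuous_on {0..c} f"
    by (rule locally_absolutely_continuous_on_subset[OF ac down[OF c(1)]])
  have "continuous_on {0..c} f"
    unfolding continuous_on_iff
  proof (intro ballI allI impI)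
    fix x e :: real assume x: "x \<in> {0..c}" and e: "e > 0"
    obtain d where d: "d > 0"
      "\<forall>(I::unit set) l r. finite I \<longrightarrow> (\<forall>i\<in>I. 0 \<le> l i \<and> l i \<le> r i \<and> r i \<le> c) \<longrightarrow>
         (\<forall>i\<in>I. \<forall>j\<in>I. i \<noteq> j \<longrightarrow> {l i<..<r i} \<inter> {l j<..<r j} = {}) \<longrightarrow>
         (\<Sum>i\<in>I. r i - l i) < d \<longrightarrow> (\<Sum>i\<in>I. norm (f (r i) - f (l i))) < e"
      by (rule absolutely_continuous_finite_sum[OF ac' e])
    have "dist (f y) (f x) < e" if y: "y \<in> {0..c}" "dist y x < d" for y
    proof -
      have "norm (f (max x y) - f (min x y)) < e"
        using d(2)[rule_format, of UNIV "\<lambda>_. min x y" "\<lambda>_. max x y"] x y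
        by (auto simp: UNIV_unit dist_real_def min_def max_def)
      then show ?thesis by (auto simp: dist_norm min_def max_def norm_minus_commute split: if_splits)
    qed
    then show "\<exists>d>0. \<forall>y\<in>{0..c}. dist y x < d \<longrightarrow> dist (f y) (f x) < e" using d(1) by blast
  qed
  then show "continuous (at t within \<Delta>) f"
    unfolding c(3) using c(2) by (simp add: continuous_on_eq_continuous_within)
qed

end

lemma system_matrix_hessenberg_system:
  fixes p q :: "nat \<Rightarrow> real \<Rightarrow> 'h::{complex_hilbert, second_countable_topology} \<Rightarrow>\<^sub>L 'h"
  assumes n: "n \<ge> 1"
    and \<Delta>: "0 \<in> \<Delta>" "\<And>t. t \<in> \<Delta> \<Longrightarrow> 0 \<le> t" "\<And>t. t \<in> \<Delta> \<Longrightarrow> {0..t} \<subseteq> \<Delta>" "\<exists>c\<in>\<Delta>. 0 < c"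
    and p_linear: "\<And>k t. k \<le> n \<Longrightarrow> t \<in> \<Delta> \<Longrightarrow> complex_linear (p k t)"
    and q_linear: "\<And>k t. k < n \<Longrightarrow> t \<in> \<Delta> \<Longrightarrow> complex_linear (q k t)"
    and p_cont: "\<And>k. k \<le> n \<Longrightarrow> continuous_on \<Delta> (p k)"
    and q_cont: "\<And>k. k < n \<Longrightarrow> continuous_on \<Delta> (q k)"
    and p0_inverse: "\<And>t. t \<in> \<Delta> \<Longrightarrow> has_bounded_inverse (p 0 t)"
  shows "hessenberg_system (2 * n) \<Delta> (system_matrix n p q) (superdiagonal_inverse n p)"
proof
  have inv_cont: "continuous_on \<Delta> (\<lambda>t. bounded_inverse (p 0 t))"
    by (rule continuous_on_inverse_blinfun[OF p_cont[of 0]]) (use bounded_inverse p0_inverse in auto)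
  have qa_cont: "continuous_on \<Delta> (\<lambda>t. cadjoint (q k t))" if "k < n" for k
    by (rule continuous_on_cadjoint[OF q_cont[OF that] q_linear[OF that]])
  have scale: "continuous_on \<Delta> (\<lambda>t. c *\<^sub>C f t)" if "continuous_on \<Delta> f" for c and f :: "real \<Rightarrow> 'h \<Rightarrow>\<^sub>L 'h"
    by (rule bounded_linear.continuous_on[OF bounded_linear_scaleC that])
  show "continuous_on \<Delta> (system_matrix n p q k j)" if "k < 2 * n" "j < 2 * n" for k j
    unfolding system_matrix_def[abs_def]
    by (intro continuous_on_add continuous_on_if_const continuous_on_const continuous_on_minus scale
        bounded_bilinear.continuous_on[OF bounded_bilinear_blinfun_compose] inv_cont qa_cont q_cont p_cont)
      (use that n in auto)
  show "complex_linear (system_matrix n p q k j t)" if "k < 2 * n" "j < 2 * n" "t \<in> \<Delta>" for k j t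
  proof -
    have "complex_linear (bounded_inverse (p 0 t))"
      by (rule complex_linear_bounded_inverse[OF p0_inverse[OF that(3)] p_linear[OF _ that(3)]]) simp
    moreover have "complex_linear (if b then T else 0)" if "b \<Longrightarrow> complex_linear T" for b and T :: "'h \<Rightarrow>\<^sub>L 'h"
      using that by (auto intro: complex_linear_intros(1))
    ultimately show ?thesis
      unfolding system_matrix_def using that n
      by (intro complex_linear_intros(3)) (auto intro!: complex_linear_intros complex_linear_cadjoint p_linear q_linear)
  qed
  show "system_matrix n p q k j t = 0" if "Suc k < j" for k j t
  proof (cases "n \<le> k")
    case True
    \<comment> \<open>In these rows every column that occurs is either \<open>Suc k\<close> or at
      most \<open>n\<close>, also where the natural subtraction is truncated.\<close>
    with that have "j \<noteq> 2 * n - 1 - k" "j \<noteq> 2 * n - k" "j \<noteq> 2 * n - 2 - k" "j \<noteq> Suc k" "j \<noteq> n" "j \<noteq> n - 1" "j \<noteq> k - 1"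
      "Suc k \<noteq> n" "\<not> Suc k < n" by linarith+
    then show ?thesis by (simp add: system_matrix_def)
  next
    case False
    with that have "j \<noteq> Suc k" "Suc k = n \<Longrightarrow> j \<noteq> n" "Suc k = n \<Longrightarrow> j \<noteq> n - 1" "\<not> n < k" "n \<noteq> k" by linarith+
    with False show ?thesis by (simp add: system_matrix_def)
  qed
  show "continuous_on \<Delta> (superdiagonal_inverse n p k)" for k
    unfolding superdiagonal_inverse_def[abs_def] using p_cont[of 0]
    by (cases "Suc k < n"; cases "Suc k = n") (auto intro!: continuous_intros)
  show "superdiagonal_inverse n p k t o\<^sub>L system_matrix n p q k (Suc k) t = id_blinfun"
    if k: "Suc k < 2 * n" and t: "t \<in> \<Delta>" for k t
  proof -
    consider "Suc k < n" | "Suc k = n" | "n \<le> k" by linarith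
    then show ?thesis
    proof cases
      case 1
      then show ?thesis by (auto simp: superdiagonal_inverse_def system_matrix_def intro!: blinfun_eqI)
    next
      case 2
      then show ?thesis using bounded_inverse(1)[OF p0_inverse[OF t]]
        by (auto simp: superdiagonal_inverse_def system_matrix_def)
    next
      case 3
      then have "Suc k \<noteq> 2 * n - 1 - k" "Suc k \<noteq> 2 * n - k" "Suc k \<noteq> 2 * n - 2 - k" by auto
      with 3 show ?thesis
        by (auto simp: superdiagonal_inverse_def system_matrix_def blinfun.minus_left blinfun.minus_right intro!: blinfun_eqI)
    qed
  qed
qed (use n \<Delta> in auto)

theorem theorem4p6:
  fixes n :: nat and b :: ereal and \<Delta> :: "real set"
    and p q :: "nat \<Rightarrow> real \<Rightarrow> 'h::{complex_hilbert, second_countable_topology} \<Rightarrow>\<^sub>L 'h"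
    and A :: "('h L2 \<times> 'h L2) set"
  assumes n: "n \<ge> 1"
    and b: "0 < b"
    and \<Delta>: "\<Delta> = {t. 0 \<le> t \<and> ereal t < b} \<or> (b < \<infinity> \<and> \<Delta> = {t. 0 \<le> t \<and> ereal t \<le> b})"
    and p_linear: "\<And>k t. k \<le> n \<Longrightarrow> t \<in> \<Delta> \<Longrightarrow> complex_linear (p k t)"
    and q_linear: "\<And>k t. k < n \<Longrightarrow> t \<in> \<Delta> \<Longrightarrow> complex_linear (q k t)"
    and p_smooth: "\<And>k. k \<le> n \<Longrightarrow> Ck_on (n - k) \<Delta> (p k)"
    and q_smooth: "\<And>k. k < n \<Longrightarrow> Ck_on (n - k) \<Delta> (q k)"
    and p_selfadjoint: "\<And>k t. k \<le> n \<Longrightarrow> t \<in> \<Delta> \<Longrightarrow> cadjoint (p k t) = p k t"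
    and p0_inverse: "\<And>t. t \<in> \<Delta> \<Longrightarrow> has_bounded_inverse (p 0 t)"
    and A: "proper_extension b \<Delta> n p q A"
    and rho: "resolvent_set (L2_on \<Delta>) A \<noteq> {}"
  shows "\<exists>(K :: 'h L2 set) (Z :: complex \<Rightarrow> real \<Rightarrow> 'h L2 \<Rightarrow>\<^sub>L 'h).
           csubspace K \<and> complete K \<and>
           (\<forall>\<mu>\<in>resolvent_set (L2_on \<Delta>) A. fundamental_solution \<Delta> n p q \<mu> K (Z \<mu>)) \<and>
           (\<forall>t\<in>\<Delta>. \<forall>k\<le>2 * n - 1.
              vholomorphic_on (\<lambda>\<mu>. quasi_deriv_op \<Delta> n p q k (Z \<mu>) t)
                (resolvent_set (L2_on \<Delta>) A))"
proof -
  have zero: "0 \<in> \<Delta>" using \<Delta> b by (auto simp: zero_ereal_def[symmetric] less_imp_le)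
  have nonneg: "0 \<le> t" if "t \<in> \<Delta>" for t using \<Delta> that by auto
  have down: "{0..t} \<subseteq> \<Delta>" if "t \<in> \<Delta>" for t
    using \<Delta> that by (auto intro: order_le_less_trans order_trans simp flip: ereal_less_eq(3))
  \<comment> \<open>Since \<open>b\<close> may be infinite, a positive real point strictly below it
    is chosen.\<close>
  obtain c where c: "0 < ereal c" "ereal c < b" using ereal_dense2[OF b] by blast
  then have nontrivial: "\<exists>c\<in>\<Delta>. 0 < c" using \<Delta> by (auto intro!: bexI[of _ c])
  interpret hessenberg_system "2 * n" \<Delta> "system_matrix n p q" "superdiagonal_inverse n p"
    by (rule system_matrix_hessenberg_system)
      (use n zero nonneg down nontrivial p_linear q_linear p0_inverse in
        \<open>auto intro: Ck_on_imp_continuous_on p_smooth q_smooth\<close>)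
  have N1: "Suc (2 * n - 1) = 2 * n" using n by simp

  \<comment> \<open>Membership in the maximal domain yields the integral equations. All rows but the
    last follow from the classical fundamental theorem; in the last row differentiability holds only
    almost everywhere, and absolute continuity replaces it.\<close>
  have vec_Sol: "Sol (\<lambda>k. quasi_deriv_vec \<Delta> n p q k y) (L2_class \<Delta> y) (L2_class \<Delta> (l_vec \<Delta> n p q y))"
    if y: "y \<in> max_dom \<Delta> n p q" for y
  proof -
    let ?u = "\<lambda>k. quasi_deriv_vec \<Delta> n p q k y" and ?f = "l_vec \<Delta> n p q y"
    have u0: "?u 0 = y" using n by (simp add: quasi_deriv_def)
    have smooth: "Ck_on 1 \<Delta> (?u k)" if "k < 2 * n" "Suc k \<noteq> 2 * n" for k
      using y that by (auto simp: max_dom_def)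
    have ac: "locally_absolutely_continuous_on \<Delta> (?u (2 * n - 1))" using y by (simp add: max_dom_def)
    have link: "D \<Delta> (?u k) t = F k ?u t - (if Suc k = 2 * n then ?f t else 0)" if "k < 2 * n" "t \<in> \<Delta>" for k t
      unfolding F_def by (rule apply_action.D_quasi_deriv[where p = p and t = t, OF n that(1) p0_inverse[OF that(2)]])
    have der: "(?u k has_vector_derivative F k ?u t - (if Suc k = 2 * n then ?f t else 0)) (at t within \<Delta>)"
      if "k < 2 * n" "t \<in> \<Delta>" "?u k differentiable (at t within \<Delta>)" for k t
      using that(3) unfolding link[OF that(1,2), symmetric] D_def by (simp add: vector_derivative_works)
    show ?thesis
      unfolding Sol_def u0
    proof (intro conjI exI[of _ ?f] allI impI ballI)
      fix k assume k: "k < 2 * n"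
      show "continuous_on \<Delta> (?u k)"
      proof (cases "Suc k = 2 * n")
        case True
        then have "k = 2 * n - 1" by simp
        then show ?thesis using locally_absolutely_continuous_on_imp_continuous_on[OF ac] by simp
      next
        case False
        then show ?thesis by (rule Ck_on_imp_continuous_on[OF smooth[OF k]])
      qed
      fix s t assume st: "s \<in> \<Delta>" "t \<in> \<Delta>" "s \<le> t"
      have sub: "{s..t} \<subseteq> \<Delta>" by (rule interval_subset[OF st(1,2)])
      show "((\<lambda>r. F k ?u r - (if Suc k = 2 * n then ?f r else 0)) has_integral ?u k t - ?u k s) {s..t}"
      proof (cases "Suc k = 2 * n")
        case True
        then have k1: "k = 2 * n - 1" by simp
        have "AE t in lebesgue. t \<in> \<Delta> \<longrightarrow> ?u k differentiable (at t within \<Delta>)"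
          using y unfolding k1 by (simp add: max_dom_def)
        then obtain E where E: "{t \<in> space lebesgue. \<not> (t \<in> \<Delta> \<longrightarrow> ?u k differentiable (at t within \<Delta>))} \<subseteq> E"
          "emeasure lebesgue E = 0" "E \<in> sets lebesgue"
          by (rule AE_E)
        have "negligible E" using E(2,3) by (simp add: negligible_iff_null_sets null_sets_def)
        moreover have "(?u k has_vector_derivative F k ?u r - (if Suc k = 2 * n then ?f r else 0)) (at r within {s..t})"
          if r: "r \<in> {s..t} - E" for r
        proof -
          have "r \<in> \<Delta>" using r sub by blast
          then have "?u k differentiable (at r within \<Delta>)" using E(1) r by auto
          from has_vector_derivative_within_subset[OF der[OF k \<open>r \<in> \<Delta>\<close> this] sub] show ?thesis .
        qed
        ultimately show ?thesis
          using locally_absolutely_continuous_on_subset[OF ac sub] st(3) unfolding k1[symmetric]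
          by (intro absolutely_continuous_fundamental_theorem)
      next
        case False
        have "?u k differentiable (at r within \<Delta>)" if "r \<in> \<Delta>" for r
          using smooth[OF k False] that by (auto simp: Ck_on_def differentiable_in_def)
        then show ?thesis
          using sub by (intro fundamental_theorem_of_calculus st(3))
            (blast intro: has_vector_derivative_within_subset[OF der[OF k]])
      qed
    qed (use y in \<open>simp_all add: max_dom_def\<close>)
  qed

  obtain \<nu> where \<nu>: "\<nu> \<in> resolvent_set (L2_on \<Delta>) A" using rho by blast
  obtain P where P: "complex_linear P" "\<And>x. blinfun_apply P x \<in> eigenspace \<nu>" "\<And>x. x \<in> eigenspace \<nu> \<Longrightarrow> P x = x"
      "\<And>x. (\<forall>k\<in>eigenspace \<nu>. cinner x k = 0) \<Longrightarrow> P x = 0"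
    using orthogonal_projection[OF csubspace_eigenspace complete_eigenspace, of \<nu>] by metis
  have A_closed: "closed_operator_in (L2_on \<Delta>) A" and A_max: "A \<subseteq> max_op \<Delta> n p q"
    using A by (auto simp: proper_extension_def)
  interpret hessenberg_family "2 * n" \<Delta> "system_matrix n p q" "superdiagonal_inverse n p" A \<nu> P
  proof
    show "(u + v, f + g) \<in> A" if "(u, f) \<in> A" "(v, g) \<in> A" for u v f g
      using A_closed that by (simp add: closed_operator_in_def)
    show "(c *\<^sub>C u, c *\<^sub>C f) \<in> A" if "(u, f) \<in> A" for c u f
      using A_closed that by (simp add: closed_operator_in_def)
    show "\<exists>u. Sol u v w" if vw: "(v, w) \<in> A" for v w
    proof -
      obtain y where "v = L2_class \<Delta> y" "w = L2_class \<Delta> (l_vec \<Delta> n p q y)" "y \<in> max_dom \<Delta> n p q"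
        using vw A_max unfolding max_op_def by blast
      then show ?thesis using vec_Sol by blast
    qed
  qed (use \<nu> P in auto)

  \<comment> \<open>The derivative of quasi-derivative \<open>m\<close> is computed twice, through
    \<open>Z_derivative\<close> and through the formal identity \<open>D_quasi_deriv\<close>. Terms
    up to \<open>m\<close> agree by induction, and the left inverse of the superdiagonal entry
    identifies the next one. The induction hypothesis is needed at all points of
    \<open>\<Delta>\<close>, because it is differentiated.\<close>
  have op: "quasi_deriv_op \<Delta> n p q k (Z 0 \<mu>) t = Z k \<mu> t"
    if \<mu>: "\<mu> \<in> \<rho>" and "k < 2 * n" "t \<in> \<Delta>" for \<mu> k t
    using that(2,3)
  proof (induction k arbitrary: t rule: less_induct)
    case (less k)
    let ?u = "\<lambda>j. quasi_deriv_op \<Delta> n p q j (Z 0 \<mu>)"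
    show ?case
    proof (cases k)
      case 0
      then show ?thesis using n by (simp add: quasi_deriv_def)
    next
      case (Suc m)
      have m: "m < 2 * n" "Suc m < 2 * n" using less.prems Suc by auto
      have eq: "?u j s = Z j \<mu> s" if "j \<le> m" "s \<in> \<Delta>" for j s
        using less.IH[of j s] that Suc m by simp
      have "D \<Delta> (?u m) t = Psi \<mu> m (\<lambda>k. Z k \<mu>) t"
        by (rule D_eqI(2)[OF less.prems(2) eq Z_derivative(1)[OF \<mu> m(1) less.prems(2)]]) simp_all
      moreover have "D \<Delta> (?u m) t = (\<Sum>j<2 * n. system_matrix n p q m j t o\<^sub>L ?u j t)"
        using compose_action.D_quasi_deriv[where p = p and t = t, OF n m(1)] p0_inverse[OF less.prems(2)] m by simp
      ultimately have sums: "(\<Sum>j<2 * n. system_matrix n p q m j t o\<^sub>L ?u j t) = (\<Sum>j<2 * n. system_matrix n p q m j t o\<^sub>L Z j \<mu> t)"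
        using m by (simp add: Psi_def)
      have trunc: "(\<Sum>j<2 * n. system_matrix n p q m j t o\<^sub>L G j) = (\<Sum>j\<le>m. system_matrix n p q m j t o\<^sub>L G j) + (system_matrix n p q m (Suc m) t o\<^sub>L G (Suc m))"
        for G :: "nat \<Rightarrow> 'h L2 \<Rightarrow>\<^sub>L 'h"
      proof -
        have "(\<Sum>j<2 * n. system_matrix n p q m j t o\<^sub>L G j) = (\<Sum>j\<le>Suc m. system_matrix n p q m j t o\<^sub>L G j)"
          using m by (intro sum.mono_neutral_right) (auto simp: M_zero intro: blinfun_eqI)
        then show ?thesis by simp
      qed
      have "system_matrix n p q m (Suc m) t o\<^sub>L ?u (Suc m) t = system_matrix n p q m (Suc m) t o\<^sub>L Z (Suc m) \<mu> t"
        using sums unfolding trunc using eq less.prems(2) by simp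
      moreover have "superdiagonal_inverse n p m t o\<^sub>L (system_matrix n p q m (Suc m) t o\<^sub>L T) = T" for T :: "'h L2 \<Rightarrow>\<^sub>L 'h"
        unfolding compose_action.act_compose[symmetric] B_inv[OF m(2) less.prems(2)] by (rule compose_action.act_id)
      ultimately show ?thesis unfolding Suc by metis
    qed
  qed

  have "fundamental_solution \<Delta> n p q \<mu> (eigenspace \<nu>) (Z 0 \<mu>)" if \<mu>: "\<mu> \<in> \<rho>" for \<mu>
    unfolding fundamental_solution_def operator_solution_def
  proof (intro conjI ballI allI impI)
    show "Z 0 \<mu> t \<in> ops_on (eigenspace \<nu>)" if "t \<in> \<Delta>" for t
      using Z_ops_on[OF \<mu> _ that] n by simp
    show "in_L2 \<Delta> (\<lambda>t. Z 0 \<mu> t h)" for h by (rule Z_in_L2(1)[OF \<mu>])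
    show "Ck_on 1 \<Delta> (quasi_deriv_op \<Delta> n p q k (Z 0 \<mu>))" if "k \<le> 2 * n - 1" for k
    proof -
      have k: "k < 2 * n" using that n by simp
      show ?thesis
        by (rule Ck_on_1I[OF op[OF \<mu> k] Z_derivative(1)[OF \<mu> k]])
          (use Z_derivative(2)[OF \<mu> k] in \<open>auto simp: continuous_on_eq_continuous_within\<close>)
    qed
    show "l_op \<Delta> n p q (Z 0 \<mu>) t - \<mu> *\<^sub>C Z 0 \<mu> t = 0" if t: "t \<in> \<Delta>" for t
    proof -
      let ?u = "\<lambda>j. quasi_deriv_op \<Delta> n p q j (Z 0 \<mu>)"
      have k: "2 * n - 1 < 2 * n" using n by simp
      \<comment> \<open>In the last row one computation of this derivative contains
        \<open>\<mu> *\<^sub>C Z 0 \<mu> t\<close> and the other \<open>l_op\<close>; comparing them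
        gives the equation pointwise.\<close>
      have "D \<Delta> (?u (2 * n - 1)) t = Psi \<mu> (2 * n - 1) (\<lambda>k. Z k \<mu>) t"
        by (rule D_eqI(2)[OF t op[OF \<mu> k] Z_derivative(1)[OF \<mu> k t]])
      also have "\<dots> = (\<Sum>j<2 * n. system_matrix n p q (2 * n - 1) j t o\<^sub>L ?u j t) - \<mu> *\<^sub>C Z 0 \<mu> t"
        unfolding Psi_def N1 using op[OF \<mu> _ t] by simp
      finally show ?thesis
        using compose_action.D_quasi_deriv[where p = p and t = t and \<Delta> = \<Delta> and q = q and y = "Z 0 \<mu>", OF n k] p0_inverse[OF t] N1 by simp
    qed
    show "\<exists>!h. h \<in> eigenspace \<nu> \<and> (\<forall>t\<in>\<Delta>. y t = Z 0 \<mu> t h)" if y: "y \<in> defect_space \<Delta> n p q \<mu>" for y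
    proof -
      \<comment> \<open>An element of the defect space satisfies the equation between classes, which
        is exactly what \<open>Sol\<close> records.\<close>
      have "Sol (\<lambda>k. quasi_deriv_vec \<Delta> n p q k y) (L2_class \<Delta> y) (\<mu> *\<^sub>C L2_class \<Delta> y)"
        using vec_Sol[of y] y by (simp add: defect_space_def)
      from Z_represents[OF \<mu> this] show ?thesis using n by (simp add: quasi_deriv_def)
    qed
  qed
  moreover have "vholomorphic_on (\<lambda>\<mu>. quasi_deriv_op \<Delta> n p q k (Z 0 \<mu>) t) \<rho>"
    if "t \<in> \<Delta>" "k \<le> 2 * n - 1" for t k
  proof -
    have k: "k < 2 * n" using that n by simp
    show ?thesis
      \<comment> \<open>The limits are taken within the resolvent set, so agreement of the two
        functions there is enough.\<close>
      using Z_holomorphic[OF k that(1)] op[OF _ k that(1)]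
      by (simp add: vholomorphic_on_def cong: Lim_cong_within)
  qed
  ultimately show ?thesis
    using csubspace_eigenspace complete_eigenspace by (intro exI[of _ "eigenspace \<nu>"] exI[of _ "Z 0"]) blast
qed

end
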